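(* Let $\mathrm{d}+A$ be an $\mathfrak{sl}_2$-connection that is irregular of Poisson order $1$ with diagonalizable irregular term, i.e. $A_k=0$ for $k>1$, $A_1=\mathrm{diag}(\xi,-\xi)$ with $\xi\neq0$, and $A_k\in\mathfrak{sl}_2$ arbitrary for $k\leq 0$. The induction functor $$\mathrm{Ind}:\ \mathrm{Rep}(\mathcal{SF}_{\mathrm{d}+A}^{01})\longrightarrow\mathrm{Rep}(\mathcal{SF}_{\mathrm{d}+A})$$ is fully faithful. Hence the full subcategory $\mathcal{C}$ of representations in the image of $\mathrm{Ind}$ is equivalent to the category of representations of $\mathcal{SF}_{\mathrm{d}+A}^{01}$. In particular, the simple objects in $\mathcal{C}$ are precisely the induced modules $\mathrm{Ind}(V^{01})$ for $V^{01}$ a simple $\mathcal{SF}_{\mathrm{d}+A}^{01}$-module.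
   Context: All algebras are over $\mathbb{C}$. Indices $a,b\in\{+,-\}$; $\mathbb{C}^2$ has basis $e^+,e^-$ and symplectic form $(e^+,e^-)=1=-(e^-,e^+)$, $(e^\pm,e^\pm)=0$. Connection: $\mathrm{d}+A$ with $A(z)=\sum_{k}A_kz^{-k-1}$, $A_k\in\mathfrak{sl}_2(\mathbb{C})$. Put $C_k=\begin{pmatrix}0&-1\\1&0\end{pmatrix}A_k$ (rows and columns indexed by $+,-$ in this order), a symmetric matrix with entries $C_k^{ab}$. Thus $C_1=\begin{pmatrix}0&\xi\\\xi&0\end{pmatrix}$ and $C_k=0$ for $k>1$. $\mathcal{SF}_{\mathrm{d}+A}$ is the unital associative (Clifford) algebra with generators $\psi^\pm_n$, $n\in\mathbb{Z}$, and relations $\{\psi^a_m,\psi^b_n\}=m\,(e^a,e^b)\,\delta_{m+n,0}+C_{m+n}^{ab}$, where $\{x,y\}=xy+yx$. Let $\mathcal{SF}_{\mathrm{d}+A}^{\geq 0}$, $\mathcal{SF}_{\mathrm{d}+A}^{\geq 2}$, $\mathcal{SF}_{\mathrm{d}+A}^{01}$ be the subalgebras generated by the $\psi_n^\pm$ with $n\geq0$, $n\geq 2$, $n\in\{0,1\}$ respectively. $\mathrm{Rep}$ denotes the category of left modules. Given a representation $V^{01}$ of $\mathcal{SF}_{\mathrm{d}+A}^{01}$, extend it to $\mathcal{SF}_{\mathrm{d}+A}^{\geq0}$ by letting $\psi_n^\pm$, $n\geq2$, act by zero (consistent, since these generators anticommute with each other and with $\psi_0^\pm,\psi_1^\pm$),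 and set $\mathrm{Ind}(V^{01})=\mathcal{SF}_{\mathrm{d}+A}\otimes_{\mathcal{SF}_{\mathrm{d}+A}^{\geq 0}}V^{01}$. *)

theory Defs
  imports
    "HOL-Analysis.Determinants"
    "HOL-Algebra.QuotRing"
    "HOL-Algebra.Generated_Rings"
    "HOL-Algebra.Free_Abelian_Groups"
begin

section \<open>Categories\<close>

text \<open>
  Hom-sets of different pairs of objects need not be disjoint, so composition and the
  action of a functor on morphisms take the objects involved as arguments:
  \<open>Comp C X Y Z g f\<close> is the composite of \<open>f\<close> from \<open>X\<close> to \<open>Y\<close> with \<open>g\<close> from \<open>Y\<close> to \<open>Z\<close>.
\<close>

record ('o, 'm) category =
  Obj :: "'o set"
  Hom :: "'o \<Rightarrow> 'o \<Rightarrow> 'm set"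
  Id :: "'o \<Rightarrow> 'm"
  Comp :: "'o \<Rightarrow> 'o \<Rightarrow> 'o \<Rightarrow> 'm \<Rightarrow> 'm \<Rightarrow> 'm"

locale category =
  fixes C :: "('o, 'm) category"
  assumes Id_in: "X \<in> Obj C \<Longrightarrow> Id C X \<in> Hom C X X"
    and Comp_in: "\<lbrakk>X \<in> Obj C; Y \<in> Obj C; Z \<in> Obj C; f \<in> Hom C X Y; g \<in> Hom C Y Z\<rbrakk>
      \<Longrightarrow> Comp C X Y Z g f \<in> Hom C X Z"
    and Comp_Id_right: "\<lbrakk>X \<in> Obj C; Y \<in> Obj C; f \<in> Hom C X Y\<rbrakk> \<Longrightarrow> Comp C X X Y f (Id C X) = f"
    and Comp_Id_left: "\<lbrakk>X \<in> Obj C; Y \<in> Obj C; f \<in> Hom C X Y\<rbrakk> \<Longrightarrow> Comp C X Y Y (Id C Y) f = f"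
    and Comp_assoc: "\<lbrakk>W \<in> Obj C; X \<in> Obj C; Y \<in> Obj C; Z \<in> Obj C;
        f \<in> Hom C W X; g \<in> Hom C X Y; h \<in> Hom C Y Z\<rbrakk>
      \<Longrightarrow> Comp C W Y Z h (Comp C W X Y g f) = Comp C W X Z (Comp C X Y Z h g) f"

definition iso_in :: "('o, 'm) category \<Rightarrow> 'o \<Rightarrow> 'o \<Rightarrow> 'm \<Rightarrow> bool" where
  "iso_in C X Y f \<longleftrightarrow> f \<in> Hom C X Y \<and>
    (\<exists>g\<in>Hom C Y X. Comp C X Y X g f = Id C X \<and> Comp C Y X Y f g = Id C Y)"

definition isomorphic_in :: "('o, 'm) category \<Rightarrow> 'o \<Rightarrow> 'o \<Rightarrow> bool" where
  "isomorphic_in C X Y \<longleftrightarrow> (\<exists>f. iso_in C X Y f)"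

definition mono_in :: "('o, 'm) category \<Rightarrow> 'o \<Rightarrow> 'o \<Rightarrow> 'm \<Rightarrow> bool" where
  "mono_in C X Y f \<longleftrightarrow> f \<in> Hom C X Y \<and>
    (\<forall>Z\<in>Obj C. \<forall>g\<in>Hom C Z X. \<forall>h\<in>Hom C Z X. Comp C Z X Y f g = Comp C Z X Y f h \<longrightarrow> g = h)"

definition zero_object :: "('o, 'm) category \<Rightarrow> 'o \<Rightarrow> bool" where
  "zero_object C Z \<longleftrightarrow> Z \<in> Obj C \<and>
    (\<forall>X\<in>Obj C. (\<exists>!f. f \<in> Hom C Z X) \<and> (\<exists>!f. f \<in> Hom C X Z))"

definition simple_object :: "('o, 'm) category \<Rightarrow> 'o \<Rightarrow> bool" where
  "simple_object C X \<longleftrightarrow> X \<in> Obj C \<and> \<not> zero_object C X \<and>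
    (\<forall>Y\<in>Obj C. \<forall>f. mono_in C Y X f \<longrightarrow> zero_object C Y \<or> iso_in C Y X f)"

definition full_subcategory :: "('o, 'm) category \<Rightarrow> 'o set \<Rightarrow> ('o, 'm) category" where
  "full_subcategory C S = C\<lparr>Obj := Obj C \<inter> S\<rparr>"

record ('o, 'm, 'p, 'n) cat_functor =
  fobj :: "'o \<Rightarrow> 'p"
  fmor :: "'o \<Rightarrow> 'o \<Rightarrow> 'm \<Rightarrow> 'n"

locale is_functor = C: category C + D: category D
  for C :: "('o, 'm) category" and D :: "('p, 'n) category" +
  fixes F :: "('o, 'm, 'p, 'n) cat_functor"
  assumes fobj_in: "X \<in> Obj C \<Longrightarrow> fobj F X \<in> Obj D"
    and fmor_in: "\<lbrakk>X \<in> Obj C; Y \<in> Obj C; f \<in> Hom C X Y\<rbrakk>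
      \<Longrightarrow> fmor F X Y f \<in> Hom D (fobj F X) (fobj F Y)"
    and fmor_Id: "X \<in> Obj C \<Longrightarrow> fmor F X X (Id C X) = Id D (fobj F X)"
    and fmor_Comp: "\<lbrakk>X \<in> Obj C; Y \<in> Obj C; Z \<in> Obj C; f \<in> Hom C X Y; g \<in> Hom C Y Z\<rbrakk>
      \<Longrightarrow> fmor F X Z (Comp C X Y Z g f) =
          Comp D (fobj F X) (fobj F Y) (fobj F Z) (fmor F Y Z g) (fmor F X Y f)"

definition fully_faithful ::
  "('o, 'm) category \<Rightarrow> ('p, 'n) category \<Rightarrow> ('o, 'm, 'p, 'n) cat_functor \<Rightarrow> bool" where
  "fully_faithful C D F \<longleftrightarrow> is_functor C D F \<and>
    (\<forall>X\<in>Obj C. \<forall>Y\<in>Obj C. bij_betw (fmor F X Y) (Hom C X Y) (Hom D (fobj F X) (fobj F Y)))"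

definition essential_image ::
  "('o, 'm) category \<Rightarrow> ('p, 'n) category \<Rightarrow> ('o, 'm, 'p, 'n) cat_functor \<Rightarrow> 'p set" where
  "essential_image C D F = {Y \<in> Obj D. \<exists>X\<in>Obj C. isomorphic_in D Y (fobj F X)}"

definition id_functor :: "('o, 'm, 'o, 'm) cat_functor" where
  "id_functor = \<lparr>fobj = (\<lambda>X. X), fmor = (\<lambda>X Y f. f)\<rparr>"

definition comp_functor ::
  "('p, 'n, 'q, 'k) cat_functor \<Rightarrow> ('o, 'm, 'p, 'n) cat_functor \<Rightarrow> ('o, 'm, 'q, 'k) cat_functor" where
  "comp_functor G F =
    \<lparr>fobj = (\<lambda>X. fobj G (fobj F X)),
     fmor = (\<lambda>X Y f. fmor G (fobj F X) (fobj F Y) (fmor F X Y f))\<rparr>"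

definition natural_iso ::
  "('o, 'm) category \<Rightarrow> ('p, 'n) category \<Rightarrow> ('o, 'm, 'p, 'n) cat_functor
    \<Rightarrow> ('o, 'm, 'p, 'n) cat_functor \<Rightarrow> ('o \<Rightarrow> 'n) \<Rightarrow> bool" where
  "natural_iso C D F G \<eta> \<longleftrightarrow>
    (\<forall>X\<in>Obj C. iso_in D (fobj F X) (fobj G X) (\<eta> X)) \<and>
    (\<forall>X\<in>Obj C. \<forall>Y\<in>Obj C. \<forall>f\<in>Hom C X Y.
      Comp D (fobj F X) (fobj F Y) (fobj G Y) (\<eta> Y) (fmor F X Y f) =
      Comp D (fobj F X) (fobj G X) (fobj G Y) (fmor G X Y f) (\<eta> X))"

definition equivalence_of_categories ::
  "('o, 'm) category \<Rightarrow> ('p, 'n) category \<Rightarrow> ('o, 'm, 'p, 'n) cat_functor \<Rightarrow> bool" where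
  "equivalence_of_categories C D F \<longleftrightarrow> is_functor C D F \<and>
    (\<exists>G. is_functor D C G \<and>
      (\<exists>\<eta>. natural_iso C C (comp_functor G F) id_functor \<eta>) \<and>
      (\<exists>\<epsilon>. natural_iso D D (comp_functor F G) id_functor \<epsilon>))"


section \<open>Left modules over noncommutative rings\<close>

text \<open>
  The library locale \<open>module\<close> requires a commutative base ring. As usual for its record type,
  the fields \<open>mult\<close> and \<open>one\<close> of the module are irrelevant. A left module over (the underlying
  ring of) a unital complex algebra is the same as a left module over the algebra.
\<close>

locale left_module = R?: ring R + M?: abelian_group M
  for R :: "('r, 'a) ring_scheme" (structure) and M :: "('r, 'v, 'b) module_scheme" (structure) +
  assumes smult_closed: "\<lbrakk>a \<in> carrier R; x \<in> carrier M\<rbrakk> \<Longrightarrow> a \<odot>\<^bsub>M\<^esub> x \<in> carrier M"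
    and smult_l_distr: "\<lbrakk>a \<in> carrier R; b \<in> carrier R; x \<in> carrier M\<rbrakk>
      \<Longrightarrow> (a \<oplus>\<^bsub>R\<^esub> b) \<odot>\<^bsub>M\<^esub> x = a \<odot>\<^bsub>M\<^esub> x \<oplus>\<^bsub>M\<^esub> b \<odot>\<^bsub>M\<^esub> x"
    and smult_r_distr: "\<lbrakk>a \<in> carrier R; x \<in> carrier M; y \<in> carrier M\<rbrakk>
      \<Longrightarrow> a \<odot>\<^bsub>M\<^esub> (x \<oplus>\<^bsub>M\<^esub> y) = a \<odot>\<^bsub>M\<^esub> x \<oplus>\<^bsub>M\<^esub> a \<odot>\<^bsub>M\<^esub> y"
    and smult_assoc: "\<lbrakk>a \<in> carrier R; b \<in> carrier R; x \<in> carrier M\<rbrakk>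
      \<Longrightarrow> (a \<otimes>\<^bsub>R\<^esub> b) \<odot>\<^bsub>M\<^esub> x = a \<odot>\<^bsub>M\<^esub> (b \<odot>\<^bsub>M\<^esub> x)"
    and smult_one: "x \<in> carrier M \<Longrightarrow> \<one>\<^bsub>R\<^esub> \<odot>\<^bsub>M\<^esub> x = x"

definition simple_module :: "('r, 'a) ring_scheme \<Rightarrow> ('r, 'v, 'b) module_scheme \<Rightarrow> bool" where
  "simple_module R M \<longleftrightarrow> left_module R M \<and> carrier M \<noteq> {\<zero>\<^bsub>M\<^esub>} \<and>
    (\<forall>N. submodule N R M \<longrightarrow> N = {\<zero>\<^bsub>M\<^esub>} \<or> N = carrier M)"

definition module_hom ::
  "('r, 'a) ring_scheme \<Rightarrow> ('r, 'v, 'b) module_scheme \<Rightarrow> ('r, 'w, 'c) module_scheme \<Rightarrow> ('v \<Rightarrow> 'w) set" where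
  "module_hom R M N = {f \<in> carrier M \<rightarrow>\<^sub>E carrier N.
    (\<forall>x\<in>carrier M. \<forall>y\<in>carrier M. f (x \<oplus>\<^bsub>M\<^esub> y) = f x \<oplus>\<^bsub>N\<^esub> f y) \<and>
    (\<forall>a\<in>carrier R. \<forall>x\<in>carrier M. f (a \<odot>\<^bsub>M\<^esub> x) = a \<odot>\<^bsub>N\<^esub> f x)}"

text \<open>The category of those left \<open>R\<close>-modules whose carrier is a subset of the type \<open>'v\<close>.\<close>

definition Rep :: "('r, 'a) ring_scheme \<Rightarrow> (('r, 'v) module, 'v \<Rightarrow> 'v) category" where
  "Rep R =
    \<lparr>Obj = {M. left_module R M},
     Hom = module_hom R,
     Id = (\<lambda>M. \<lambda>x\<in>carrier M. x),
     Comp = (\<lambda>L M N g f. compose (carrier L) g f)\<rparr>"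


section \<open>Extension of scalars\<close>

text \<open>
  For a subset \<open>B\<close> of \<open>R\<close> forming a subring and a \<open>B\<close>-module \<open>V\<close>, the tensor product of \<open>R\<close>
  and \<open>V\<close> over \<open>B\<close> is the free abelian group on the pairs \<open>(x, v)\<close> modulo biadditivity and
  \<open>B\<close>-balancedness, with \<open>R\<close> acting on the left factor. Its elements are cosets of finitely
  supported integer-valued functions.
\<close>

type_synonym ('r, 'v) tensor = "('r \<times> 'v \<Rightarrow>\<^sub>0 int) set"

abbreviation pair_group ::
  "('r, 'a) ring_scheme \<Rightarrow> ('r, 'v, 'b) module_scheme \<Rightarrow> ('r \<times> 'v \<Rightarrow>\<^sub>0 int) monoid" where
  "pair_group R V \<equiv> free_Abelian_group (carrier R \<times> carrier V)"

definition tensor_relations ::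
  "('r, 'a) ring_scheme \<Rightarrow> 'r set \<Rightarrow> ('r, 'v, 'b) module_scheme \<Rightarrow> ('r \<times> 'v \<Rightarrow>\<^sub>0 int) set" where
  "tensor_relations R B V = generate (pair_group R V)
    ({frag_of (x \<oplus>\<^bsub>R\<^esub> y, v) - frag_of (x, v) - frag_of (y, v) | x y v.
        x \<in> carrier R \<and> y \<in> carrier R \<and> v \<in> carrier V} \<union>
     {frag_of (x, v \<oplus>\<^bsub>V\<^esub> w) - frag_of (x, v) - frag_of (x, w) | x v w.
        x \<in> carrier R \<and> v \<in> carrier V \<and> w \<in> carrier V} \<union>
     {frag_of (x \<otimes>\<^bsub>R\<^esub> b, v) - frag_of (x, b \<odot>\<^bsub>V\<^esub> v) | x b v.
        x \<in> carrier R \<and> b \<in> B \<and> v \<in> carrier V})"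

definition induced_module ::
  "('r, 'a) ring_scheme \<Rightarrow> 'r set \<Rightarrow> ('r, 'v, 'b) module_scheme \<Rightarrow> ('r, ('r, 'v) tensor) module" where
  "induced_module R B V =
    (let N = tensor_relations R B V; T = pair_group R V Mod N in
     \<lparr>carrier = carrier T, monoid.mult = undefined, one = undefined,
      ring.zero = \<one>\<^bsub>T\<^esub>, ring.add = monoid.mult T,
      smult = (\<lambda>a S. \<Union>u\<in>S.
        N #>\<^bsub>pair_group R V\<^esub> frag_extend (\<lambda>(x, v). frag_of (a \<otimes>\<^bsub>R\<^esub> x, v)) u)\<rparr>)"

definition induced_map ::
  "('r, 'a) ring_scheme \<Rightarrow> 'r set \<Rightarrow> ('r, 'v, 'b) module_scheme \<Rightarrow> ('r, 'w, 'c) module_scheme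
    \<Rightarrow> ('v \<Rightarrow> 'w) \<Rightarrow> ('r, 'v) tensor \<Rightarrow> ('r, 'w) tensor" where
  "induced_map R B V W f = (\<lambda>S\<in>carrier (induced_module R B V). \<Union>u\<in>S.
    tensor_relations R B W #>\<^bsub>pair_group R W\<^esub> frag_extend (\<lambda>(x, v). frag_of (x, f v)) u)"


section \<open>The free algebra\<close>

text \<open>
  With concatenation of words as (noncommutative) addition, the convolution product of
  finitely supported functions on words is the product of the free algebra.
\<close>

datatype 'g free_word = Word (letters: "'g list")

instantiation free_word :: (type) monoid_add
begin

definition zero_free_word :: "'a free_word" where
  "0 = Word []"

definition plus_free_word :: "'a free_word \<Rightarrow> 'a free_word \<Rightarrow> 'a free_word" where
  "u + v = Word (letters u @ letters v)"

instance
  by standard (simp_all add: zero_free_word_def plus_free_word_def)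

end

type_synonym 'g free_alg = "'g free_word \<Rightarrow>\<^sub>0 complex"

definition free_gen :: "'g \<Rightarrow> 'g free_alg" where
  "free_gen g = Poly_Mapping.single (Word [g]) 1"

definition free_scalar :: "complex \<Rightarrow> 'g free_alg" where
  "free_scalar c = Poly_Mapping.single 0 c"

definition free_algebra :: "'g free_alg ring" where
  "free_algebra = \<lparr>carrier = UNIV, monoid.mult = (*), one = 1, ring.zero = 0, ring.add = (+)\<rparr>"


section \<open>Symplectic fermions on a connection\<close>

datatype sign = Plus | Minus

instance sign :: finite
proof
  have "(UNIV :: sign set) = {Plus, Minus}"
    using sign.exhaust by auto
  then show "finite (UNIV :: sign set)"
    by (metis finite.emptyI finite.insertI)
qed

type_synonym sign_matrix = "complex ^ sign ^ sign"

definition matrix2 :: "complex \<Rightarrow> complex \<Rightarrow> complex \<Rightarrow> complex \<Rightarrow> sign_matrix" where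
  "matrix2 p q r s = (\<chi> a b. case (a, b) of
    (Plus, Plus) \<Rightarrow> p | (Plus, Minus) \<Rightarrow> q | (Minus, Plus) \<Rightarrow> r | (Minus, Minus) \<Rightarrow> s)"

definition sl2 :: "sign_matrix set" where
  "sl2 = {M. trace M = 0}"

definition symp :: "sign \<Rightarrow> sign \<Rightarrow> complex" where
  "symp a b = matrix2 0 1 (-1) 0 $ a $ b"

text \<open>A connection is given by its coefficients \<open>A k\<close>, where \<open>A(z)\<close> is the sum of \<open>A k z\<^bsup>-k-1\<^esup>\<close>.\<close>

definition conn_form :: "(int \<Rightarrow> sign_matrix) \<Rightarrow> int \<Rightarrow> sign_matrix" where
  "conn_form A k = matrix2 0 (-1) 1 0 ** A k"

definition SF_relations :: "(int \<Rightarrow> sign_matrix) \<Rightarrow> (sign \<times> int) free_alg set" where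
  "SF_relations A =
    {free_gen (a, m) * free_gen (b, n) + free_gen (b, n) * free_gen (a, m)
       - free_scalar ((if m + n = 0 then of_int m * symp a b else 0) + conn_form A (m + n) $ a $ b)
     | a b m n. True}"

type_synonym sf = "(sign \<times> int) free_alg set"

definition SF_ideal :: "(int \<Rightarrow> sign_matrix) \<Rightarrow> (sign \<times> int) free_alg set" where
  "SF_ideal A = genideal free_algebra (SF_relations A)"

definition SF :: "(int \<Rightarrow> sign_matrix) \<Rightarrow> sf ring" where
  "SF A = free_algebra Quot SF_ideal A"

definition SF_scalar :: "(int \<Rightarrow> sign_matrix) \<Rightarrow> complex \<Rightarrow> sf" where
  "SF_scalar A c = SF_ideal A +>\<^bsub>free_algebra\<^esub> free_scalar c"

definition \<psi> :: "(int \<Rightarrow> sign_matrix) \<Rightarrow> sign \<Rightarrow> int \<Rightarrow> sf" where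
  "\<psi> A a n = SF_ideal A +>\<^bsub>free_algebra\<^esub> free_gen (a, n)"

text \<open>
  The unital complex subalgebra generated by the modes \<open>\<psi> A a n\<close> with \<open>n \<in> I\<close>, that is,
  the subring generated by these modes and the scalars.
\<close>

definition SF_modes :: "(int \<Rightarrow> sign_matrix) \<Rightarrow> int set \<Rightarrow> sf set" where
  "SF_modes A I = generate_ring (SF A) (range (SF_scalar A) \<union> {\<psi> A a n | a n. n \<in> I})"

definition SF_sub :: "(int \<Rightarrow> sign_matrix) \<Rightarrow> int set \<Rightarrow> sf ring" where
  "SF_sub A I = (SF A)\<lparr>carrier := SF_modes A I\<rparr>"

abbreviation SF_ge0 :: "(int \<Rightarrow> sign_matrix) \<Rightarrow> sf ring" where
  "SF_ge0 A \<equiv> SF_sub A {0..}"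

abbreviation SF01 :: "(int \<Rightarrow> sign_matrix) \<Rightarrow> sf ring" where
  "SF01 A \<equiv> SF_sub A {0, 1}"

text \<open>
  The action of the modes \<open>n \<ge> 0\<close> on a module \<open>V\<close> over the modes \<open>n \<in> {0, 1}\<close>: the module
  structure on the abelian group \<open>V\<close> that restricts to the given one and for which the modes
  \<open>n \<ge> 2\<close> act by zero. Generators determine it on the carriers; requiring the value
  \<open>undefined\<close> elsewhere makes it unique as a function.
\<close>

definition extended_action ::
  "(int \<Rightarrow> sign_matrix) \<Rightarrow> (sf, 'v) module \<Rightarrow> sf \<Rightarrow> 'v \<Rightarrow> 'v" where
  "extended_action A V = (THE \<rho>.
    left_module (SF_ge0 A) (V\<lparr>smult := \<rho>\<rparr>) \<and>
    (\<forall>x\<in>carrier (SF01 A). \<forall>v\<in>carrier V. \<rho> x v = x \<odot>\<^bsub>V\<^esub> v) \<and>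
    (\<forall>a. \<forall>n\<ge>2. \<forall>v\<in>carrier V. \<rho> (\<psi> A a n) v = \<zero>\<^bsub>V\<^esub>) \<and>
    (\<forall>x v. x \<notin> carrier (SF_ge0 A) \<or> v \<notin> carrier V \<longrightarrow> \<rho> x v = undefined))"

definition extend_by_zero :: "(int \<Rightarrow> sign_matrix) \<Rightarrow> (sf, 'v) module \<Rightarrow> (sf, 'v) module" where
  "extend_by_zero A V = V\<lparr>smult := extended_action A V\<rparr>"

type_synonym 'v ind_functor =
  "((sf, 'v) module, 'v \<Rightarrow> 'v, (sf, (sf, 'v) tensor) module, (sf, 'v) tensor \<Rightarrow> (sf, 'v) tensor)
    cat_functor"

definition Ind :: "(int \<Rightarrow> sign_matrix) \<Rightarrow> 'v ind_functor" where
  "Ind A =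
    \<lparr>fobj = (\<lambda>V. induced_module (SF A) (carrier (SF_ge0 A)) (extend_by_zero A V)),
     fmor = (\<lambda>V W. induced_map (SF A) (carrier (SF_ge0 A)) (extend_by_zero A V) (extend_by_zero A W))\<rparr>"

text \<open>The full subcategory on the image of \<open>Ind\<close>, closed under isomorphism.\<close>

definition Ind_category ::
  "(int \<Rightarrow> sign_matrix) \<Rightarrow>
    ((sf, (sf, 'v) tensor) module, (sf, 'v) tensor \<Rightarrow> (sf, 'v) tensor) category" where
  "Ind_category A = full_subcategory (Rep (SF A)) (essential_image (Rep (SF01 A)) (Rep (SF A)) (Ind A))"

end

theory Submission
  imports Defs
begin

text \<open>
  Full faithfulness rests on two facts about \<open>Ind(V)\<close>: the unit \<open>v \<mapsto> 1 \<otimes> v\<close> is injective, and its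
  image is the space of vacuum vectors, those killed by all modes \<open>n \<ge> 2\<close>.

  Injectivity needs an additive map \<open>p\<close> from the algebra onto the subalgebra of the modes
  \<open>n \<in> {0, 1}\<close> with \<open>p (x b) = p x p b\<close> for \<open>b\<close> in the modes \<open>n \<ge> 0\<close>, identical on the subalgebra and
  zero on the modes \<open>n \<ge> 2\<close>; then \<open>x \<otimes> v \<mapsto> p x \<cdot> v\<close> is a left inverse of the unit. It also gives
  the extended action as \<open>b \<cdot> v = p b \<cdot> v\<close>. Instead of going through a normal ordering basis, \<open>p\<close> is
  obtained on the free algebra from Chevalley's deformation of Clifford relations: contracting the
  modes \<open>n < 0\<close> only, one deforms the bilinear form to its restriction to the modes \<open>n \<in> {0, 1}\<close>,
  after which all other modes may be set to zero.

  For the vacuum vectors, filter \<open>Ind(V)\<close> by the lowest mode used. Because the irregular term is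
  invertible, the modes \<open>1 + k\<close> pair perfectly with the modes \<open>- k\<close> and anticommute with all
  modes above \<open>- k\<close>, so a vacuum vector in step \<open>k\<close> already lies in step \<open>k - 1\<close>.
\<close>

section \<open>Linear maps on the free algebra\<close>

text \<open>Since \<open>A k\<close> vanishes for \<open>k > 1\<close> and the central term occurs
  only at index sum 0, two modes whose degrees add up to more than 1 anticommute. At index sum
  exactly 1 the anticommutator is an entry of \<open>C_1\<close>: off-diagonal, equal to \<xi> in
  every degree and independent of the arbitrary \<open>A k\<close> with \<open>k <= 0\<close>. Hence
  degrees are matched as n with 1 - n, not as n with -n, and 0 and 1 form the one matched pair
  without a negative degree. The obstacle is that generators and relations alone never show an
  element to be nonzero; this takes a map out of the quotient, which must respect a whole two-sided
  ideal. So additive maps are built on words and tested on products \<open>u r v\<close> with a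
  relation \<open>r\<close>. Simplicity in the image category refers to monomorphisms of that
  category, whose kernels are not known to lie in it. It is therefore carried along the equivalence
  abstractly and compared with submodules only over the modes 0 and 1.\<close>

lemma free_scalar_0 [simp]: "free_scalar 0 = 0"
  by (simp add: free_scalar_def)

lemma free_scalar_1 [simp]: "free_scalar 1 = 1"
  by (simp add: free_scalar_def)

lemma free_scalar_add: "free_scalar (c + d) = free_scalar c + free_scalar d"
  by (simp add: free_scalar_def single_add)

lemma free_scalar_mult: "free_scalar (c * d) = free_scalar c * free_scalar d"
  by (simp add: free_scalar_def mult_single)

lemma single_Word_snoc:
  "Poly_Mapping.single (Word (l @ [g])) c = Poly_Mapping.single (Word l) c * free_gen g"
  by (simp add: free_gen_def mult_single plus_free_word_def)

lemma poly_mapping_add_induct [case_names single add]: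
  fixes x :: "'a \<Rightarrow>\<^sub>0 'b::comm_monoid_add"
  assumes "\<And>u c. P (Poly_Mapping.single u c)" and "\<And>x y. P x \<Longrightarrow> P y \<Longrightarrow> P (x + y)"
  shows "P x"
proof (induction x rule: update_induct)
  case const
  have "P (Poly_Mapping.single undefined 0)" by (rule assms(1))
  then show ?case by simp
next
  case (update f a b)
  have "Poly_Mapping.update a b f = Poly_Mapping.single a b + f"
    using update(1) by (intro poly_mapping_eqI)
      (auto simp: lookup_update lookup_add lookup_single when_def in_keys_iff)
  then show ?case using assms update by metis
qed

text \<open>Words grow at their right end because all maps below are recursive in the last
  letter.\<close>

lemma free_alg_induct [case_names scalar gen add]:
  assumes "\<And>c. P (free_scalar c)" and "\<And>x g. P x \<Longrightarrow> P (x * free_gen g)"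
    and "\<And>x y. P x \<Longrightarrow> P y \<Longrightarrow> P (x + y)"
  shows "P x"
proof (induction x rule: poly_mapping_add_induct)
  case (single u c)
  have "P (Poly_Mapping.single (Word l) c)" for l
  proof (induction l rule: rev_induct)
    case Nil
    show ?case using assms(1)[of c] by (simp add: free_scalar_def zero_free_word_def)
  next
    case (snoc g l)
    then show ?case by (simp add: single_Word_snoc assms(2))
  qed
  then show ?case by (metis free_word.collapse)
qed (rule assms(3))

lemma free_scalar_commute: "free_scalar c * x = x * free_scalar c"
proof (induction x rule: poly_mapping_add_induct)
  case (single u d)
  then show ?case by (simp add: free_scalar_def mult_single mult.commute)
qed (simp add: algebra_simps)

lemma free_scalar_left_commute: "x * (free_scalar c * y) = free_scalar c * (x * y)"
  by (metis free_scalar_commute mult.assoc)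

text \<open>Right-handed primitive recursion: the additive, homogeneous map with value \<open>z\<close> at \<open>1\<close>
  and value \<open>S g x y\<close> at \<open>x g\<close>, where \<open>y\<close> is the value at \<open>x\<close>.\<close>

primrec word_rec :: "'h free_alg \<Rightarrow> ('g \<Rightarrow> 'g free_alg \<Rightarrow> 'h free_alg \<Rightarrow> 'h free_alg) \<Rightarrow> 'g list \<Rightarrow> 'h free_alg"
  where
    "word_rec z S [] = z"
  | "word_rec z S (g # l) = S g (Poly_Mapping.single (Word (rev l)) 1) (word_rec z S l)"

text \<open>List recursion consumes the head, so the word is reversed first; \<open>word_rec\<close>
  reverses back the prefix that it hands to \<open>S\<close>.\<close>

definition free_rec :: "'h free_alg \<Rightarrow> ('g \<Rightarrow> 'g free_alg \<Rightarrow> 'h free_alg \<Rightarrow> 'h free_alg) \<Rightarrow> 'g free_alg \<Rightarrow> 'h free_alg"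
  where "free_rec z S x =
    (\<Sum>u\<in>Poly_Mapping.keys x. free_scalar (Poly_Mapping.lookup x u) * word_rec z S (rev (letters u)))"

text \<open>Padding the support with zero coefficients allows \<open>x\<close>, \<open>y\<close> and
  \<open>x + y\<close> to be summed over one common index set.\<close>

lemma free_rec_superset:
  assumes "finite U" "Poly_Mapping.keys x \<subseteq> U"
  shows "free_rec z S x = (\<Sum>u\<in>U. free_scalar (Poly_Mapping.lookup x u) * word_rec z S (rev (letters u)))"
  unfolding free_rec_def using assms
  by (intro sum.mono_neutral_left) (auto simp: in_keys_iff)

lemma free_rec_add: "free_rec z S (x + y) = free_rec z S x + free_rec z S y"
proof -
  let ?U = "Poly_Mapping.keys x \<union> Poly_Mapping.keys y"
  have "free_rec z S w = (\<Sum>u\<in>?U. free_scalar (Poly_Mapping.lookup w u) * word_rec z S (rev (letters u)))"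
    if "w = x \<or> w = y \<or> w = x + y" for w
    using that by (intro free_rec_superset) (auto dest: subsetD[OF keys_add])
  then show ?thesis
    by (simp add: lookup_add free_scalar_add distrib_right sum.distrib)
qed

lemma free_rec_0: "free_rec z S 0 = 0"
  by (simp add: free_rec_def)

lemma free_rec_minus: "free_rec z S (- x) = - free_rec z S x"
  using free_rec_add[of z S "- x" x] by (simp add: free_rec_0 eq_neg_iff_add_eq_0)

lemma free_rec_diff: "free_rec z S (x - y) = free_rec z S x - free_rec z S y"
  using free_rec_add[of z S x "- y"] by (simp add: free_rec_minus)

lemma free_rec_single:
  "free_rec z S (Poly_Mapping.single u c) = free_scalar c * word_rec z S (rev (letters u))"
  by (cases "c = 0") (simp_all add: free_rec_def)

lemma free_rec_scalar: "free_rec z S (free_scalar c) = free_scalar c * z"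
  unfolding free_scalar_def free_rec_single by (simp add: zero_free_word_def)

lemma free_rec_scalar_mult: "free_rec z S (free_scalar c * x) = free_scalar c * free_rec z S x"
proof (induction x rule: poly_mapping_add_induct)
  case (single u d)
  have "free_scalar c * Poly_Mapping.single u d = Poly_Mapping.single u (c * d)"
    by (simp add: free_scalar_def mult_single)
  then show ?case by (simp add: free_rec_single free_scalar_mult mult.assoc)
qed (simp add: free_rec_add distrib_left)

text \<open>The recursion feeds \<open>S\<close> only words with coefficient 1, so its equation
  extends to arbitrary \<open>x\<close> once \<open>S g\<close> is linear in its two arguments
  jointly.\<close>

lemma free_rec_gen:
  assumes "\<And>g x x' y y'. S g (x + x') (y + y') = S g x y + S g x' y'"
    and "\<And>g c x y. S g (free_scalar c * x) (free_scalar c * y) = free_scalar c * S g x y"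
  shows "free_rec z S (x * free_gen g) = S g x (free_rec z S x)"
proof (induction x rule: poly_mapping_add_induct)
  case (single u c)
  obtain l where u: "u = Word l" by (cases u)
  let ?w = "Poly_Mapping.single u 1"
  have w: "Poly_Mapping.single u c = free_scalar c * ?w"
    by (simp add: free_scalar_def mult_single)
  have "free_rec z S (?w * free_gen g) = S g ?w (free_rec z S ?w)"
    by (simp add: u free_rec_single flip: single_Word_snoc)
  then show ?case
    unfolding w mult.assoc free_rec_scalar_mult by (simp add: assms(2))
qed (simp add: free_rec_add distrib_right assms(1))

section \<open>The free algebra as a ring with explicit carrier, and its ideals\<close>

lemma free_algebra_simps [simp]:
  "carrier free_algebra = UNIV" "x \<oplus>\<^bsub>free_algebra\<^esub> y = x + y" "x \<otimes>\<^bsub>free_algebra\<^esub> y = x * y"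
  "\<one>\<^bsub>free_algebra\<^esub> = 1" "\<zero>\<^bsub>free_algebra\<^esub> = 0"
  by (simp_all add: free_algebra_def)

lemma free_algebra_ring: "ring free_algebra"
proof (rule ringI)
  show "abelian_group free_algebra"
  proof (rule abelian_groupI)
    show "\<exists>y\<in>carrier free_algebra. y \<oplus>\<^bsub>free_algebra\<^esub> x = \<zero>\<^bsub>free_algebra\<^esub>" for x
      by (rule bexI[of _ "- x"]) simp_all
  qed (simp_all add: ac_simps)
  show "Group.monoid free_algebra"
    by (rule monoidI) (simp_all add: mult.assoc)
qed (simp_all add: distrib_left distrib_right)

lemma free_algebra_a_inv [simp]: "\<ominus>\<^bsub>free_algebra\<^esub> x = - x"
proof -
  interpret ring free_algebra by (rule free_algebra_ring)
  show ?thesis by (rule minus_equality) simp_all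
qed

text \<open>Negation is multiplication by -1, so the subgroup part of an ideal reduces to zero and
  sums.\<close>

lemma free_ideal_iff:
  "ideal I free_algebra \<longleftrightarrow> 0 \<in> I \<and> (\<forall>x\<in>I. \<forall>y\<in>I. x + y \<in> I) \<and> (\<forall>x\<in>I. \<forall>y. y * x \<in> I \<and> x * y \<in> I)"
proof
  assume "ideal I free_algebra"
  then interpret ideal I free_algebra .
  show "0 \<in> I \<and> (\<forall>x\<in>I. \<forall>y\<in>I. x + y \<in> I) \<and> (\<forall>x\<in>I. \<forall>y. y * x \<in> I \<and> x * y \<in> I)"
    using additive_subgroup.zero_closed[OF is_additive_subgroup]
      additive_subgroup.a_closed[OF is_additive_subgroup] I_l_closed I_r_closed by auto
next
  assume *: "0 \<in> I \<and> (\<forall>x\<in>I. \<forall>y\<in>I. x + y \<in> I) \<and> (\<forall>x\<in>I. \<forall>y. y * x \<in> I \<and> x * y \<in> I)"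
  interpret ring free_algebra by (rule free_algebra_ring)
  have neg: "- x \<in> I" if "x \<in> I" for x
    using *[THEN conjunct2, THEN conjunct2, rule_format, OF that, of "- 1"] by simp
  have "subgroup I (add_monoid free_algebra)"
  proof (rule group.subgroupI[OF a_group])
    fix x assume "x \<in> I"
    then show "inv\<^bsub>add_monoid free_algebra\<^esub> x \<in> I"
      using neg free_algebra_a_inv[of x] by (simp add: a_inv_def)
  qed (use * in auto)
  then show "ideal I free_algebra"
    using * by (intro idealI) (auto simp: free_algebra_ring)
qed

section \<open>Deformation of Clifford relations\<close>

definition clifford_rel :: "('g \<Rightarrow> 'g \<Rightarrow> complex) \<Rightarrow> 'g \<Rightarrow> 'g \<Rightarrow> 'g free_alg" where
  "clifford_rel Q a b = free_gen a * free_gen b + free_gen b * free_gen a - free_scalar (Q a b)"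

definition clifford_ideal :: "('g \<Rightarrow> 'g \<Rightarrow> complex) \<Rightarrow> 'g free_alg set" where
  "clifford_ideal Q = genideal free_algebra {clifford_rel Q a b | a b. True}"

lemma ideal_clifford_ideal: "ideal (clifford_ideal Q) free_algebra"
  unfolding clifford_ideal_def by (rule ring.genideal_ideal[OF free_algebra_ring]) simp

lemma
  shows clifford_ideal_0: "0 \<in> clifford_ideal Q"
    and clifford_ideal_add: "x \<in> clifford_ideal Q \<Longrightarrow> y \<in> clifford_ideal Q \<Longrightarrow> x + y \<in> clifford_ideal Q"
    and clifford_ideal_lmult: "x \<in> clifford_ideal Q \<Longrightarrow> z * x \<in> clifford_ideal Q"
    and clifford_ideal_rmult: "x \<in> clifford_ideal Q \<Longrightarrow> x * z \<in> clifford_ideal Q"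
  using ideal_clifford_ideal[of Q] unfolding free_ideal_iff by auto

lemma clifford_ideal_diff:
  "x \<in> clifford_ideal Q \<Longrightarrow> y \<in> clifford_ideal Q \<Longrightarrow> x - y \<in> clifford_ideal Q"
  using clifford_ideal_add[of x Q "- 1 * y"] clifford_ideal_lmult[of y Q "- 1"] by simp

lemma clifford_rel_in: "clifford_rel Q a b \<in> clifford_ideal Q"
  unfolding clifford_ideal_def using ring.genideal_self[OF free_algebra_ring] by fastforce

text \<open>Testing an additive map on all products \<open>u r v\<close> turns the preimage of an ideal into an ideal.\<close>

lemma clifford_ideal_mapsto:
  assumes add: "\<And>x y. f (x + y) = f x + f y" and f0: "f 0 = 0"
    and J: "ideal J free_algebra"
    and rel: "\<And>u v a b. f (u * clifford_rel Q a b * v) \<in> J"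
    and x: "x \<in> clifford_ideal Q"
  shows "f x \<in> J"
proof -
  let ?K = "{z. \<forall>u v. f (u * z * v) \<in> J}"
  note J' = J[unfolded free_ideal_iff]
  have "ideal ?K free_algebra"
    unfolding free_ideal_iff
  proof (intro conjI ballI allI)
    show "0 \<in> ?K" using J' f0 by simp
    show "x + y \<in> ?K" if "x \<in> ?K" "y \<in> ?K" for x y
      using that J' by (simp add: distrib_left distrib_right add)
    show "y * x \<in> ?K" if "x \<in> ?K" for x y
    proof -
      have "f (u * (y * x) * v) \<in> J" for u v
        using that by (metis (no_types, lifting) mem_Collect_eq mult.assoc)
      then show ?thesis by simp
    qed
    show "x * y \<in> ?K" if "x \<in> ?K" for x y
    proof -
      have "f (u * (x * y) * v) \<in> J" for u v
        using that by (metis (no_types, lifting) mem_Collect_eq mult.assoc)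
      then show ?thesis by simp
    qed
  qed
  then have "clifford_ideal Q \<subseteq> ?K"
    unfolding clifford_ideal_def
    by (rule ring.genideal_minimal[OF free_algebra_ring]) (use rel in auto)
  then have "f (1 * x * 1) \<in> J" using x by blast
  then show ?thesis by simp
qed

text \<open>Contraction by \<open>w\<close>: move \<open>w\<close> to the left through a word, collecting the terms \<open>T k w\<close>.\<close>

definition contract :: "('g \<Rightarrow> 'g \<Rightarrow> complex) \<Rightarrow> 'g \<Rightarrow> 'g free_alg \<Rightarrow> 'g free_alg" where
  "contract T w = free_rec 0 (\<lambda>k x y. free_scalar (T k w) * x - y * free_gen k)"

lemma contract_add: "contract T w (x + y) = contract T w x + contract T w y"
  and contract_diff: "contract T w (x - y) = contract T w x - contract T w y"
  and contract_0: "contract T w 0 = 0"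
  and contract_scalar: "contract T w (free_scalar c) = 0"
  and contract_scalar_mult: "contract T w (free_scalar c * x) = free_scalar c * contract T w x"
  by (simp_all add: contract_def free_rec_add free_rec_diff free_rec_0 free_rec_scalar free_rec_scalar_mult)

lemma contract_gen:
  "contract T w (x * free_gen k) = free_scalar (T k w) * x - contract T w x * free_gen k"
  unfolding contract_def
proof (rule free_rec_gen)
  show "free_scalar (T g w) * (free_scalar c * x) - free_scalar c * y * free_gen g
      = free_scalar c * (free_scalar (T g w) * x - y * free_gen g)" for g c and x y :: "'a free_alg"
    unfolding free_scalar_left_commute[of "free_scalar (T g w)"] by (simp add: algebra_simps)
qed (simp add: algebra_simps)

text \<open>In the recursion step the terms with \<open>T g v\<close> and \<open>T g w\<close> trade
  places with opposite signs, as for interior products on an exterior algebra.\<close>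

lemma contract_anticommute: "contract T v (contract T w x) = - contract T w (contract T v x)"
proof (induction x rule: free_alg_induct)
  case (scalar c)
  then show ?case by (simp add: contract_scalar contract_0)
next
  case (gen x g)
  then show ?case by (simp add: contract_gen contract_diff contract_scalar_mult)
next
  case (add x y)
  then show ?case by (simp add: contract_add)
qed

lemma contract_eq_0:
  assumes "\<And>k. T k w = 0"
  shows "contract T w x = 0"
  by (induction x rule: free_alg_induct) (simp_all add: contract_scalar contract_gen contract_add assms)

lemma mult_clifford_rel:
  "x * clifford_rel Q a b = x * free_gen a * free_gen b + x * free_gen b * free_gen a - free_scalar (Q a b) * x"
  unfolding clifford_rel_def free_scalar_commute[of _ x] by (simp only: distrib_left right_diff_distrib mult.assoc)

text \<open>Contraction is an odd skew derivation: passing one letter changes the sign, passing two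
  restores it, and the terms in which it hits \<open>a\<close> or \<open>b\<close> cancel between
  the two orders. The form \<open>Q\<close> enters only through a scalar.\<close>

lemma contract_clifford_rel: "contract T w (x * clifford_rel Q a b) = contract T w x * clifford_rel Q a b"
  unfolding mult_clifford_rel contract_add contract_diff contract_gen contract_scalar_mult
  by (simp add: algebra_simps)

text \<open>By \<open>contract_clifford_rel\<close> the product of \<open>u\<close> and a relation
  contracts into the ideal; each further letter on the right only adds multiples of elements already
  there.\<close>

lemma contract_clifford_ideal: "x \<in> clifford_ideal Q \<Longrightarrow> contract T w x \<in> clifford_ideal Q"
proof (rule clifford_ideal_mapsto[OF contract_add contract_0 ideal_clifford_ideal])
  fix u v a b
  show "contract T w (u * clifford_rel Q a b * v) \<in> clifford_ideal Q"
  proof (induction v rule: free_alg_induct)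
    case (scalar c)
    have "contract T w (u * clifford_rel Q a b * free_scalar c)
        = free_scalar c * (contract T w u * clifford_rel Q a b)"
      unfolding free_scalar_commute[of c, symmetric] contract_scalar_mult contract_clifford_rel ..
    then show ?case by (simp add: clifford_ideal_lmult clifford_rel_in)
  next
    case (gen x g)
    then show ?case
      unfolding mult.assoc[symmetric] contract_gen
      by (intro clifford_ideal_diff clifford_ideal_lmult clifford_ideal_rmult clifford_rel_in)
  next
    case (add x y)
    then show ?case by (simp add: distrib_left contract_add clifford_ideal_add)
  qed
qed

text \<open>Chevalley's deformation: it transports the Clifford relations of one bilinear form to those
  of another one that differs from it by the symmetrization of \<open>T\<close>.\<close>

definition deform :: "('g \<Rightarrow> 'g \<Rightarrow> complex) \<Rightarrow> 'g free_alg \<Rightarrow> 'g free_alg" where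
  "deform T = free_rec 1 (\<lambda>k x y. y * free_gen k + contract T k y)"

lemma deform_add: "deform T (x + y) = deform T x + deform T y"
  and deform_diff: "deform T (x - y) = deform T x - deform T y"
  and deform_0: "deform T 0 = 0"
  and deform_scalar: "deform T (free_scalar c) = free_scalar c"
  and deform_scalar_mult: "deform T (free_scalar c * x) = free_scalar c * deform T x"
  by (simp_all add: deform_def free_rec_add free_rec_diff free_rec_0 free_rec_scalar free_rec_scalar_mult)

lemma deform_gen: "deform T (x * free_gen k) = deform T x * free_gen k + contract T k (deform T x)"
  unfolding deform_def
  by (rule free_rec_gen) (simp_all add: algebra_simps contract_add contract_scalar_mult)

text \<open>Mixed terms of one contraction and one letter cancel, double contractions cancel by
  anticommutativity, and what survives is the scalar \<open>T a b + T b a\<close>, exactly the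
  difference of the two forms.\<close>

lemma deform_clifford_rel:
  assumes "B a b = Q a b + T a b + T b a"
  shows "deform T (x * clifford_rel B a b) = deform T x * clifford_rel Q a b"
proof -
  have "contract T b (contract T a y) + contract T a (contract T b y) = 0" for y
    using contract_anticommute[of T a b y] by simp
  moreover have B: "free_scalar (B a b) = free_scalar (Q a b) + free_scalar (T a b) + free_scalar (T b a)"
    by (simp add: assms free_scalar_add)
  ultimately show ?thesis
    unfolding mult_clifford_rel deform_add deform_diff deform_gen deform_scalar_mult contract_add contract_gen B
    by (simp add: algebra_simps deform_add deform_scalar_mult)
qed

lemma deform_clifford_ideal:
  assumes "\<And>a b. B a b = Q a b + T a b + T b a" and "x \<in> clifford_ideal B"
  shows "deform T x \<in> clifford_ideal Q"
proof (rule clifford_ideal_mapsto[OF deform_add deform_0 ideal_clifford_ideal _ assms(2)])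
  fix u v a b
  show "deform T (u * clifford_rel B a b * v) \<in> clifford_ideal Q"
  proof (induction v rule: free_alg_induct)
    case (scalar c)
    have "deform T (u * clifford_rel B a b * free_scalar c)
        = free_scalar c * (deform T u * clifford_rel Q a b)"
      unfolding free_scalar_commute[of c, symmetric] deform_scalar_mult deform_clifford_rel[of B a b Q T, OF assms(1)] ..
    then show ?case by (simp add: clifford_ideal_lmult clifford_rel_in)
  next
    case (gen x g)
    \<comment> \<open>Appending a letter produces a contraction term as well; it stays in the ideal
      because contractions preserve the ideal.\<close>
    then show ?case
      unfolding mult.assoc[symmetric] deform_gen
      by (intro clifford_ideal_add clifford_ideal_rmult contract_clifford_ideal)
  next
    case (add x y)
    then show ?case by (simp add: distrib_left deform_add clifford_ideal_add)
  qed
qed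

definition kill_gens :: "('g \<Rightarrow> bool) \<Rightarrow> 'g free_alg \<Rightarrow> 'g free_alg" where
  "kill_gens P = free_rec 1 (\<lambda>k x y. if P k then y * free_gen k else 0)"

lemma kill_gens_add: "kill_gens P (x + y) = kill_gens P x + kill_gens P y"
  and kill_gens_diff: "kill_gens P (x - y) = kill_gens P x - kill_gens P y"
  and kill_gens_0: "kill_gens P 0 = 0"
  and kill_gens_scalar: "kill_gens P (free_scalar c) = free_scalar c"
  and kill_gens_scalar_mult: "kill_gens P (free_scalar c * x) = free_scalar c * kill_gens P x"
  by (simp_all add: kill_gens_def free_rec_add free_rec_diff free_rec_0 free_rec_scalar free_rec_scalar_mult)

lemma kill_gens_gen: "kill_gens P (x * free_gen k) = (if P k then kill_gens P x * free_gen k else 0)"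
  unfolding kill_gens_def
  by (rule free_rec_gen) (auto simp: algebra_simps)

lemma kill_gens_mult: "kill_gens P (x * y) = kill_gens P x * kill_gens P y"
proof (induction y rule: free_alg_induct)
  case (scalar c)
  show ?case
    unfolding free_scalar_commute[of c, symmetric] kill_gens_scalar_mult kill_gens_scalar ..
next
  case (gen y g)
  then show ?case unfolding mult.assoc[symmetric] kill_gens_gen by (simp add: mult.assoc)
next
  case (add y z)
  then show ?case by (simp add: kill_gens_add distrib_left)
qed

lemma kill_gens_free_gen: "kill_gens P (free_gen k) = (if P k then free_gen k else 0)"
  using kill_gens_gen[of P 1 k] kill_gens_scalar[of P 1] by simp

text \<open>A relation involving a killed generator maps to minus its scalar, so the form must
  vanish on such pairs. Arranging this is the purpose of deforming first.\<close>

lemma kill_gens_clifford_ideal: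
  assumes "\<And>a b. P a \<Longrightarrow> P b \<Longrightarrow> Q a b = B a b" and "\<And>a b. \<not> (P a \<and> P b) \<Longrightarrow> Q a b = 0"
    and "x \<in> clifford_ideal Q"
  shows "kill_gens P x \<in> clifford_ideal B"
proof (rule clifford_ideal_mapsto[OF kill_gens_add kill_gens_0 ideal_clifford_ideal _ assms(3)])
  fix u v a b
  have "kill_gens P (clifford_rel Q a b) = (if P a \<and> P b then clifford_rel B a b else 0)"
    using assms(1,2)[of a b]
    by (auto simp: clifford_rel_def kill_gens_add kill_gens_diff kill_gens_mult kill_gens_scalar kill_gens_free_gen)
  then have "kill_gens P (clifford_rel Q a b) \<in> clifford_ideal B"
    by (simp add: clifford_rel_in clifford_ideal_0)
  then show "kill_gens P (u * clifford_rel Q a b * v) \<in> clifford_ideal B"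
    by (simp add: kill_gens_mult clifford_ideal_lmult clifford_ideal_rmult)
qed

section \<open>The projection onto the modes 0 and 1\<close>

lemma UNIV_sign: "(UNIV :: sign set) = {Plus, Minus}"
  using sign.exhaust by auto

lemma conn_form_entries:
  "conn_form A k $ Plus $ b = - A k $ Minus $ b" "conn_form A k $ Minus $ b = A k $ Plus $ b"
  by (simp_all add: conn_form_def matrix_matrix_mult_def matrix2_def UNIV_sign)

text \<open>The off-diagonal entries of the form are the diagonal entries of \<open>A k\<close>, one
  of them with a sign, so symmetry amounts to tracelessness.\<close>

lemma conn_form_sym: "A k \<in> sl2 \<Longrightarrow> conn_form A k $ a $ b = conn_form A k $ b $ a"
  by (cases a; cases b)
    (auto simp: conn_form_entries sl2_def trace_def UNIV_sign eq_neg_iff_add_eq_0 neg_eq_iff_add_eq_0 add.commute)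

section \<open>Symplectic fermions as a Clifford quotient, and their subalgebras of modes\<close>

definition pairing :: "(int \<Rightarrow> sign_matrix) \<Rightarrow> sign \<times> int \<Rightarrow> sign \<times> int \<Rightarrow> complex" where
  "pairing A x y = (if snd x + snd y = 0 then of_int (snd x) * symp (fst x) (fst y) else 0)
    + conn_form A (snd x + snd y) $ fst x $ fst y"

lemma SF_ideal_eq: "SF_ideal A = clifford_ideal (pairing A)"
proof -
  have "SF_relations A = {clifford_rel (pairing A) x y | x y. True}"
    unfolding SF_relations_def clifford_rel_def pairing_def by auto
  then show ?thesis by (simp add: SF_ideal_def clifford_ideal_def)
qed

abbreviation cls :: "(int \<Rightarrow> sign_matrix) \<Rightarrow> (sign \<times> int) free_alg \<Rightarrow> sf" where
  "cls A x \<equiv> SF_ideal A +>\<^bsub>free_algebra\<^esub> x"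

lemma ideal_SF_ideal: "ideal (SF_ideal A) free_algebra"
  unfolding SF_ideal_eq by (rule ideal_clifford_ideal)

lemma SF_ring: "ring (SF A)"
  unfolding SF_def by (rule ideal.quotient_is_ring[OF ideal_SF_ideal])

lemma cls_hom: "ring_hom_ring free_algebra (SF A) (cls A)"
  unfolding SF_def by (rule ideal.rcos_ring_hom_ring[OF ideal_SF_ideal])

lemma carrier_SF: "carrier (SF A) = range (cls A)"
  by (auto simp: SF_def FactRing_def A_RCOSETS_def' a_r_coset_def)

lemma cls_closed [simp]: "cls A x \<in> carrier (SF A)"
  by (simp add: carrier_SF)

lemma cls_add: "cls A (x + y) = cls A x \<oplus>\<^bsub>SF A\<^esub> cls A y"
  and cls_mult: "cls A (x * y) = cls A x \<otimes>\<^bsub>SF A\<^esub> cls A y"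
  and cls_1: "cls A 1 = \<one>\<^bsub>SF A\<^esub>"
  and cls_0: "cls A 0 = \<zero>\<^bsub>SF A\<^esub>"
  and cls_minus: "cls A (- x) = \<ominus>\<^bsub>SF A\<^esub> cls A x"
proof -
  interpret h: ring_hom_ring free_algebra "SF A" "cls A" by (rule cls_hom)
  show "cls A (x + y) = cls A x \<oplus>\<^bsub>SF A\<^esub> cls A y" "cls A (x * y) = cls A x \<otimes>\<^bsub>SF A\<^esub> cls A y"
    "cls A 1 = \<one>\<^bsub>SF A\<^esub>" "cls A 0 = \<zero>\<^bsub>SF A\<^esub>" "cls A (- x) = \<ominus>\<^bsub>SF A\<^esub> cls A x"
    using h.hom_add[of x y] h.hom_mult[of x y] h.hom_one h.hom_zero h.hom_a_inv[of x] by simp_all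
qed

lemma cls_eq_iff: "cls A x = cls A y \<longleftrightarrow> x - y \<in> SF_ideal A"
proof -
  interpret ideal "SF_ideal A" free_algebra by (rule ideal_SF_ideal)
  show ?thesis
    using quotient_eq_iff_same_a_r_cos[OF ideal_SF_ideal, of x y] by (simp add: a_minus_def)
qed

lemma SF_scalar_closed [simp]: "SF_scalar A c \<in> carrier (SF A)"
  and \<psi>_closed [simp]: "\<psi> A a n \<in> carrier (SF A)"
  by (simp_all add: SF_scalar_def \<psi>_def)

lemma SF_scalar_commute:
  assumes "x \<in> carrier (SF A)"
  shows "SF_scalar A c \<otimes>\<^bsub>SF A\<^esub> x = x \<otimes>\<^bsub>SF A\<^esub> SF_scalar A c"
proof -
  obtain y where "x = cls A y" using assms by (auto simp: carrier_SF)
  then show ?thesis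
    unfolding SF_scalar_def by (simp only: free_scalar_commute flip: cls_mult)
qed

lemma SF_scalar_mult: "SF_scalar A c \<otimes>\<^bsub>SF A\<^esub> SF_scalar A d = SF_scalar A (c * d)"
  unfolding SF_scalar_def free_scalar_mult cls_mult ..

lemma SF_scalar_0: "SF_scalar A 0 = \<zero>\<^bsub>SF A\<^esub>"
  and SF_scalar_1: "SF_scalar A 1 = \<one>\<^bsub>SF A\<^esub>"
  by (simp_all add: SF_scalar_def cls_0 cls_1)

lemma \<psi>_anticommutator:
  "\<psi> A a m \<otimes>\<^bsub>SF A\<^esub> \<psi> A b n \<oplus>\<^bsub>SF A\<^esub> \<psi> A b n \<otimes>\<^bsub>SF A\<^esub> \<psi> A a m = SF_scalar A (pairing A (a, m) (b, n))"
proof -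
  let ?x = "free_gen (a, m) * free_gen (b, n) + free_gen (b, n) * free_gen (a, m)"
    and ?c = "free_scalar (pairing A (a, m) (b, n))"
  have "?x - ?c = clifford_rel (pairing A) (a, m) (b, n)"
    by (rule clifford_rel_def[symmetric])
  then have "?x - ?c \<in> SF_ideal A"
    by (simp only: SF_ideal_eq clifford_rel_in)
  then have "cls A ?x = cls A ?c" by (rule cls_eq_iff[THEN iffD2])
  then show ?thesis
    by (simp only: \<psi>_def SF_scalar_def cls_mult cls_add)
qed

lemma cls_scalar: "cls A (free_scalar c) = SF_scalar A c"
  and cls_gen: "cls A (free_gen (a, n)) = \<psi> A a n"
  by (simp_all only: SF_scalar_def \<psi>_def)

lemma SF_modes_subset: "SF_modes A I \<subseteq> carrier (SF A)"
  unfolding SF_modes_def by (rule ring.generate_ring_incl[OF SF_ring]) auto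

lemma subring_SF_modes: "subring (SF_modes A I) (SF A)"
  unfolding SF_modes_def by (rule ring.generate_ring_is_subring[OF SF_ring]) auto

lemma SF_modes_mono: "I \<subseteq> J \<Longrightarrow> SF_modes A I \<subseteq> SF_modes A J"
  unfolding SF_modes_def by (rule ring.mono_generate_ring[OF SF_ring]) auto

lemma SF_scalar_in_modes [simp]: "SF_scalar A c \<in> SF_modes A I"
  unfolding SF_modes_def by (rule generate_ring.incl) auto

lemma \<psi>_in_modes: "n \<in> I \<Longrightarrow> \<psi> A a n \<in> SF_modes A I"
  unfolding SF_modes_def by (rule generate_ring.incl) auto

lemma carrier_SF_sub [simp]: "carrier (SF_sub A I) = SF_modes A I"
  and SF_sub_simps [simp]: "x \<oplus>\<^bsub>SF_sub A I\<^esub> y = x \<oplus>\<^bsub>SF A\<^esub> y" "x \<otimes>\<^bsub>SF_sub A I\<^esub> y = x \<otimes>\<^bsub>SF A\<^esub> y"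
    "\<one>\<^bsub>SF_sub A I\<^esub> = \<one>\<^bsub>SF A\<^esub>" "\<zero>\<^bsub>SF_sub A I\<^esub> = \<zero>\<^bsub>SF A\<^esub>"
  by (simp_all add: SF_sub_def)

lemma SF_sub_ring: "ring (SF_sub A I)"
  unfolding SF_sub_def by (rule ring.subring_is_ring[OF SF_ring subring_SF_modes])

lemma SF_modes_UNIV: "SF_modes A UNIV = carrier (SF A)"
proof
  have "cls A x \<in> SF_modes A UNIV" for x
  proof (induction x rule: free_alg_induct)
    case (scalar c)
    show ?case unfolding cls_scalar by (rule SF_scalar_in_modes)
  next
    case (gen x g)
    obtain a n where g: "g = (a, n)" by (cases g)
    show ?case
      unfolding g cls_mult cls_gen by (intro subringE(6)[OF subring_SF_modes] gen \<psi>_in_modes UNIV_I)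
  next
    case (add x y)
    then show ?case
      unfolding cls_add by (rule subringE(7)[OF subring_SF_modes])
  qed
  then show "carrier (SF A) \<subseteq> SF_modes A UNIV" by (auto simp: carrier_SF)
qed (rule SF_modes_subset)

text \<open>The identities for \<open>deform\<close> hold for particular words, not for classes. So
  an element of a subalgebra gets a representative built from scalars and admissible generators
  alone, for which such an identity follows by induction.\<close>

lemma SF_modes_lift [consumes 1, case_names scalar gen minus add mult]:
  assumes "x \<in> SF_modes A I"
    and "\<And>c. P (free_scalar c)" and "\<And>a n. n \<in> I \<Longrightarrow> P (free_gen (a, n))"
    and "\<And>y. P y \<Longrightarrow> P (- y)" and "\<And>y z. P y \<Longrightarrow> P z \<Longrightarrow> P (y + z)" and "\<And>y z. P y \<Longrightarrow> P z \<Longrightarrow> P (y * z)"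
  obtains y where "P y" "x = cls A y"
proof -
  have "\<exists>y. P y \<and> x = cls A y"
    using assms(1) unfolding SF_modes_def
  proof (induction rule: generate_ring.induct)
    case one
    show ?case using assms(2)[of 1] by (intro exI[of _ 1]) (simp add: cls_1)
  next
    case (incl h)
    then consider c where "h = SF_scalar A c" | a n where "h = \<psi> A a n" "n \<in> I" by blast
    then show ?case by cases (use assms(2,3) cls_scalar cls_gen in blast)+
  next
    case (a_inv h)
    then obtain y where "P y" "h = cls A y" by blast
    then show ?case by (intro exI[of _ "- y"] conjI assms(4)) (simp_all only: cls_minus)
  next
    case (eng_add h1 h2)
    then obtain y z where "P y" "h1 = cls A y" "P z" "h2 = cls A z" by blast
    then show ?case by (intro exI[of _ "y + z"] conjI assms(5)) (simp_all only: cls_add)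
  next
    case (eng_mult h1 h2)
    then obtain y z where "P y" "h1 = cls A y" "P z" "h2 = cls A z" by blast
    then show ?case by (intro exI[of _ "y * z"] conjI assms(6)) (simp_all only: cls_mult)
  qed
  then show thesis using that by blast
qed

section \<open>The projection as a deformation followed by a specialization\<close>

locale sf_connection =
  fixes A :: "int \<Rightarrow> sign_matrix"
  assumes sl2: "\<And>k. A k \<in> sl2" and order_le_1: "\<And>k. k > 1 \<Longrightarrow> A k = 0"
begin

lemma pairing_sym: "pairing A x y = pairing A y x"
proof -
  have "symp a b = - symp b a" for a b
    by (cases a; cases b) (simp_all add: symp_def matrix2_def)
  then have "of_int (snd x) * symp (fst x) (fst y) = of_int (snd y) * symp (fst y) (fst x)"
    if "snd x + snd y = 0"
    using that by (metis add_eq_0_iff minus_mult_minus of_int_minus)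
  then show ?thesis
    unfolding pairing_def add.commute[of "snd y"] conn_form_sym[OF sl2, where a = "fst y" and b = "fst x"] by simp
qed

lemma pairing_eq_0:
  assumes "snd x + snd y > 1"
  shows "pairing A x y = 0"
  using assms by (cases "fst x") (simp_all add: pairing_def conn_form_entries order_le_1)

text \<open>Only modes \<open>n < 0\<close> are contracted, so \<open>deform transfer\<close> is linear over the modes \<open>n \<ge> 0\<close>
  from the right. It turns the pairing into its restriction to the modes \<open>n \<in> {0, 1}\<close>, for which
  setting the other modes to zero is compatible with the relations.\<close>

definition transfer :: "sign \<times> int \<Rightarrow> sign \<times> int \<Rightarrow> complex" where
  "transfer x y = (if snd y < 0 then if snd x < 0 then pairing A x y / 2 else pairing A x y else 0)"

definition is01 :: "sign \<times> int \<Rightarrow> bool" where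
  "is01 x \<longleftrightarrow> snd x \<in> {0, 1}"

definition pairing01 :: "sign \<times> int \<Rightarrow> sign \<times> int \<Rightarrow> complex" where
  "pairing01 x y = (if is01 x \<and> is01 y then pairing A x y else 0)"

text \<open>Two negative modes occur in both \<open>transfer x y\<close> and
  \<open>transfer y x\<close>, each with half of the symmetric pairing; a negative and a nonnegative
  mode occur in just one of them. Nonnegative modes that are not both of degree 0 or 1 have degree
  sum above 1 and pair to zero.\<close>

lemma pairing_eq_transfer: "pairing A x y = pairing01 x y + transfer x y + transfer y x"
proof (cases "snd x < 0 \<or> snd y < 0")
  case True
  then show ?thesis
    using pairing_sym[of x y] by (auto simp: transfer_def pairing01_def is01_def)
next
  case False
  then have "\<not> (is01 x \<and> is01 y) \<Longrightarrow> snd x + snd y > 1"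
    by (auto simp: is01_def)
  then show ?thesis
    using False pairing_eq_0[of x y] by (auto simp: transfer_def pairing01_def)
qed

definition proj_free :: "(sign \<times> int) free_alg \<Rightarrow> (sign \<times> int) free_alg" where
  "proj_free x = kill_gens is01 (deform transfer x)"

lemma proj_free_add: "proj_free (x + y) = proj_free x + proj_free y"
  and proj_free_diff: "proj_free (x - y) = proj_free x - proj_free y"
  by (simp_all add: proj_free_def deform_add deform_diff kill_gens_add kill_gens_diff)

text \<open>The deformation leads from \<open>pairing A\<close> to \<open>pairing01\<close>, and
  killing the remaining modes leads back, as the two forms agree in degrees 0 and 1. So the
  composite descends to the quotient on both sides.\<close>

lemma proj_free_ideal:
  assumes "x \<in> SF_ideal A"
  shows "proj_free x \<in> SF_ideal A"
proof -
  have "deform transfer x \<in> clifford_ideal pairing01"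
    using assms unfolding SF_ideal_eq by (rule deform_clifford_ideal[OF pairing_eq_transfer])
  then show ?thesis
    unfolding SF_ideal_eq proj_free_def
    by (rule kill_gens_clifford_ideal[rotated 2]) (auto simp: pairing01_def)
qed

lemma cls_proj_free_in: "cls A (proj_free x) \<in> SF_modes A {0, 1}"
proof -
  have "cls A (kill_gens is01 y) \<in> SF_modes A {0, 1}" for y
  proof (induction y rule: free_alg_induct)
    case (scalar c)
    show ?case unfolding kill_gens_scalar cls_scalar by (rule SF_scalar_in_modes)
  next
    case (gen x g)
    obtain a n where g: "g = (a, n)" by (cases g)
    show ?case
    proof (cases "is01 g")
      case True
      then have "n \<in> {0, 1}" by (simp add: g is01_def)
      then show ?thesis
        unfolding kill_gens_gen if_P[OF True] cls_mult
        unfolding g cls_gen by (intro subringE(6)[OF subring_SF_modes] gen \<psi>_in_modes)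
    next
      case False
      show ?thesis
        unfolding kill_gens_gen if_not_P[OF False] cls_0 by (rule subringE(2)[OF subring_SF_modes])
    qed
  next
    case (add x y)
    then show ?case
      unfolding kill_gens_add cls_add by (rule subringE(7)[OF subring_SF_modes])
  qed
  then show ?thesis by (simp add: proj_free_def)
qed

definition proj :: "sf \<Rightarrow> sf" where
  "proj S = cls A (proj_free (SOME x. cls A x = S))"

lemma proj_cls: "proj (cls A x) = cls A (proj_free x)"
proof -
  let ?y = "SOME y. cls A y = cls A x"
  have "cls A ?y = cls A x" by (rule someI) simp
  then have "?y - x \<in> SF_ideal A" by (simp only: cls_eq_iff)
  then have "proj_free ?y - proj_free x \<in> SF_ideal A" by (simp only: proj_free_diff[symmetric] proj_free_ideal)
  then show ?thesis by (simp only: proj_def cls_eq_iff)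
qed

lemma proj_in: "proj x \<in> SF_modes A {0, 1}"
  by (simp add: proj_def cls_proj_free_in)

lemma proj_closed [simp]: "proj x \<in> carrier (SF A)"
  using proj_in SF_modes_subset by blast

lemma proj_add:
  assumes "x \<in> carrier (SF A)" "y \<in> carrier (SF A)"
  shows "proj (x \<oplus>\<^bsub>SF A\<^esub> y) = proj x \<oplus>\<^bsub>SF A\<^esub> proj y"
proof -
  obtain x' y' where xy: "x = cls A x'" "y = cls A y'" using assms by (auto simp: carrier_SF)
  show ?thesis unfolding xy cls_add[symmetric] proj_cls proj_free_add ..
qed

lemma deform_transfer_gen:
  "0 \<le> n \<Longrightarrow> deform transfer (x * free_gen (a, n)) = deform transfer x * free_gen (a, n)"
  by (simp add: deform_gen contract_eq_0 transfer_def)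

lemma proj_mult:
  assumes "x \<in> carrier (SF A)" "b \<in> SF_modes A {0..}"
  shows "proj (x \<otimes>\<^bsub>SF A\<^esub> b) = proj x \<otimes>\<^bsub>SF A\<^esub> proj b"
proof -
  \<comment> \<open>The representative consists of scalars and modes \<open>n >= 0\<close>, whose
    contractions vanish, so \<open>deform transfer\<close> lets it pass unchanged on the
    right.\<close>
  obtain b' where b': "\<forall>y. deform transfer (y * b') = deform transfer y * b'" "b = cls A b'"
  proof (rule SF_modes_lift[OF assms(2), where P = "\<lambda>b'. \<forall>y. deform transfer (y * b') = deform transfer y * b'"])
    show "\<forall>y. deform transfer (y * free_scalar c) = deform transfer y * free_scalar c" for c
      by (simp only: free_scalar_commute[symmetric] deform_scalar_mult simp_thms)
    show "\<forall>y. deform transfer (y * - b) = deform transfer y * - b"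
      if "\<forall>y. deform transfer (y * b) = deform transfer y * b" for b
      using that deform_diff[of transfer 0] by (simp add: deform_0)
  qed (simp_all add: deform_transfer_gen deform_add distrib_left flip: mult.assoc)
  obtain x' where x': "x = cls A x'" using assms(1) by (auto simp: carrier_SF)
  \<comment> \<open>The case \<open>y = 1\<close>: on \<open>b'\<close> itself only the
    specialization acts, and that is multiplicative.\<close>
  have "deform transfer b' = b'"
    using b'(1)[rule_format, of 1] deform_scalar[of transfer 1] by simp
  then have "proj_free (x' * b') = proj_free x' * proj_free b'"
    by (simp add: proj_free_def b'(1) kill_gens_mult)
  then show ?thesis by (simp only: x' b'(2) proj_cls cls_mult[symmetric])
qed

lemma proj_id:
  assumes "b \<in> SF_modes A {0, 1}"
  shows "proj b = b"
proof -
  define P where "P b' \<longleftrightarrow> (\<forall>y. deform transfer (y * b') = deform transfer y * b') \<and> kill_gens is01 b' = b'" for b'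
  obtain b' where b': "P b'" "b = cls A b'"
  proof (rule SF_modes_lift[OF assms, where P = P])
    show "P (free_scalar c)" for c
      by (simp only: P_def free_scalar_commute[symmetric] deform_scalar_mult kill_gens_scalar simp_thms)
    show "P (free_gen (a, n))" if "n \<in> {0, 1}" for a n
      using that by (auto simp: P_def deform_transfer_gen kill_gens_free_gen is01_def)
    show "P (- b)" if "P b" for b
      using that deform_diff[of transfer 0] kill_gens_diff[of is01 0 b]
      by (simp add: P_def deform_0 kill_gens_0)
  qed (simp_all add: P_def deform_add kill_gens_add kill_gens_mult distrib_left flip: mult.assoc)
  have "deform transfer b' = b'"
    using b'(1)[unfolded P_def, THEN conjunct1, rule_format, of 1] deform_scalar[of transfer 1] by simp
  moreover have "kill_gens is01 b' = b'" using b'(1)[unfolded P_def] by (rule conjunct2)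
  ultimately show ?thesis by (simp only: b'(2) proj_cls proj_free_def)
qed

lemma proj_\<psi>:
  assumes "n \<ge> 2"
  shows "proj (\<psi> A a n) = \<zero>\<^bsub>SF A\<^esub>"
proof -
  have "deform transfer (free_gen (a, n)) = free_gen (a, n)"
    using assms deform_transfer_gen[of n 1 a] deform_scalar[of transfer 1] by simp
  moreover have "kill_gens is01 (free_gen (a, n)) = 0"
    using assms by (simp add: kill_gens_free_gen is01_def)
  ultimately show ?thesis
    by (simp only: \<psi>_def proj_cls proj_free_def cls_0)
qed

end

section \<open>Left modules and extension of scalars\<close>

lemma (in left_module) smult_l_null:
  assumes "x \<in> carrier M"
  shows "\<zero>\<^bsub>R\<^esub> \<odot>\<^bsub>M\<^esub> x = \<zero>\<^bsub>M\<^esub>"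
proof -
  have "\<zero>\<^bsub>R\<^esub> \<odot>\<^bsub>M\<^esub> x \<oplus>\<^bsub>M\<^esub> \<zero>\<^bsub>R\<^esub> \<odot>\<^bsub>M\<^esub> x = \<zero>\<^bsub>R\<^esub> \<odot>\<^bsub>M\<^esub> x"
    using smult_l_distr[of "\<zero>\<^bsub>R\<^esub>" "\<zero>\<^bsub>R\<^esub>" x] assms by simp
  then show ?thesis
    using smult_closed[OF R.zero_closed assms] by (simp add: M.add.l_cancel_one)
qed

lemma (in left_module) smult_r_null:
  assumes "a \<in> carrier R"
  shows "a \<odot>\<^bsub>M\<^esub> \<zero>\<^bsub>M\<^esub> = \<zero>\<^bsub>M\<^esub>"
proof -
  have "a \<odot>\<^bsub>M\<^esub> \<zero>\<^bsub>M\<^esub> \<oplus>\<^bsub>M\<^esub> a \<odot>\<^bsub>M\<^esub> \<zero>\<^bsub>M\<^esub> = a \<odot>\<^bsub>M\<^esub> \<zero>\<^bsub>M\<^esub>"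
    using smult_r_distr[of a "\<zero>\<^bsub>M\<^esub>" "\<zero>\<^bsub>M\<^esub>"] assms by simp
  then show ?thesis
    using smult_closed[OF assms M.zero_closed] by (simp add: M.add.l_cancel_one)
qed

lemma (in left_module) smult_l_minus:
  assumes "a \<in> carrier R" "x \<in> carrier M"
  shows "(\<ominus>\<^bsub>R\<^esub> a) \<odot>\<^bsub>M\<^esub> x = \<ominus>\<^bsub>M\<^esub> (a \<odot>\<^bsub>M\<^esub> x)"
proof -
  have "(\<ominus>\<^bsub>R\<^esub> a) \<odot>\<^bsub>M\<^esub> x \<oplus>\<^bsub>M\<^esub> a \<odot>\<^bsub>M\<^esub> x = \<zero>\<^bsub>M\<^esub>"
    using smult_l_distr[of "\<ominus>\<^bsub>R\<^esub> a" a x] assms smult_l_null[of x] by (simp add: R.l_neg)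
  then show ?thesis
    using assms smult_closed by (simp add: M.minus_equality)
qed

lemma left_moduleI:
  assumes "ring R" "abelian_group M"
    and "\<And>a x. a \<in> carrier R \<Longrightarrow> x \<in> carrier M \<Longrightarrow> a \<odot>\<^bsub>M\<^esub> x \<in> carrier M"
    and "\<And>a b x. a \<in> carrier R \<Longrightarrow> b \<in> carrier R \<Longrightarrow> x \<in> carrier M
      \<Longrightarrow> (a \<oplus>\<^bsub>R\<^esub> b) \<odot>\<^bsub>M\<^esub> x = a \<odot>\<^bsub>M\<^esub> x \<oplus>\<^bsub>M\<^esub> b \<odot>\<^bsub>M\<^esub> x"
    and "\<And>a x y. a \<in> carrier R \<Longrightarrow> x \<in> carrier M \<Longrightarrow> y \<in> carrier M
      \<Longrightarrow> a \<odot>\<^bsub>M\<^esub> (x \<oplus>\<^bsub>M\<^esub> y) = a \<odot>\<^bsub>M\<^esub> x \<oplus>\<^bsub>M\<^esub> a \<odot>\<^bsub>M\<^esub> y"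
    and "\<And>a b x. a \<in> carrier R \<Longrightarrow> b \<in> carrier R \<Longrightarrow> x \<in> carrier M
      \<Longrightarrow> (a \<otimes>\<^bsub>R\<^esub> b) \<odot>\<^bsub>M\<^esub> x = a \<odot>\<^bsub>M\<^esub> (b \<odot>\<^bsub>M\<^esub> x)"
    and "\<And>x. x \<in> carrier M \<Longrightarrow> \<one>\<^bsub>R\<^esub> \<odot>\<^bsub>M\<^esub> x = x"
  shows "left_module R M"
  using assms by (simp add: left_module_def left_module_axioms_def)

lemma left_module_group: "left_module R M \<Longrightarrow> abelian_group M"
  by (simp add: left_module_def)

lemma module_homI:
  assumes "f \<in> extensional (carrier M)"
    and "\<And>x. x \<in> carrier M \<Longrightarrow> f x \<in> carrier N"
    and "\<And>x y. x \<in> carrier M \<Longrightarrow> y \<in> carrier M \<Longrightarrow> f (x \<oplus>\<^bsub>M\<^esub> y) = f x \<oplus>\<^bsub>N\<^esub> f y"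
    and "\<And>a x. a \<in> carrier R \<Longrightarrow> x \<in> carrier M \<Longrightarrow> f (a \<odot>\<^bsub>M\<^esub> x) = a \<odot>\<^bsub>N\<^esub> f x"
  shows "f \<in> module_hom R M N"
  using assms by (auto simp: module_hom_def PiE_def)

lemma module_hom_extensional: "f \<in> module_hom R M N \<Longrightarrow> f \<in> extensional (carrier M)"
  and module_hom_closed: "f \<in> module_hom R M N \<Longrightarrow> x \<in> carrier M \<Longrightarrow> f x \<in> carrier N"
  and module_hom_add: "f \<in> module_hom R M N \<Longrightarrow> x \<in> carrier M \<Longrightarrow> y \<in> carrier M
    \<Longrightarrow> f (x \<oplus>\<^bsub>M\<^esub> y) = f x \<oplus>\<^bsub>N\<^esub> f y"
  and module_hom_smult: "f \<in> module_hom R M N \<Longrightarrow> a \<in> carrier R \<Longrightarrow> x \<in> carrier M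
    \<Longrightarrow> f (a \<odot>\<^bsub>M\<^esub> x) = a \<odot>\<^bsub>N\<^esub> f x"
  by (auto simp: module_hom_def PiE_def)

lemma module_hom_zero:
  assumes "abelian_group M" "abelian_group N" "f \<in> module_hom R M N"
  shows "f \<zero>\<^bsub>M\<^esub> = \<zero>\<^bsub>N\<^esub>"
proof -
  interpret M: abelian_group M by fact
  interpret N: abelian_group N by fact
  have "f \<zero>\<^bsub>M\<^esub> \<oplus>\<^bsub>N\<^esub> f \<zero>\<^bsub>M\<^esub> = f \<zero>\<^bsub>M\<^esub>"
    using module_hom_add[OF assms(3), of "\<zero>\<^bsub>M\<^esub>" "\<zero>\<^bsub>M\<^esub>"] by simp
  then show ?thesis
    using module_hom_closed[OF assms(3) M.zero_closed] by (simp add: N.add.l_cancel_one)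
qed

lemma module_hom_compose:
  assumes f: "f \<in> module_hom R L M" and g: "g \<in> module_hom R M N"
    and L: "left_module R L"
  shows "compose (carrier L) g f \<in> module_hom R L N"
proof -
  interpret L: left_module R L by fact
  show ?thesis
    by (rule module_homI)
      (simp_all add: compose_eq L.smult_closed module_hom_closed[OF f] module_hom_closed[OF g]
        module_hom_add[OF f] module_hom_add[OF g] module_hom_smult[OF f] module_hom_smult[OF g])
qed

lemma module_hom_id: "left_module R M \<Longrightarrow> (\<lambda>x\<in>carrier M. x) \<in> module_hom R M M"
  by (rule module_homI)
    (auto simp: left_module.smult_closed abelian_monoid.a_closed
      dest: left_module_group[THEN abelian_group.axioms(1)])

lemma Rep_simps:
  "M \<in> Obj (Rep R) \<longleftrightarrow> left_module R M" "Hom (Rep R) = module_hom R"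
  "Id (Rep R) M = (\<lambda>x\<in>carrier M. x)" "Comp (Rep R) L M N g f = compose (carrier L) g f"
  by (simp_all add: Rep_def)

text \<open>Morphisms are extensional, so the laws hold as equations between total
  functions.\<close>

lemma category_Rep: "category (Rep R)"
proof
  fix X Y f assume f: "f \<in> Hom (Rep R) X Y"
  then have f': "f \<in> module_hom R X Y" by (simp only: Rep_simps)
  note ext = extensional_arb[OF module_hom_extensional[OF f']]
  show "Comp (Rep R) X X Y f (Id (Rep R) X) = f"
    unfolding Rep_simps using ext by (auto simp: compose_def fun_eq_iff restrict_def)
  show "Comp (Rep R) X Y Y (Id (Rep R) Y) f = f"
    unfolding Rep_simps using ext module_hom_closed[OF f'] by (auto simp: compose_def fun_eq_iff restrict_def)
next
  fix W X Y Z f g h assume "f \<in> Hom (Rep R) W X"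
  then have f': "f \<in> module_hom R W X" by (simp only: Rep_simps)
  show "Comp (Rep R) W Y Z h (Comp (Rep R) W X Y g f) = Comp (Rep R) W X Z (Comp (Rep R) X Y Z h g) f"
    unfolding Rep_simps using module_hom_closed[OF f'] by (auto simp: compose_def fun_eq_iff restrict_def)
qed (simp_all only: Rep_simps module_hom_compose module_hom_id)

section \<open>Tensor products over a subring of a noncommutative ring\<close>

lemma (in abelian_group) add_diff_diff:
  assumes "x \<in> carrier G" "y \<in> carrier G"
  shows "x \<oplus> y \<ominus> x \<ominus> y = \<zero>"
proof -
  have "x \<oplus> y \<ominus> x \<ominus> y = (x \<oplus> y) \<oplus> \<ominus> (x \<oplus> y)"
    using assms by (simp add: minus_eq minus_add a_assoc)
  then show ?thesis using assms by (simp add: r_neg)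
qed

lemma keys_diff_subset:
  "Poly_Mapping.keys u \<subseteq> X \<Longrightarrow> Poly_Mapping.keys w \<subseteq> X \<Longrightarrow> Poly_Mapping.keys (u - w) \<subseteq> X"
  using keys_diff[of u w] by blast

locale extension_of_scalars = ring R for R :: "('r, 'a) ring_scheme" (structure) +
  fixes B :: "'r set" and V :: "('r, 'v, 'c) module_scheme"
  assumes subring: "subring B R" and mod: "left_module (R\<lparr>carrier := B\<rparr>) V"
begin

sublocale V: left_module "R\<lparr>carrier := B\<rparr>" V by (rule mod)

abbreviation "T \<equiv> pair_group R V"
abbreviation "N \<equiv> tensor_relations R B V"
abbreviation "Q \<equiv> induced_module R B V"
abbreviation "coset u \<equiv> N #>\<^bsub>T\<^esub> u"

definition tens :: "'r \<Rightarrow> 'v \<Rightarrow> ('r, 'v) tensor" where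
  "tens x v = coset (frag_of (x, v))"

lemma B_subset: "b \<in> B \<Longrightarrow> b \<in> carrier R"
  using subringE(1)[OF subring] by blast

lemma smult_B_closed: "b \<in> B \<Longrightarrow> v \<in> carrier V \<Longrightarrow> b \<odot>\<^bsub>V\<^esub> v \<in> carrier V"
  using V.smult_closed[of b v] by simp

lemma relations_induct [consumes 1, case_names left right balanced zero minus add]:
  assumes "u \<in> N"
    and "\<And>x y v. x \<in> carrier R \<Longrightarrow> y \<in> carrier R \<Longrightarrow> v \<in> carrier V
      \<Longrightarrow> P (frag_of (x \<oplus> y, v) - frag_of (x, v) - frag_of (y, v))"
    and "\<And>x v w. x \<in> carrier R \<Longrightarrow> v \<in> carrier V \<Longrightarrow> w \<in> carrier V
      \<Longrightarrow> P (frag_of (x, v \<oplus>\<^bsub>V\<^esub> w) - frag_of (x, v) - frag_of (x, w))"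
    and "\<And>x b v. x \<in> carrier R \<Longrightarrow> b \<in> B \<Longrightarrow> v \<in> carrier V
      \<Longrightarrow> P (frag_of (x \<otimes> b, v) - frag_of (x, b \<odot>\<^bsub>V\<^esub> v))"
    and "P 0" and "\<And>u. P u \<Longrightarrow> P (- u)" and "\<And>u w. P u \<Longrightarrow> P w \<Longrightarrow> P (u + w)"
  shows "P u"
  using assms(1) unfolding tensor_relations_def
proof (induction u rule: generate.induct)
  case (incl h)
  then show ?case by (elim UnE CollectE exE conjE) (simp_all only: assms(2-4))
next
  case (inv h)
  then have "P h" by (elim UnE CollectE exE conjE) (simp_all only: assms(2-4))
  \<comment> \<open>Membership in the carrier identifies the group inverse of \<open>h\<close> with
    \<open>- h\<close>.\<close>
  moreover have "h \<in> carrier T"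
    using inv
    by (elim UnE CollectE exE conjE) (simp_all add: keys_diff_subset B_subset smult_B_closed)
  ultimately show ?case using assms(6) by simp
qed (use assms(5,7) in simp_all)

lemma relations_subset: "N \<subseteq> carrier T"
proof
  fix u assume "u \<in> N"
  then show "u \<in> carrier T"
  proof (induction u rule: relations_induct)
    case (add u w)
    then show ?case by (auto dest!: subsetD[OF keys_add])
  qed (simp_all add: keys_diff_subset B_subset smult_B_closed)
qed

lemma subgroup_relations: "subgroup N T"
proof -
  interpret T: group T by simp
  show ?thesis
    unfolding tensor_relations_def
    by (intro T.generate_is_subgroup subset_trans[OF _ relations_subset[unfolded tensor_relations_def]]
        subsetI generate.incl)
qed

lemma normal_relations: "N \<lhd> T"
  using comm_group.normal_iff_subgroup[OF abelian_free_Abelian_group] subgroup_relations by blast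

lemma relations_in:
  shows "x \<in> carrier R \<Longrightarrow> y \<in> carrier R \<Longrightarrow> v \<in> carrier V
      \<Longrightarrow> frag_of (x \<oplus> y, v) - frag_of (x, v) - frag_of (y, v) \<in> N"
    and "x \<in> carrier R \<Longrightarrow> v \<in> carrier V \<Longrightarrow> w \<in> carrier V
      \<Longrightarrow> frag_of (x, v \<oplus>\<^bsub>V\<^esub> w) - frag_of (x, v) - frag_of (x, w) \<in> N"
    and "x \<in> carrier R \<Longrightarrow> b \<in> B \<Longrightarrow> v \<in> carrier V
      \<Longrightarrow> frag_of (x \<otimes> b, v) - frag_of (x, b \<odot>\<^bsub>V\<^esub> v) \<in> N"
  unfolding tensor_relations_def by (rule generate.incl, blast)+

lemma relations_closed: "0 \<in> N" "u \<in> N \<Longrightarrow> - u \<in> N" "u \<in> N \<Longrightarrow> w \<in> N \<Longrightarrow> u + w \<in> N"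
  using subgroup.one_closed[OF subgroup_relations] subgroup.m_inv_closed[OF subgroup_relations, of u]
    subgroup.m_closed[OF subgroup_relations, of u w] relations_subset by auto

lemma coset_eq_iff:
  assumes "u \<in> carrier T" "w \<in> carrier T"
  shows "coset u = coset w \<longleftrightarrow> u - w \<in> N"
proof -
  interpret T: group T by simp
  have "coset u = coset w \<longleftrightarrow> u \<in> coset w"
    using T.repr_independence[of u N w] T.rcos_self[of u N] subgroup_relations assms by metis
  also have "\<dots> \<longleftrightarrow> u - w \<in> N"
    by (auto simp: r_coset_def) (metis diff_add_cancel)
  finally show ?thesis .
qed

lemma carrier_Q: "carrier Q = coset ` carrier T"
  by (simp add: induced_module_def Let_def carrier_FactGroup)

lemma coset_closed: "u \<in> carrier T \<Longrightarrow> coset u \<in> carrier Q"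
  by (simp add: carrier_Q)

lemma zero_Q: "\<zero>\<^bsub>Q\<^esub> = coset 0"
  using subgroup_relations relations_closed(1) group.coset_join2[of T 0 N]
  by (simp add: induced_module_def Let_def)

lemma add_Q:
  assumes "u \<in> carrier T" "w \<in> carrier T"
  shows "coset u \<oplus>\<^bsub>Q\<^esub> coset w = coset (u + w)"
  using normal.rcos_sum[OF normal_relations assms] by (simp add: induced_module_def Let_def)

lemma abelian_group_Q: "abelian_group Q"
proof -
  have add: "u + w \<in> carrier T" if "u \<in> carrier T" "w \<in> carrier T" for u w
    using that by (auto dest!: subsetD[OF keys_add])
  have zero: "0 \<in> carrier T" by simp
  show ?thesis
  proof (rule abelian_groupI)
    fix S assume "S \<in> carrier Q"
    then obtain u where u: "u \<in> carrier T" "S = coset u" unfolding carrier_Q by blast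
    then have "coset (- u) \<in> carrier Q" "coset (- u) \<oplus>\<^bsub>Q\<^esub> S = \<zero>\<^bsub>Q\<^esub>"
      by (simp_all add: coset_closed add_Q zero_Q)
    then show "\<exists>S'\<in>carrier Q. S' \<oplus>\<^bsub>Q\<^esub> S = \<zero>\<^bsub>Q\<^esub>" by blast
  qed (unfold carrier_Q zero_Q, auto simp: add_Q add zero ac_simps simp del: carrier_free_Abelian_group_iff)
qed

sublocale Q: abelian_group Q by (rule abelian_group_Q)

lemma minus_Q:
  assumes "u \<in> carrier T"
  shows "\<ominus>\<^bsub>Q\<^esub> coset u = coset (- u)"
  by (rule Q.minus_equality) (use assms in \<open>simp_all add: add_Q zero_Q coset_closed\<close>)

lemma tens_closed: "x \<in> carrier R \<Longrightarrow> v \<in> carrier V \<Longrightarrow> tens x v \<in> carrier Q"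
  by (simp add: tens_def coset_closed)

lemma tens_add_left:
  assumes "x \<in> carrier R" "y \<in> carrier R" "v \<in> carrier V"
  shows "tens (x \<oplus> y) v = tens x v \<oplus>\<^bsub>Q\<^esub> tens y v"
proof -
  have "coset (frag_of (x \<oplus> y, v)) = coset (frag_of (x, v) + frag_of (y, v))"
    using relations_in(1)[OF assms] assms
    by (subst coset_eq_iff) (auto simp: algebra_simps dest!: subsetD[OF keys_add])
  then show ?thesis using assms by (simp add: tens_def add_Q)
qed

lemma tens_add_right:
  assumes "x \<in> carrier R" "v \<in> carrier V" "w \<in> carrier V"
  shows "tens x (v \<oplus>\<^bsub>V\<^esub> w) = tens x v \<oplus>\<^bsub>Q\<^esub> tens x w"
proof -
  have "coset (frag_of (x, v \<oplus>\<^bsub>V\<^esub> w)) = coset (frag_of (x, v) + frag_of (x, w))"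
    using relations_in(2)[OF assms] assms
    by (subst coset_eq_iff) (auto simp: algebra_simps dest!: subsetD[OF keys_add])
  then show ?thesis using assms by (simp add: tens_def add_Q)
qed

lemma tens_balanced:
  assumes "x \<in> carrier R" "b \<in> B" "v \<in> carrier V"
  shows "tens (x \<otimes> b) v = tens x (b \<odot>\<^bsub>V\<^esub> v)"
  unfolding tens_def
  by (subst coset_eq_iff) (use assms relations_in(3) in \<open>auto simp: B_subset smult_B_closed\<close>)

lemma tens_zero_left: "v \<in> carrier V \<Longrightarrow> tens \<zero> v = \<zero>\<^bsub>Q\<^esub>"
  using tens_add_left[of \<zero> \<zero> v] tens_closed[of \<zero> v] by (simp add: Q.add.l_cancel_one)

lemma tens_zero_right: "x \<in> carrier R \<Longrightarrow> tens x \<zero>\<^bsub>V\<^esub> = \<zero>\<^bsub>Q\<^esub>"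
  using tens_add_right[of x "\<zero>\<^bsub>V\<^esub>" "\<zero>\<^bsub>V\<^esub>"] tens_closed[of x "\<zero>\<^bsub>V\<^esub>"] by (simp add: Q.add.l_cancel_one)

lemma tens_minus_left: "x \<in> carrier R \<Longrightarrow> v \<in> carrier V \<Longrightarrow> tens (\<ominus> x) v = \<ominus>\<^bsub>Q\<^esub> tens x v"
  using tens_add_left[of "\<ominus> x" x v] by (intro Q.minus_equality[symmetric]) (simp_all add: tens_closed tens_zero_left l_neg)

text \<open>The free abelian group is exhausted by differences, while only sums are allowed here. A
  class and its negative are therefore treated together; the negative of a pure tensor is again a
  pure tensor.\<close>

lemma Q_induct [consumes 1, case_names tens add]:
  assumes "S \<in> carrier Q"
    and "\<And>x v. x \<in> carrier R \<Longrightarrow> v \<in> carrier V \<Longrightarrow> P (tens x v)"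
    and "\<And>S S'. S \<in> carrier Q \<Longrightarrow> S' \<in> carrier Q \<Longrightarrow> P S \<Longrightarrow> P S' \<Longrightarrow> P (S \<oplus>\<^bsub>Q\<^esub> S')"
  shows "P S"
proof -
  obtain u where u: "Poly_Mapping.keys u \<subseteq> carrier R \<times> carrier V" "S = coset u"
    using assms(1) by (auto simp: carrier_Q)
  have "P (coset u) \<and> P (coset (- u))"
    using u(1)
  proof (induction u rule: free_Abelian_group_induct[consumes 1, case_names zero diff of])
    case zero
    then show ?case
      using assms(2)[of \<zero> "\<zero>\<^bsub>V\<^esub>"] by (simp add: tens_zero_left zero_Q)
  next
    case (diff u w)
    then show ?case
      using assms(3)[of "coset u" "coset (- w)"] assms(3)[of "coset w" "coset (- u)"]
      by (simp add: add_Q coset_closed)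
  next
    case (of a)
    then show ?case
      using assms(2)[of "fst a" "snd a"] assms(2)[of "\<ominus> fst a" "snd a"]
      by (auto simp: tens_minus_left) (auto simp: tens_def minus_Q)
  qed
  then show ?thesis using u by simp
qed

text \<open>The module action and the induced maps are defined as unions over all representatives.
  Such a union collapses to one coset because changing the representative changes its image by a
  relation.\<close>

lemma lift_coset:
  fixes N' :: "('b \<Rightarrow>\<^sub>0 int) set" and h
  assumes u: "u \<in> carrier T" and diff: "\<And>u w. h (u - w) = h u - h w"
    and N': "subgroup N' (free_Abelian_group X)" and h: "\<And>u. u \<in> N \<Longrightarrow> h u \<in> N'"
    and hu: "h u \<in> carrier (free_Abelian_group X)"
  shows "(\<Union>w\<in>coset u. N' #>\<^bsub>free_Abelian_group X\<^esub> h w) = N' #>\<^bsub>free_Abelian_group X\<^esub> h u"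
proof -
  interpret X: group "free_Abelian_group X" by simp
  have "N' #>\<^bsub>free_Abelian_group X\<^esub> h w = N' #>\<^bsub>free_Abelian_group X\<^esub> h u" if w: "w \<in> coset u" for w
  proof -
    obtain n where n: "n \<in> N" "w = n + u"
      using w unfolding r_coset_def mult_free_Abelian_group by blast
    then have "h w - h u \<in> N'" using h[OF n(1)] diff[of w u] by simp
    then have "h w \<in> N' #>\<^bsub>free_Abelian_group X\<^esub> h u"
      by (auto simp: r_coset_def intro!: bexI[of _ "h w - h u"])
    then show ?thesis
      using X.repr_independence[OF _ hu N'] by simp
  qed
  moreover have "u \<in> coset u"
    using group.rcos_self[of T u N] u subgroup_relations by simp
  ultimately show ?thesis by blast
qed

text \<open>Meant for left multiplication by a ring element, which commutes with right
  multiplication by \<open>B\<close>.\<close>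

lemma extension_map_relations:
  assumes add: "\<And>x y. x \<in> carrier R \<Longrightarrow> y \<in> carrier R \<Longrightarrow> f (x \<oplus> y) = f x \<oplus> f y"
    and mult: "\<And>x b. x \<in> carrier R \<Longrightarrow> b \<in> B \<Longrightarrow> f (x \<otimes> b) = f x \<otimes> b"
    and f: "\<And>x. x \<in> carrier R \<Longrightarrow> f x \<in> carrier R"
    and u: "u \<in> N"
  shows "frag_extend (\<lambda>(x, v). frag_of (f x, v)) u \<in> N"
  using u
proof (induction u rule: relations_induct)
  case (left x y v)
  then show ?case using relations_in(1)[of "f x" "f y" v] by (simp add: frag_extend_diff add f)
next
  case (right x v w)
  then show ?case using relations_in(2)[of "f x" v w] by (simp add: frag_extend_diff f)
next
  case (balanced x b v)
  then show ?case using relations_in(3)[of "f x" b v] by (simp add: frag_extend_diff mult f)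
qed (simp_all add: relations_closed frag_extend_minus frag_extend_add)

lemma smult_coset:
  assumes a: "a \<in> carrier R" and u: "u \<in> carrier T"
  shows "a \<odot>\<^bsub>Q\<^esub> coset u = coset (frag_extend (\<lambda>(x, v). frag_of (a \<otimes> x, v)) u)"
    and "frag_extend (\<lambda>(x, v). frag_of (a \<otimes> x, v)) u \<in> carrier T"
proof -
  let ?h = "frag_extend (\<lambda>(x, v). frag_of (a \<otimes> x, v))"
  show hu: "?h u \<in> carrier T"
    using a u keys_frag_extend[of "\<lambda>(x, v). frag_of (a \<otimes> x, v)" u] by fastforce
  have "(\<Union>w\<in>coset u. coset (?h w)) = coset (?h u)"
  proof (rule lift_coset[OF u frag_extend_diff subgroup_relations _ hu])
    show "?h w \<in> N" if "w \<in> N" for w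
      by (rule extension_map_relations[OF _ _ _ that]) (use a B_subset in \<open>simp_all add: r_distr m_assoc\<close>)
  qed
  then show "a \<odot>\<^bsub>Q\<^esub> coset u = coset (?h u)"
    by (simp add: induced_module_def Let_def)
qed

lemma smult_tens:
  assumes "a \<in> carrier R" "x \<in> carrier R" "v \<in> carrier V"
  shows "a \<odot>\<^bsub>Q\<^esub> tens x v = tens (a \<otimes> x) v"
  using assms by (simp add: tens_def smult_coset)

lemma smult_Q_closed:
  assumes "a \<in> carrier R" "S \<in> carrier Q"
  shows "a \<odot>\<^bsub>Q\<^esub> S \<in> carrier Q"
proof -
  obtain u where u: "u \<in> carrier T" "S = coset u"
    using assms(2) unfolding carrier_Q by blast
  show ?thesis
    unfolding u(2) smult_coset(1)[OF assms(1) u(1)] by (rule coset_closed[OF smult_coset(2)[OF assms(1) u(1)]])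
qed

lemma smult_Q_add:
  assumes "a \<in> carrier R" "S \<in> carrier Q" "S' \<in> carrier Q"
  shows "a \<odot>\<^bsub>Q\<^esub> (S \<oplus>\<^bsub>Q\<^esub> S') = a \<odot>\<^bsub>Q\<^esub> S \<oplus>\<^bsub>Q\<^esub> a \<odot>\<^bsub>Q\<^esub> S'"
proof -
  obtain u w where u: "u \<in> carrier T" "S = coset u" and w: "w \<in> carrier T" "S' = coset w"
    using assms(2,3) unfolding carrier_Q by blast
  have "u + w \<in> carrier T" using u w by (auto dest!: subsetD[OF keys_add])
  then show ?thesis
    using smult_coset[OF assms(1) u(1)] smult_coset[OF assms(1) w(1)] smult_coset[OF assms(1), of "u + w"]
    by (simp only: u w add_Q frag_extend_add)
qed

lemma left_module_Q: "left_module R Q"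
proof (rule left_moduleI)
  fix a b S assume ab: "a \<in> carrier R" "b \<in> carrier R" and S: "S \<in> carrier Q"
  show "(a \<oplus> b) \<odot>\<^bsub>Q\<^esub> S = a \<odot>\<^bsub>Q\<^esub> S \<oplus>\<^bsub>Q\<^esub> b \<odot>\<^bsub>Q\<^esub> S"
    using S
  proof (induction S rule: Q_induct)
    case (tens x v)
    then show ?case using ab by (simp add: smult_tens l_distr tens_add_left)
  next
    case (add S S')
    then show ?case using ab by (simp add: smult_Q_add smult_Q_closed Q.add.m_ac)
  qed
  show "(a \<otimes> b) \<odot>\<^bsub>Q\<^esub> S = a \<odot>\<^bsub>Q\<^esub> (b \<odot>\<^bsub>Q\<^esub> S)"
    using S
  proof (induction S rule: Q_induct)
    case (tens x v)
    then show ?case using ab by (simp add: smult_tens m_assoc)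
  next
    case (add S S')
    then show ?case using ab by (simp add: smult_Q_add smult_Q_closed)
  qed
next
  fix S assume "S \<in> carrier Q"
  then show "\<one> \<odot>\<^bsub>Q\<^esub> S = S"
    by (induction S rule: Q_induct) (simp_all add: smult_tens smult_Q_add)
qed (simp_all add: ring_axioms abelian_group_Q smult_Q_closed smult_Q_add)

lemma tens_eq_smult: "x \<in> carrier R \<Longrightarrow> v \<in> carrier V \<Longrightarrow> tens x v = x \<odot>\<^bsub>Q\<^esub> tens \<one> v"
  by (simp add: smult_tens)

text \<open>The elements \<open>tens \<one> v\<close> generate the module, since
  \<open>tens x v\<close> is \<open>x\<close> applied to one of them.\<close>

lemma module_hom_Q_eqI:
  assumes "f \<in> module_hom R Q M" "g \<in> module_hom R Q M"
    and "\<And>v. v \<in> carrier V \<Longrightarrow> f (tens \<one> v) = g (tens \<one> v)"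
  shows "f = g"
proof (rule extensionalityI[OF assms(1,2)[THEN module_hom_extensional]])
  fix S assume "S \<in> carrier Q"
  then show "f S = g S"
  proof (induction S rule: Q_induct)
    case (tens x v)
    then show ?case
      using assms(3) module_hom_smult[OF assms(1), of x "tens \<one> v"] module_hom_smult[OF assms(2), of x "tens \<one> v"]
      by (simp add: tens_closed smult_tens)
  next
    case (add S S')
    then show ?case by (simp add: module_hom_add[OF assms(1)] module_hom_add[OF assms(2)])
  qed
qed

text \<open>Only the values on pure tensors are recorded: the mere existence of such a function is
  what tells two pure tensors apart.\<close>

lemma universal:
  assumes "abelian_group M"
    and \<phi>: "\<And>x v. x \<in> carrier R \<Longrightarrow> v \<in> carrier V \<Longrightarrow> \<phi> x v \<in> carrier M"
    and left: "\<And>x y v. x \<in> carrier R \<Longrightarrow> y \<in> carrier R \<Longrightarrow> v \<in> carrier V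
      \<Longrightarrow> \<phi> (x \<oplus> y) v = \<phi> x v \<oplus>\<^bsub>M\<^esub> \<phi> y v"
    and right: "\<And>x v w. x \<in> carrier R \<Longrightarrow> v \<in> carrier V \<Longrightarrow> w \<in> carrier V
      \<Longrightarrow> \<phi> x (v \<oplus>\<^bsub>V\<^esub> w) = \<phi> x v \<oplus>\<^bsub>M\<^esub> \<phi> x w"
    and balanced: "\<And>x b v. x \<in> carrier R \<Longrightarrow> b \<in> B \<Longrightarrow> v \<in> carrier V
      \<Longrightarrow> \<phi> (x \<otimes> b) v = \<phi> x (b \<odot>\<^bsub>V\<^esub> v)"
  obtains \<Phi> where "\<And>x v. x \<in> carrier R \<Longrightarrow> v \<in> carrier V \<Longrightarrow> \<Phi> (tens x v) = \<phi> x v"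
proof -
  interpret M: abelian_group M by fact
  have M: "comm_group (add_monoid M)" by (rule M.a_comm_group)
  obtain h where h: "h \<in> hom T (add_monoid M)"
    and h_of: "\<And>p. p \<in> carrier R \<times> carrier V \<Longrightarrow> h (frag_of p) = (\<lambda>(x, v). \<phi> x v) p"
  proof (rule comm_group.free_Abelian_group_universal[OF M, of "\<lambda>(x, v). \<phi> x v" "carrier R \<times> carrier V"])
    show "(\<lambda>(x, v). \<phi> x v) ` (carrier R \<times> carrier V) \<subseteq> carrier (add_monoid M)" using \<phi> by auto
  qed (rule that)
  interpret h: group_hom T "add_monoid M" h
    using h by (simp add: group_hom_def group_hom_axioms_def M.a_group)
  have h_minus: "h (- u) = \<ominus>\<^bsub>M\<^esub> h u" if "u \<in> carrier T" for u
    using h.hom_inv[OF that] that by (simp add: a_inv_def)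
  have h_add: "h (u + w) = h u \<oplus>\<^bsub>M\<^esub> h w" if "u \<in> carrier T" "w \<in> carrier T" for u w
    using h.hom_mult[OF that] by simp
  have h_diff: "h (u - w) = h u \<ominus>\<^bsub>M\<^esub> h w" if "u \<in> carrier T" "w \<in> carrier T" for u w
    using h_add[of u "- w"] h_minus[of w] that by (simp add: a_minus_def)
  have h_closed: "h u \<in> carrier M" if "u \<in> carrier T" for u
    using h.hom_closed[OF that] by simp
  have frag: "frag_of (x, v) \<in> carrier T" if "x \<in> carrier R" "v \<in> carrier V" for x v
    using that by simp
  have diff: "u - w \<in> carrier T" if "u \<in> carrier T" "w \<in> carrier T" for u w
    using that by (simp only: carrier_free_Abelian_group_iff keys_diff_subset)
  have h_frag: "h (frag_of (x, v)) = \<phi> x v" if "x \<in> carrier R" "v \<in> carrier V" for x v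
    using h_of[of "(x, v)"] that by simp
  \<comment> \<open>As \<open>h\<close> is a homomorphism on the carrier only, membership is carried
    through the induction.\<close>
  have "h u = \<zero>\<^bsub>M\<^esub> \<and> u \<in> carrier T" if "u \<in> N" for u
    using that
  proof (induction u rule: relations_induct)
    case (left x y v)
    note c = left add.m_closed[OF left(1,2)]
    have "h (frag_of (x \<oplus> y, v) - frag_of (x, v) - frag_of (y, v)) = \<phi> x v \<oplus>\<^bsub>M\<^esub> \<phi> y v \<ominus>\<^bsub>M\<^esub> \<phi> x v \<ominus>\<^bsub>M\<^esub> \<phi> y v"
      by (simp only: h_diff diff frag h_frag c assms(3)[OF left])
    then show ?case
      using c by (auto intro!: diff frag simp: \<phi> M.add_diff_diff simp del: carrier_free_Abelian_group_iff)
  next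
    case (right x v w)
    note c = right V.M.add.m_closed[OF right(2,3)]
    have "h (frag_of (x, v \<oplus>\<^bsub>V\<^esub> w) - frag_of (x, v) - frag_of (x, w)) = \<phi> x v \<oplus>\<^bsub>M\<^esub> \<phi> x w \<ominus>\<^bsub>M\<^esub> \<phi> x v \<ominus>\<^bsub>M\<^esub> \<phi> x w"
      by (simp only: h_diff diff frag h_frag c assms(4)[OF right])
    then show ?case
      using c by (auto intro!: diff frag simp: \<phi> M.add_diff_diff simp del: carrier_free_Abelian_group_iff)
  next
    case (balanced x b v)
    note c = balanced m_closed[OF balanced(1) B_subset[OF balanced(2)]] smult_B_closed[OF balanced(2,3)]
    have "h (frag_of (x \<otimes> b, v) - frag_of (x, b \<odot>\<^bsub>V\<^esub> v)) = \<phi> x (b \<odot>\<^bsub>V\<^esub> v) \<ominus>\<^bsub>M\<^esub> \<phi> x (b \<odot>\<^bsub>V\<^esub> v)"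
      by (simp only: h_diff diff frag h_frag c assms(5)[OF balanced])
    then show ?case
      using c by (auto intro!: diff frag simp: \<phi> M.minus_eq M.r_neg simp del: carrier_free_Abelian_group_iff)
  next
    case zero
    show ?case using h.hom_one by simp
  next
    case (minus u)
    then show ?case using h_minus[of u] by simp
  next
    case (add u w)
    then show ?case using h_add[of u w] by (auto dest!: subsetD[OF keys_add])
  qed
  then have "N \<subseteq> kernel T (add_monoid M) h"
    by (auto simp: kernel_def)
  then obtain g where "\<And>u. u \<in> carrier T \<Longrightarrow> g (coset u) = h u"
    using h.FactGroup_universal_kernel[OF normal_relations] by blast
  then have "g (tens x v) = \<phi> x v" if "x \<in> carrier R" "v \<in> carrier V" for x v
    using that h_of[of "(x, v)"] by (simp add: tens_def)
  then show thesis by (rule that)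
qed

end

section \<open>Functoriality of extension of scalars\<close>

locale extension_pair = V: extension_of_scalars R B V + W: extension_of_scalars R B W
  for R :: "('r, 'a) ring_scheme" (structure) and B :: "'r set"
    and V :: "('r, 'v, 'c) module_scheme" and W :: "('r, 'w, 'd) module_scheme" +
  fixes f :: "'v \<Rightarrow> 'w"
  assumes f: "f \<in> module_hom (R\<lparr>carrier := B\<rparr>) V W"
begin

abbreviation "ext u \<equiv> frag_extend (\<lambda>(x, v). frag_of (x, f v)) u"

lemma ext_closed:
  assumes "u \<in> carrier V.T"
  shows "ext u \<in> carrier W.T"
  unfolding carrier_free_Abelian_group_iff
proof (rule order_trans[OF keys_frag_extend UN_least])
  fix p assume "p \<in> Poly_Mapping.keys u"
  then have "p \<in> carrier R \<times> carrier V" using assms by auto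
  then show "Poly_Mapping.keys (case p of (x, v) \<Rightarrow> frag_of (x, f v)) \<subseteq> carrier R \<times> carrier W"
    using module_hom_closed[OF f] by auto
qed

lemma ext_relations: "u \<in> V.N \<Longrightarrow> ext u \<in> W.N"
proof (induction u rule: V.relations_induct)
  case (left x y v)
  then show ?case using W.relations_in(1)[of x y "f v"] by (simp add: frag_extend_diff module_hom_closed[OF f])
next
  case (right x v w)
  then show ?case
    using W.relations_in(2)[of x "f v" "f w"]
    by (simp add: frag_extend_diff module_hom_closed[OF f] module_hom_add[OF f])
next
  case (balanced x b v)
  then have "f (b \<odot>\<^bsub>V\<^esub> v) = b \<odot>\<^bsub>W\<^esub> f v" using module_hom_smult[OF f, of b v] by simp
  then show ?case
    using balanced W.relations_in(3)[of x b "f v"] by (simp add: frag_extend_diff module_hom_closed[OF f])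
qed (simp_all add: W.relations_closed frag_extend_minus frag_extend_add)

lemma induced_map_coset:
  assumes "u \<in> carrier V.T"
  shows "induced_map R B V W f (V.coset u) = W.coset (ext u)"
proof -
  have "(\<Union>w\<in>V.coset u. W.coset (ext w)) = W.coset (ext u)"
    by (rule V.lift_coset[OF assms frag_extend_diff W.subgroup_relations ext_relations ext_closed[OF assms]])
  then show ?thesis
    using V.coset_closed[OF assms] by (simp add: induced_map_def)
qed

lemma induced_map_tens:
  "x \<in> carrier R \<Longrightarrow> v \<in> carrier V \<Longrightarrow> induced_map R B V W f (V.tens x v) = W.tens x (f v)"
  by (simp add: V.tens_def W.tens_def induced_map_coset)

lemma induced_map_closed:
  assumes "S \<in> carrier V.Q"
  shows "induced_map R B V W f S \<in> carrier W.Q"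
proof -
  obtain u where u: "u \<in> carrier V.T" "S = V.coset u" using assms unfolding V.carrier_Q by blast
  show ?thesis unfolding u(2) induced_map_coset[OF u(1)] by (rule W.coset_closed[OF ext_closed[OF u(1)]])
qed

lemma induced_map_add:
  assumes "S \<in> carrier V.Q" "S' \<in> carrier V.Q"
  shows "induced_map R B V W f (S \<oplus>\<^bsub>V.Q\<^esub> S') = induced_map R B V W f S \<oplus>\<^bsub>W.Q\<^esub> induced_map R B V W f S'"
proof -
  obtain u w where u: "u \<in> carrier V.T" "S = V.coset u" and w: "w \<in> carrier V.T" "S' = V.coset w"
    using assms unfolding V.carrier_Q by blast
  have "u + w \<in> carrier V.T" using u w by (auto dest!: subsetD[OF keys_add])
  then show ?thesis
    using u(1) w(1)
    by (simp only: u(2) w(2) V.add_Q W.add_Q induced_map_coset ext_closed frag_extend_add)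
qed

lemma induced_map_hom: "induced_map R B V W f \<in> module_hom R V.Q W.Q"
proof (rule module_homI)
  fix a S assume a: "a \<in> carrier R" and S: "S \<in> carrier V.Q"
  show "induced_map R B V W f (a \<odot>\<^bsub>V.Q\<^esub> S) = a \<odot>\<^bsub>W.Q\<^esub> induced_map R B V W f S"
    using S
  proof (induction S rule: V.Q_induct)
    case (tens x v)
    then show ?case
      using a by (simp add: V.smult_tens W.smult_tens induced_map_tens module_hom_closed[OF f])
  next
    case (add S S')
    then show ?case
      using a by (simp add: V.smult_Q_add V.smult_Q_closed W.smult_Q_add induced_map_add induced_map_closed)
  qed
qed (simp_all add: induced_map_closed induced_map_add, simp add: induced_map_def)

end

section \<open>Equivalences of categories and simple objects\<close>

lemma (in category) Comp_inverse_left: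
  assumes "X \<in> Obj C" "Y \<in> Obj C" "Z \<in> Obj C" "f \<in> Hom C Z X" "a \<in> Hom C X Y" "b \<in> Hom C Y X"
    and "Comp C X Y X b a = Id C X"
  shows "Comp C Z Y X b (Comp C Z X Y a f) = f"
  using assms by (simp add: Comp_assoc[of Z X Y X f a b] Comp_Id_left)

lemma (in category) Comp_inverse_right:
  assumes "X \<in> Obj C" "Y \<in> Obj C" "Z \<in> Obj C" "f \<in> Hom C X Z" "a \<in> Hom C X Y" "b \<in> Hom C Y X"
    and "Comp C X Y X b a = Id C X"
  shows "Comp C X Y Z (Comp C Y X Z f b) a = f"
  using assms by (simp add: Comp_Id_right flip: Comp_assoc[of X Y X Z a b f])

lemma iso_in_hom: "iso_in C X Y f \<Longrightarrow> f \<in> Hom C X Y"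
  by (simp add: iso_in_def)

lemma iso_in_inverse:
  assumes "iso_in C X Y f"
  obtains g where "iso_in C Y X g" "Comp C X Y X g f = Id C X" "Comp C Y X Y f g = Id C Y"
  using assms by (auto simp: iso_in_def)

lemma (in category) iso_in_Id: "X \<in> Obj C \<Longrightarrow> iso_in C X X (Id C X)"
  using Id_in Comp_Id_left by (auto simp: iso_in_def)

lemma (in category) iso_in_Comp:
  assumes ob: "X \<in> Obj C" "Y \<in> Obj C" "Z \<in> Obj C" and f: "iso_in C X Y f" and g: "iso_in C Y Z g"
  shows "iso_in C X Z (Comp C X Y Z g f)"
proof -
  obtain f' where f': "iso_in C Y X f'" "Comp C X Y X f' f = Id C X" "Comp C Y X Y f f' = Id C Y"
    using iso_in_inverse[OF f] .
  obtain g' where g': "iso_in C Z Y g'" "Comp C Y Z Y g' g = Id C Y" "Comp C Z Y Z g g' = Id C Z"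
    using iso_in_inverse[OF g] .
  note h = f[THEN iso_in_hom] g[THEN iso_in_hom] f'(1)[THEN iso_in_hom] g'(1)[THEN iso_in_hom]
  have "Comp C X Z X (Comp C Z Y X f' g') (Comp C X Y Z g f) = Comp C X Y X f' (Comp C X Z Y g' (Comp C X Y Z g f))"
    using ob h by (simp add: Comp_assoc[of X Z Y X] Comp_in)
  also have "\<dots> = Id C X"
    using ob h f' g' by (simp add: Comp_inverse_left)
  finally have 1: "Comp C X Z X (Comp C Z Y X f' g') (Comp C X Y Z g f) = Id C X" .
  have "Comp C Z X Z (Comp C X Y Z g f) (Comp C Z Y X f' g') = Comp C Z Y Z g (Comp C Z X Y f (Comp C Z Y X f' g'))"
    using ob h by (simp add: Comp_assoc[of Z X Y Z] Comp_in)
  also have "\<dots> = Id C Z"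
    using ob h f' g' by (simp add: Comp_inverse_left)
  finally show ?thesis
    using 1 ob h Comp_in[of X Y Z f g] Comp_in[of Z Y X g' f'] by (auto simp: iso_in_def)
qed

text \<open>Conjugation by \<open>a\<close> and \<open>b\<close> identifies the two
  Hom-sets.\<close>

lemma (in category) ex1_hom_iso:
  assumes ob: "X \<in> Obj C" "Y \<in> Obj C" "X' \<in> Obj C" "Y' \<in> Obj C"
    and a: "iso_in C X X' a" and b: "iso_in C Y Y' b" and ex1: "\<exists>!f. f \<in> Hom C X Y"
  shows "\<exists>!f. f \<in> Hom C X' Y'"
proof -
  obtain a' where a': "iso_in C X' X a'" "Comp C X X' X a' a = Id C X" "Comp C X' X X' a a' = Id C X'"
    using iso_in_inverse[OF a] .
  obtain b' where b': "iso_in C Y' Y b'" "Comp C Y Y' Y b' b = Id C Y" "Comp C Y' Y Y' b b' = Id C Y'"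
    using iso_in_inverse[OF b] .
  note h = a[THEN iso_in_hom] b[THEN iso_in_hom] a'(1)[THEN iso_in_hom] b'(1)[THEN iso_in_hom]
  obtain f where f: "f \<in> Hom C X Y" using ex1 by blast
  show ?thesis
  proof (rule ex1I)
    show "Comp C X' Y Y' b (Comp C X' X Y f a') \<in> Hom C X' Y'"
      using ob h f by (simp add: Comp_in)
    show "g = Comp C X' Y Y' b (Comp C X' X Y f a')" if g: "g \<in> Hom C X' Y'" for g
    proof -
      have "Comp C X X' Y (Comp C X' Y' Y b' g) a \<in> Hom C X Y"
        using ob h g by (simp add: Comp_in)
      then have "Comp C X X' Y (Comp C X' Y' Y b' g) a = f" using ex1 f by blast
      then show ?thesis
        using ob h g a' b' by (simp add: Comp_inverse_left Comp_inverse_right Comp_in flip: \<open>_ = f\<close>)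
    qed
  qed
qed

lemma (in category) zero_object_iso:
  assumes "zero_object C X" "Y \<in> Obj C" "iso_in C X Y a"
  shows "zero_object C Y"
  unfolding zero_object_def
proof (intro conjI ballI)
  have X: "X \<in> Obj C" using assms(1) by (simp add: zero_object_def)
  show "Y \<in> Obj C" by fact
  fix Z assume Z: "Z \<in> Obj C"
  then have ex1: "\<exists>!f. f \<in> Hom C X Z" "\<exists>!f. f \<in> Hom C Z X"
    using assms(1) by (simp_all add: zero_object_def)
  show "\<exists>!f. f \<in> Hom C Y Z"
    by (rule ex1_hom_iso[OF X Z assms(2) Z assms(3) iso_in_Id[OF Z] ex1(1)])
  show "\<exists>!f. f \<in> Hom C Z Y"
    by (rule ex1_hom_iso[OF Z X Z assms(2) iso_in_Id[OF Z] assms(3) ex1(2)])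
qed

lemma mono_in_hom: "mono_in C X Y f \<Longrightarrow> f \<in> Hom C X Y"
  by (simp add: mono_in_def)

lemma mono_inD:
  "mono_in C X Y f \<Longrightarrow> Z \<in> Obj C \<Longrightarrow> g \<in> Hom C Z X \<Longrightarrow> h \<in> Hom C Z X
    \<Longrightarrow> Comp C Z X Y f g = Comp C Z X Y f h \<Longrightarrow> g = h"
  by (auto simp: mono_in_def)

lemma (in category) iso_in_mono:
  assumes "X \<in> Obj C" "Y \<in> Obj C" "iso_in C X Y a"
  shows "mono_in C X Y a"
proof -
  obtain b where "iso_in C Y X b" "Comp C X Y X b a = Id C X" using iso_in_inverse[OF assms(3)] .
  then show ?thesis
    unfolding mono_in_def using assms iso_in_hom Comp_inverse_left by metis
qed

lemma (in category) mono_in_Comp: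
  assumes ob: "X \<in> Obj C" "Y \<in> Obj C" "Z \<in> Obj C" and f: "mono_in C X Y f" and g: "mono_in C Y Z g"
  shows "mono_in C X Z (Comp C X Y Z g f)"
  unfolding mono_in_def
proof (intro conjI ballI impI)
  note h = mono_in_hom[OF f] mono_in_hom[OF g]
  show "Comp C X Y Z g f \<in> Hom C X Z" using ob h by (rule Comp_in)
  fix W u v
  assume W: "W \<in> Obj C" and uv: "u \<in> Hom C W X" "v \<in> Hom C W X"
    and eq: "Comp C W X Z (Comp C X Y Z g f) u = Comp C W X Z (Comp C X Y Z g f) v"
  have "Comp C W Y Z g (Comp C W X Y f u) = Comp C W Y Z g (Comp C W X Y f v)"
    using W uv ob h eq by (simp add: Comp_assoc)
  then have "Comp C W X Y f u = Comp C W X Y f v"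
    using mono_inD[OF g W] W uv ob h Comp_in by blast
  then show "u = v" using mono_inD[OF f W uv] by blast
qed

text \<open>A monomorphism into \<open>Y\<close> becomes one into \<open>X\<close> after composition
  with the inverse isomorphism, and composing with \<open>a\<close> recovers it.\<close>

lemma (in category) simple_object_iso:
  assumes X: "simple_object C X" and Y: "Y \<in> Obj C" and a: "iso_in C X Y a"
  shows "simple_object C Y"
  unfolding simple_object_def
proof (intro conjI ballI allI impI)
  have X': "X \<in> Obj C" using X by (simp add: simple_object_def)
  obtain b where b: "iso_in C Y X b" "Comp C X Y X b a = Id C X" "Comp C Y X Y a b = Id C Y"
    using iso_in_inverse[OF a] .
  show "Y \<in> Obj C" by fact
  show "\<not> zero_object C Y"
    using X zero_object_iso[OF _ X' b(1)] by (auto simp: simple_object_def)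
  fix Z f assume Z: "Z \<in> Obj C" and f: "mono_in C Z Y f"
  have "mono_in C Z X (Comp C Z Y X b f)"
    using mono_in_Comp[OF Z Y X' f iso_in_mono[OF Y X' b(1)]] .
  then have "zero_object C Z \<or> iso_in C Z X (Comp C Z Y X b f)"
    using X Z by (auto simp: simple_object_def)
  moreover have "iso_in C Z Y f" if "iso_in C Z X (Comp C Z Y X b f)"
    using iso_in_Comp[OF Z X' Y that a] Comp_inverse_left[OF Y X' Z mono_in_hom[OF f] iso_in_hom[OF b(1)] iso_in_hom[OF a] b(3)]
    by simp
  ultimately show "zero_object C Z \<or> iso_in C Z Y f" by blast
qed

lemma isomorphic_in_sym: "isomorphic_in C X Y \<Longrightarrow> isomorphic_in C Y X"
  unfolding isomorphic_in_def using iso_in_inverse by metis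

section \<open>Fully faithful functors\<close>

locale fully_faithful_functor = is_functor C D F
  for C :: "('o, 'm) category" and D :: "('p, 'n) category" and F +
  assumes bij: "X \<in> Obj C \<Longrightarrow> Y \<in> Obj C
    \<Longrightarrow> bij_betw (fmor F X Y) (Hom C X Y) (Hom D (fobj F X) (fobj F Y))"
begin

lemma faithful:
  "X \<in> Obj C \<Longrightarrow> Y \<in> Obj C \<Longrightarrow> f \<in> Hom C X Y \<Longrightarrow> g \<in> Hom C X Y \<Longrightarrow> fmor F X Y f = fmor F X Y g \<Longrightarrow> f = g"
  using bij[of X Y] by (auto simp: bij_betw_def dest: inj_onD)

lemma full:
  assumes "X \<in> Obj C" "Y \<in> Obj C" "g \<in> Hom D (fobj F X) (fobj F Y)"
  obtains f where "f \<in> Hom C X Y" "fmor F X Y f = g"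
proof -
  have "g \<in> fmor F X Y ` Hom C X Y"
    using bij[OF assms(1,2)] assms(3) by (simp add: bij_betw_def)
  then show thesis using that by blast
qed

lemma fmor_iso:
  assumes ob: "X \<in> Obj C" "Y \<in> Obj C" and f: "iso_in C X Y f"
  shows "iso_in D (fobj F X) (fobj F Y) (fmor F X Y f)"
proof -
  obtain g where g: "iso_in C Y X g" "Comp C X Y X g f = Id C X" "Comp C Y X Y f g = Id C Y"
    using iso_in_inverse[OF f] .
  note h = iso_in_hom[OF f] iso_in_hom[OF g(1)]
  show ?thesis
    unfolding iso_in_def
    using fmor_in ob h fmor_Comp[of X Y X f g] fmor_Comp[of Y X Y g f] fmor_Id g by auto
qed

text \<open>Fullness lifts the inverse; faithfulness turns the two inverse laws in \<open>D\<close>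
  into those in \<open>C\<close>.\<close>

lemma iso_reflect:
  assumes ob: "X \<in> Obj C" "Y \<in> Obj C" and f: "f \<in> Hom C X Y"
    and iso: "iso_in D (fobj F X) (fobj F Y) (fmor F X Y f)"
  shows "iso_in C X Y f"
proof -
  obtain g' where g': "g' \<in> Hom D (fobj F Y) (fobj F X)"
      "Comp D (fobj F X) (fobj F Y) (fobj F X) g' (fmor F X Y f) = Id D (fobj F X)"
      "Comp D (fobj F Y) (fobj F X) (fobj F Y) (fmor F X Y f) g' = Id D (fobj F Y)"
    using iso by (auto simp: iso_in_def)
  obtain g where g: "g \<in> Hom C Y X" "fmor F Y X g = g'" using full[OF ob(2,1) g'(1)] .
  have "Comp C X Y X g f = Id C X"
    by (rule faithful[OF ob(1,1)]) (use ob f g g' in \<open>simp_all add: C.Comp_in C.Id_in fmor_Comp fmor_Id\<close>)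
  moreover have "Comp C Y X Y f g = Id C Y"
    by (rule faithful[OF ob(2,2)]) (use ob f g g' in \<open>simp_all add: C.Comp_in C.Id_in fmor_Comp fmor_Id\<close>)
  ultimately show ?thesis using f g(1) by (auto simp: iso_in_def)
qed

lemma ex1_hom_iff:
  assumes "X \<in> Obj C" "Y \<in> Obj C"
  shows "(\<exists>!f. f \<in> Hom C X Y) \<longleftrightarrow> (\<exists>!f. f \<in> Hom D (fobj F X) (fobj F Y))"
proof
  assume ex: "\<exists>!f. f \<in> Hom C X Y"
  then obtain f where f: "f \<in> Hom C X Y" by blast
  show "\<exists>!f. f \<in> Hom D (fobj F X) (fobj F Y)"
  proof (rule ex1I[of _ "fmor F X Y f"])
    show "fmor F X Y f \<in> Hom D (fobj F X) (fobj F Y)" using assms f by (rule fmor_in)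
    show "g = fmor F X Y f" if "g \<in> Hom D (fobj F X) (fobj F Y)" for g
      using full[OF assms that] ex f by metis
  qed
next
  assume ex: "\<exists>!f. f \<in> Hom D (fobj F X) (fobj F Y)"
  then obtain g where "g \<in> Hom D (fobj F X) (fobj F Y)" by blast
  then obtain f where f: "f \<in> Hom C X Y" using full[OF assms] by blast
  show "\<exists>!f. f \<in> Hom C X Y"
    by (rule ex1I[of _ f]) (use ex f faithful[OF assms] fmor_in[OF assms] in blast)+
qed

end

section \<open>Fully faithful and essentially surjective functors\<close>

locale categorical_equivalence = fully_faithful_functor C D F
  for C :: "('o, 'm) category" and D :: "('p, 'n) category" and F +
  assumes ess_surj: "Y \<in> Obj D \<Longrightarrow> \<exists>X\<in>Obj C. isomorphic_in D Y (fobj F X)"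
begin

lemma ess_surj':
  assumes "Y \<in> Obj D"
  obtains X a b where "X \<in> Obj C" "iso_in D Y (fobj F X) a" "iso_in D (fobj F X) Y b"
    "Comp D Y (fobj F X) Y b a = Id D Y" "Comp D (fobj F X) Y (fobj F X) a b = Id D (fobj F X)"
proof -
  obtain X a where Xa: "X \<in> Obj C" "iso_in D Y (fobj F X) a"
    using ess_surj[OF assms] by (auto simp: isomorphic_in_def)
  show thesis by (rule iso_in_inverse[OF Xa(2)]) (rule that[OF Xa])
qed

lemma zero_object_iff:
  assumes X: "X \<in> Obj C"
  shows "zero_object C X \<longleftrightarrow> zero_object D (fobj F X)"
proof
  assume z: "zero_object C X"
  show "zero_object D (fobj F X)"
    unfolding zero_object_def
  proof (intro conjI ballI)
    show FX: "fobj F X \<in> Obj D" using X by (rule fobj_in)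
    fix Y assume Y: "Y \<in> Obj D"
    \<comment> \<open>A test object of \<open>D\<close> is replaced by an isomorphic one in the
      range of \<open>F\<close>, where Hom-sets are those of \<open>C\<close>.\<close>
    obtain X' a b where X': "X' \<in> Obj C" "iso_in D (fobj F X') Y b" using ess_surj'[OF Y] .
    have ex1: "\<exists>!f. f \<in> Hom D (fobj F X) (fobj F X')" "\<exists>!f. f \<in> Hom D (fobj F X') (fobj F X)"
      using z X' X by (simp_all add: zero_object_def flip: ex1_hom_iff)
    show "\<exists>!f. f \<in> Hom D (fobj F X) Y"
      by (rule D.ex1_hom_iso[OF FX fobj_in[OF X'(1)] FX Y D.iso_in_Id[OF FX] X'(2) ex1(1)])
    show "\<exists>!f. f \<in> Hom D Y (fobj F X)"
      by (rule D.ex1_hom_iso[OF fobj_in[OF X'(1)] FX Y FX X'(2) D.iso_in_Id[OF FX] ex1(2)])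
  qed
next
  assume "zero_object D (fobj F X)"
  then show "zero_object C X"
    using X fobj_in by (auto simp: zero_object_def ex1_hom_iff)
qed

text \<open>The domain of a monomorphism into \<open>fobj F X\<close> may be taken in the range of
  \<open>F\<close>. By fullness the map then comes from some \<open>g\<close> in \<open>C\<close>,
  and faithfulness makes \<open>g\<close> a monomorphism.\<close>

lemma simple_object_fobj:
  assumes X: "simple_object C X"
  shows "simple_object D (fobj F X)"
  unfolding simple_object_def
proof (intro conjI ballI allI impI)
  have ob: "X \<in> Obj C" using X by (simp add: simple_object_def)
  show FX: "fobj F X \<in> Obj D" using ob by (rule fobj_in)
  show "\<not> zero_object D (fobj F X)"
    using X zero_object_iff[OF ob] by (simp add: simple_object_def)
  fix Y f assume Y: "Y \<in> Obj D" and f: "mono_in D Y (fobj F X) f"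
  obtain X' a b where X': "X' \<in> Obj C" and ab: "iso_in D Y (fobj F X') a" "iso_in D (fobj F X') Y b"
      "Comp D Y (fobj F X') Y b a = Id D Y"
    using ess_surj'[OF Y] .
  note FX' = fobj_in[OF X']
  let ?f = "Comp D (fobj F X') Y (fobj F X) f b"
  have mono: "mono_in D (fobj F X') (fobj F X) ?f"
    using D.mono_in_Comp[OF FX' Y FX D.iso_in_mono[OF FX' Y ab(2)] f] .
  obtain g where g: "g \<in> Hom C X' X" "fmor F X' X g = ?f"
    using full[OF X' ob mono_in_hom[OF mono]] .
  have "mono_in C X' X g"
    unfolding mono_in_def
  proof (intro conjI ballI impI)
    fix Z u v assume Z: "Z \<in> Obj C" and uv: "u \<in> Hom C Z X'" "v \<in> Hom C Z X'"
      and eq: "Comp C Z X' X g u = Comp C Z X' X g v"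
    have "Comp D (fobj F Z) (fobj F X') (fobj F X) ?f (fmor F Z X' u) =
        Comp D (fobj F Z) (fobj F X') (fobj F X) ?f (fmor F Z X' v)"
      unfolding g(2)[symmetric] fmor_Comp[OF Z X' ob uv(1) g(1), symmetric]
        fmor_Comp[OF Z X' ob uv(2) g(1), symmetric] eq ..
    then have "fmor F Z X' u = fmor F Z X' v"
      by (rule mono_inD[OF mono fobj_in[OF Z] fmor_in[OF Z X' uv(1)] fmor_in[OF Z X' uv(2)]])
    then show "u = v" using faithful[OF Z X' uv] by blast
  qed (rule g(1))
  then have "zero_object C X' \<or> iso_in C X' X g"
    using X X' by (auto simp: simple_object_def)
  moreover have "zero_object D Y" if "zero_object C X'"
    using that D.zero_object_iso[OF _ Y ab(2)] zero_object_iff[OF X'] by blast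
  moreover have "iso_in D Y (fobj F X) f" if "iso_in C X' X g"
  proof -
    have "iso_in D (fobj F X') (fobj F X) ?f"
      using fmor_iso[OF X' ob that] g by simp
    then have "iso_in D Y (fobj F X) (Comp D Y (fobj F X') (fobj F X) ?f a)"
      using D.iso_in_Comp[OF Y FX' FX ab(1)] by blast
    then show ?thesis
      using D.Comp_inverse_right[OF Y FX' FX mono_in_hom[OF f] iso_in_hom[OF ab(1)] iso_in_hom[OF ab(2)] ab(3)] by simp
  qed
  ultimately show "zero_object D Y \<or> iso_in D Y (fobj F X) f" by blast
qed

text \<open>The point is that \<open>F\<close> preserves monomorphisms although \<open>D\<close> may
  have further test objects; precomposing with an isomorphism \<open>b\<close> from
  \<open>fobj F Z'\<close> to \<open>Z\<close> moves the test into the range of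
  \<open>F\<close>.\<close>

lemma simple_object_reflect:
  assumes ob: "X \<in> Obj C" and X: "simple_object D (fobj F X)"
  shows "simple_object C X"
  unfolding simple_object_def
proof (intro conjI ballI allI impI)
  note FX = fobj_in[OF ob]
  show "X \<in> Obj C" by fact
  show "\<not> zero_object C X"
    using X zero_object_iff[OF ob] by (simp add: simple_object_def)
  fix X' g assume X': "X' \<in> Obj C" and g: "mono_in C X' X g"
  note FX' = fobj_in[OF X'] and g' = mono_in_hom[OF g]
  have "mono_in D (fobj F X') (fobj F X) (fmor F X' X g)"
    unfolding mono_in_def
  proof (intro conjI ballI impI)
    show Fg: "fmor F X' X g \<in> Hom D (fobj F X') (fobj F X)" using X' ob g' by (rule fmor_in)
    fix Z u v assume Z: "Z \<in> Obj D" and uv: "u \<in> Hom D Z (fobj F X')" "v \<in> Hom D Z (fobj F X')"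
      and eq: "Comp D Z (fobj F X') (fobj F X) (fmor F X' X g) u = Comp D Z (fobj F X') (fobj F X) (fmor F X' X g) v"
    obtain Z' a b where Z': "Z' \<in> Obj C" and ab: "iso_in D Z (fobj F Z') a" "iso_in D (fobj F Z') Z b"
        "Comp D Z (fobj F Z') Z b a = Id D Z"
      using ess_surj'[OF Z] .
    note FZ' = fobj_in[OF Z'] and h = iso_in_hom[OF ab(1)] iso_in_hom[OF ab(2)]
    let ?ub = "Comp D (fobj F Z') Z (fobj F X') u b" and ?vb = "Comp D (fobj F Z') Z (fobj F X') v b"
    obtain u' where u': "u' \<in> Hom C Z' X'" "fmor F Z' X' u' = ?ub"
      using full[OF Z' X' D.Comp_in[OF FZ' Z FX' h(2) uv(1)]] .
    obtain v' where v': "v' \<in> Hom C Z' X'" "fmor F Z' X' v' = ?vb"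
      using full[OF Z' X' D.Comp_in[OF FZ' Z FX' h(2) uv(2)]] .
    have "Comp C Z' X' X g u' = Comp C Z' X' X g v'"
    proof (rule faithful[OF Z' ob])
      show "fmor F Z' X (Comp C Z' X' X g u') = fmor F Z' X (Comp C Z' X' X g v')"
        using fmor_Comp[OF Z' X' ob _ g'] u' v' eq Z uv FZ' FX' FX h Fg
        by (simp add: D.Comp_assoc)
    qed (use C.Comp_in[OF Z' X' ob _ g'] u' v' in blast)+
    then have "?ub = ?vb"
      using mono_inD[OF g Z' u'(1) v'(1)] u'(2) v'(2) by simp
    then have "Comp D Z (fobj F Z') (fobj F X') ?ub a = Comp D Z (fobj F Z') (fobj F X') ?vb a" by simp
    then show "u = v"
      using D.Comp_inverse_right[OF Z FZ' FX' _ h ab(3)] uv by simp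
  qed
  then have "zero_object D (fobj F X') \<or> iso_in D (fobj F X') (fobj F X) (fmor F X' X g)"
    using X FX' by (auto simp: simple_object_def)
  then show "zero_object C X' \<or> iso_in C X' X g"
    using zero_object_iff[OF X'] iso_reflect[OF X' ob g'] by blast
qed

lemma simple_objects:
  "{Y. simple_object D Y} = {Y \<in> Obj D. \<exists>X. simple_object C X \<and> isomorphic_in D Y (fobj F X)}"
proof (intro equalityI subsetI CollectI conjI)
  fix Y assume "Y \<in> {Y. simple_object D Y}"
  then have Y: "simple_object D Y" "Y \<in> Obj D" by (simp_all add: simple_object_def)
  obtain X a b where X: "X \<in> Obj C" "iso_in D Y (fobj F X) a" using ess_surj'[OF Y(2)] .
  have "simple_object C X"
    using simple_object_reflect[OF X(1)] D.simple_object_iso[OF Y(1) fobj_in[OF X(1)] X(2)] by blast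
  then show "\<exists>X. simple_object C X \<and> isomorphic_in D Y (fobj F X)"
    using X by (auto simp: isomorphic_in_def)
  show "Y \<in> Obj D" by fact
next
  fix Y assume "Y \<in> {Y \<in> Obj D. \<exists>X. simple_object C X \<and> isomorphic_in D Y (fobj F X)}"
  then obtain X where Y: "Y \<in> Obj D" and X: "simple_object C X" "isomorphic_in D (fobj F X) Y"
    using isomorphic_in_sym by fastforce
  then show "simple_object D Y"
    using D.simple_object_iso[OF simple_object_fobj[OF X(1)] Y] by (auto simp: isomorphic_in_def)
qed

text \<open>The quasi-inverse chooses a preimage \<open>G Y\<close> of each \<open>Y\<close> up to
  isomorphism; a morphism is conjugated into the range of \<open>F\<close> and lifted by fullness.
  Equations in \<open>C\<close> are checked after applying the faithful \<open>F\<close>.\<close>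

lemma equivalence: "equivalence_of_categories C D F"
proof -
  have "\<exists>X a b. X \<in> Obj C \<and> iso_in D Y (fobj F X) a \<and> iso_in D (fobj F X) Y b \<and>
    Comp D Y (fobj F X) Y b a = Id D Y \<and> Comp D (fobj F X) Y (fobj F X) a b = Id D (fobj F X)"
    if "Y \<in> Obj D" for Y
    by (rule ess_surj'[OF that]) blast
  then obtain G a b where G: "\<And>Y. Y \<in> Obj D \<Longrightarrow> G Y \<in> Obj C"
    and a: "\<And>Y. Y \<in> Obj D \<Longrightarrow> iso_in D Y (fobj F (G Y)) (a Y)"
    and b: "\<And>Y. Y \<in> Obj D \<Longrightarrow> iso_in D (fobj F (G Y)) Y (b Y)"
    and ba: "\<And>Y. Y \<in> Obj D \<Longrightarrow> Comp D Y (fobj F (G Y)) Y (b Y) (a Y) = Id D Y"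
    and ab: "\<And>Y. Y \<in> Obj D \<Longrightarrow> Comp D (fobj F (G Y)) Y (fobj F (G Y)) (a Y) (b Y) = Id D (fobj F (G Y))"
    by metis
  note FG = fobj_in[OF G] and a' = iso_in_hom[OF a] and b' = iso_in_hom[OF b]
  define lift where "lift X X' g = inv_into (Hom C X X') (fmor F X X') g" for X X' g
  have lift: "lift X X' g \<in> Hom C X X'" "fmor F X X' (lift X X' g) = g"
    if "X \<in> Obj C" "X' \<in> Obj C" "g \<in> Hom D (fobj F X) (fobj F X')" for X X' g
    using bij[OF that(1,2)] that(3) by (simp_all add: lift_def bij_betw_def inv_into_into f_inv_into_f)
  define conj where "conj Y Y' g = Comp D (fobj F (G Y)) Y' (fobj F (G Y')) (a Y') (Comp D (fobj F (G Y)) Y Y' g (b Y))" for Y Y' g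
  have conj: "conj Y Y' g \<in> Hom D (fobj F (G Y)) (fobj F (G Y'))"
    if "Y \<in> Obj D" "Y' \<in> Obj D" "g \<in> Hom D Y Y'" for Y Y' g
    using that FG a' b' by (simp add: conj_def D.Comp_in)
  \<comment> \<open>This is naturality of \<open>b\<close>; it also yields compatibility of
    \<open>conj\<close> with composition.\<close>
  have b_conj: "Comp D (fobj F (G Y)) (fobj F (G Y')) Y' (b Y') (conj Y Y' g) = Comp D (fobj F (G Y)) Y Y' g (b Y)"
    if "Y \<in> Obj D" "Y' \<in> Obj D" "g \<in> Hom D Y Y'" for Y Y' g
    using that FG a' b' ba by (simp add: conj_def D.Comp_inverse_left D.Comp_in)
  let ?G = "\<lparr>fobj = G, fmor = (\<lambda>Y Y' g. lift (G Y) (G Y') (conj Y Y' g))\<rparr>"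
  have fun_G: "is_functor D C ?G"
  proof (unfold_locales; unfold cat_functor.simps)
    fix X assume X: "X \<in> Obj D"
    show "G X \<in> Obj C" using X by (rule G)
    have "conj X X (Id D X) = Id D (fobj F (G X))"
      using X FG a' b' ab by (simp add: conj_def D.Comp_Id_left)
    then show "lift (G X) (G X) (conj X X (Id D X)) = Id C (G X)"
      using X G lift C.Id_in D.Id_in[OF FG[OF X]] fmor_Id by (intro faithful[of "G X" "G X"]) simp_all
  next
    fix X Y f assume "X \<in> Obj D" "Y \<in> Obj D" "f \<in> Hom D X Y"
    then show "lift (G X) (G Y) (conj X Y f) \<in> Hom C (G X) (G Y)"
      using G lift conj by simp
  next
    fix X Y Z f g assume ob: "X \<in> Obj D" "Y \<in> Obj D" "Z \<in> Obj D" and fg: "f \<in> Hom D X Y" "g \<in> Hom D Y Z"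
    note gf = D.Comp_in[OF ob fg]
    have "conj X Z (Comp D X Y Z g f) = Comp D (fobj F (G X)) (fobj F (G Y)) (fobj F (G Z)) (conj Y Z g) (conj X Y f)"
    proof -
      have "Comp D (fobj F (G X)) (fobj F (G Y)) (fobj F (G Z)) (conj Y Z g) (conj X Y f)
        = Comp D (fobj F (G X)) Z (fobj F (G Z)) (a Z) (Comp D (fobj F (G X)) (fobj F (G Y)) Z
            (Comp D (fobj F (G Y)) Y Z g (b Y)) (conj X Y f))"
        unfolding conj_def[of Y Z g]
        using ob fg FG a' b' conj by (simp add: D.Comp_assoc D.Comp_in)
      also have "Comp D (fobj F (G X)) (fobj F (G Y)) Z (Comp D (fobj F (G Y)) Y Z g (b Y)) (conj X Y f)
        = Comp D (fobj F (G X)) Y Z g (Comp D (fobj F (G X)) (fobj F (G Y)) Y (b Y) (conj X Y f))"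
        using ob fg FG a' b' conj by (simp add: D.Comp_assoc)
      also have "\<dots> = Comp D (fobj F (G X)) X Z (Comp D X Y Z g f) (b X)"
        using ob fg FG a' b' by (simp add: b_conj D.Comp_assoc)
      finally show ?thesis by (simp add: conj_def)
    qed
    then have "Comp D (fobj F (G X)) (fobj F (G Y)) (fobj F (G Z)) (conj Y Z g) (conj X Y f)
        = conj X Z (Comp D X Y Z g f)" by (rule sym)
    then show "lift (G X) (G Z) (conj X Z (Comp D X Y Z g f)) =
        Comp C (G X) (G Y) (G Z) (lift (G Y) (G Z) (conj Y Z g)) (lift (G X) (G Y) (conj X Y f))"
      using ob fg gf G lift conj conj[OF ob(1,3) gf] fmor_Comp C.Comp_in
      by (intro faithful[of "G X" "G Z"]) simp_all
  qed
  have "natural_iso D D (comp_functor F ?G) id_functor b"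
    unfolding natural_iso_def comp_functor_def id_functor_def
    using b lift G conj b_conj by simp
  \<comment> \<open>The component at \<open>X\<close> is \<open>b\<close> at
    \<open>fobj F X\<close>, lifted along \<open>F\<close>; isomorphisms are reflected.\<close>
  moreover have "natural_iso C C (comp_functor ?G F) id_functor (\<lambda>X. lift (G (fobj F X)) X (b (fobj F X)))"
    unfolding natural_iso_def comp_functor_def id_functor_def cat_functor.simps
  proof (intro conjI ballI)
    fix X assume X: "X \<in> Obj C"
    note FX = fobj_in[OF X] and l = lift[OF G[OF fobj_in[OF X]] X b'[OF fobj_in[OF X]]]
    show "iso_in C (G (fobj F X)) X (lift (G (fobj F X)) X (b (fobj F X)))"
      by (rule iso_reflect[OF G[OF FX] X l(1)]) (simp only: l(2) b[OF FX])
    fix Y f assume Y: "Y \<in> Obj C" and f: "f \<in> Hom C X Y"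
    note FY = fobj_in[OF Y] and l' = lift[OF G[OF fobj_in[OF Y]] Y b'[OF fobj_in[OF Y]]]
    note Ff = fmor_in[OF X Y f]
    note l'' = lift[OF G[OF FX] G[OF FY] conj[OF FX FY Ff]]
    show "Comp C (G (fobj F X)) (G (fobj F Y)) Y (lift (G (fobj F Y)) Y (b (fobj F Y)))
          (lift (G (fobj F X)) (G (fobj F Y)) (conj (fobj F X) (fobj F Y) (fmor F X Y f))) =
        Comp C (G (fobj F X)) X Y f (lift (G (fobj F X)) X (b (fobj F X)))"
      by (rule faithful[OF G[OF FX] Y C.Comp_in[OF G[OF FX] G[OF FY] Y l''(1) l'(1)] C.Comp_in[OF G[OF FX] X Y l(1) f]])
        (simp only: fmor_Comp[OF G[OF FX] G[OF FY] Y l''(1) l'(1)] fmor_Comp[OF G[OF FX] X Y l(1) f]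
          l(2) l'(2) l''(2) b_conj[OF FX FY Ff])
  qed
  ultimately show ?thesis
    unfolding equivalence_of_categories_def using fun_G is_functor_axioms by blast
qed

end

section \<open>Simple objects in module categories\<close>

lemma (in left_module) submoduleI:
  assumes "N \<subseteq> carrier M" "\<zero>\<^bsub>M\<^esub> \<in> N"
    and "\<And>x y. x \<in> N \<Longrightarrow> y \<in> N \<Longrightarrow> x \<oplus>\<^bsub>M\<^esub> y \<in> N"
    and smult: "\<And>a x. a \<in> carrier R \<Longrightarrow> x \<in> N \<Longrightarrow> a \<odot>\<^bsub>M\<^esub> x \<in> N"
  shows "submodule N R M"
proof (intro submodule.intro submodule_axioms.intro group.subgroupI[OF M.a_group])
  fix x assume x: "x \<in> N"
  then have "\<ominus>\<^bsub>M\<^esub> x = (\<ominus>\<^bsub>R\<^esub> \<one>\<^bsub>R\<^esub>) \<odot>\<^bsub>M\<^esub> x"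
    using assms(1) smult_l_minus[of "\<one>\<^bsub>R\<^esub>" x] smult_one[of x] by auto
  then have "\<ominus>\<^bsub>M\<^esub> x \<in> N" using smult x by simp
  then show "inv\<^bsub>add_monoid M\<^esub> x \<in> N" by (simp add: a_inv_def)
qed (use assms in auto)

lemma (in left_module) submodule_closed:
  assumes "submodule N R M"
  shows "N \<subseteq> carrier M" "\<zero>\<^bsub>M\<^esub> \<in> N" "x \<in> N \<Longrightarrow> y \<in> N \<Longrightarrow> x \<oplus>\<^bsub>M\<^esub> y \<in> N"
    "a \<in> carrier R \<Longrightarrow> x \<in> N \<Longrightarrow> a \<odot>\<^bsub>M\<^esub> x \<in> N"
proof -
  interpret N: submodule N R M by fact
  show "N \<subseteq> carrier M" "\<zero>\<^bsub>M\<^esub> \<in> N" "x \<in> N \<Longrightarrow> y \<in> N \<Longrightarrow> x \<oplus>\<^bsub>M\<^esub> y \<in> N"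
    "a \<in> carrier R \<Longrightarrow> x \<in> N \<Longrightarrow> a \<odot>\<^bsub>M\<^esub> x \<in> N"
    using N.subset N.one_closed N.m_closed N.smult_closed by auto
qed

lemma (in left_module) left_module_submodule:
  assumes "submodule N R M"
  shows "left_module R (M\<lparr>carrier := N\<rparr>)"
proof -
  note cl = submodule_closed[OF assms]
  have "\<exists>y\<in>N. y \<oplus>\<^bsub>M\<^esub> x = \<zero>\<^bsub>M\<^esub>" if "x \<in> N" for x
    using that cl smult_l_minus[of "\<one>\<^bsub>R\<^esub>" x] smult_one[of x]
    by (intro bexI[of _ "(\<ominus>\<^bsub>R\<^esub> \<one>\<^bsub>R\<^esub>) \<odot>\<^bsub>M\<^esub> x"]) (auto simp: M.l_neg)
  then have "abelian_group (M\<lparr>carrier := N\<rparr>)"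
    using cl by (intro abelian_groupI) (auto simp: M.a_ac subset_iff)
  then show ?thesis
    using cl R.ring_axioms
    by (intro left_moduleI) (auto simp: smult_l_distr smult_r_distr smult_assoc smult_one subset_iff)
qed

lemma module_hom_zero_map:
  assumes "left_module R M" "left_module R N"
  shows "(\<lambda>x\<in>carrier M. \<zero>\<^bsub>N\<^esub>) \<in> module_hom R M N"
proof -
  interpret M: left_module R M by fact
  interpret N: left_module R N by fact
  show ?thesis
    by (rule module_homI) (simp_all add: M.smult_closed N.smult_r_null)
qed

lemma zero_object_Rep:
  assumes M: "left_module R M"
  shows "zero_object (Rep R) M \<longleftrightarrow> carrier M = {\<zero>\<^bsub>M\<^esub>}"
proof
  interpret M: left_module R M by fact
  assume "zero_object (Rep R) M"
  then have "\<exists>!f. f \<in> module_hom R M M"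
    using M by (simp add: zero_object_def Rep_simps)
  then have eq: "(\<lambda>x\<in>carrier M. x) = (\<lambda>x\<in>carrier M. \<zero>\<^bsub>M\<^esub>)"
    using module_hom_id[OF M] module_hom_zero_map[OF M M] by blast
  have "x = \<zero>\<^bsub>M\<^esub>" if "x \<in> carrier M" for x
    using fun_cong[OF eq, of x] that by simp
  then show "carrier M = {\<zero>\<^bsub>M\<^esub>}" using M.zero_closed by blast
next
  assume z: "carrier M = {\<zero>\<^bsub>M\<^esub>}"
  show "zero_object (Rep R) M"
    unfolding zero_object_def Rep_simps
  proof (intro conjI ballI M)
    fix N assume "N \<in> Obj (Rep R)"
    then have N: "left_module R N" by (simp add: Rep_simps)
    note groups = left_module_group[OF M] left_module_group[OF N]
    show "\<exists>!f. f \<in> module_hom R M N"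
    proof (rule ex1I)
      show "(\<lambda>x\<in>carrier M. \<zero>\<^bsub>N\<^esub>) \<in> module_hom R M N"
        by (rule module_hom_zero_map[OF M N])
    next
      fix f assume f: "f \<in> module_hom R M N"
      show "f = (\<lambda>x\<in>carrier M. \<zero>\<^bsub>N\<^esub>)"
        by (rule extensionalityI[OF module_hom_extensional[OF f] restrict_extensional])
          (use z module_hom_zero[OF groups f] in auto)
    qed
    show "\<exists>!f. f \<in> module_hom R N M"
    proof (rule ex1I)
      show "(\<lambda>x\<in>carrier N. \<zero>\<^bsub>M\<^esub>) \<in> module_hom R N M"
        by (rule module_hom_zero_map[OF N M])
    next
      fix f assume f: "f \<in> module_hom R N M"
      show "f = (\<lambda>x\<in>carrier N. \<zero>\<^bsub>M\<^esub>)"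
        by (rule extensionalityI[OF module_hom_extensional[OF f] restrict_extensional])
          (use z module_hom_closed[OF f] in auto)
    qed
  qed
qed

lemma module_hom_kernel:
  assumes M: "left_module R M" and N: "left_module R N" and f: "f \<in> module_hom R M N"
  shows "submodule {x \<in> carrier M. f x = \<zero>\<^bsub>N\<^esub>} R M"
proof -
  interpret M: left_module R M by fact
  interpret N: left_module R N by fact
  show ?thesis
    by (rule M.submoduleI)
      (auto simp: module_hom_add[OF f] module_hom_smult[OF f] M.smult_closed N.smult_r_null
        module_hom_zero[OF left_module_group[OF M] left_module_group[OF N] f])
qed

lemma module_hom_image:
  assumes M: "left_module R M" and N: "left_module R N" and f: "f \<in> module_hom R M N"
  shows "submodule (f ` carrier M) R N"
proof -
  interpret M: left_module R M by fact
  interpret N: left_module R N by fact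
  show ?thesis
  proof (rule N.submoduleI)
    show "\<zero>\<^bsub>N\<^esub> \<in> f ` carrier M"
      using module_hom_zero[OF left_module_group[OF M] left_module_group[OF N] f]
      by (intro image_eqI[of _ _ "\<zero>\<^bsub>M\<^esub>"]) simp_all
    show "f ` carrier M \<subseteq> carrier N" using module_hom_closed[OF f] by blast
    show "y \<oplus>\<^bsub>N\<^esub> y' \<in> f ` carrier M" if "y \<in> f ` carrier M" "y' \<in> f ` carrier M" for y y'
      using that module_hom_add[OF f] M.add.m_closed by (metis (no_types, lifting) imageE imageI)
    show "a \<odot>\<^bsub>N\<^esub> y \<in> f ` carrier M" if "a \<in> carrier R" "y \<in> f ` carrier M" for a y
      using that module_hom_smult[OF f] M.smult_closed by (metis (no_types, lifting) imageE imageI)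
  qed
qed

text \<open>The test object is the kernel: its inclusion and its zero map agree after composition
  with \<open>f\<close>. Being a submodule it lives on the same type as \<open>M\<close>, hence is
  an object of \<open>Rep R\<close>.\<close>

lemma mono_in_Rep_inj:
  assumes M: "left_module R M" and N: "left_module R N" and f: "mono_in (Rep R) M N f"
  shows "inj_on f (carrier M)"
proof -
  interpret M: left_module R M by fact
  interpret N: left_module R N by fact
  have f': "f \<in> module_hom R M N" using mono_in_hom[OF f] by (simp add: Rep_simps)
  note f0 = module_hom_zero[OF left_module_group[OF M] left_module_group[OF N] f']
  let ?K = "{x \<in> carrier M. f x = \<zero>\<^bsub>N\<^esub>}"
  let ?KM = "M\<lparr>carrier := ?K\<rparr>"
  have K: "left_module R ?KM"
    by (rule M.left_module_submodule[OF module_hom_kernel[OF M N f']])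
  have incl: "(\<lambda>x\<in>?K. x) \<in> module_hom R ?KM M"
    using M.submodule_closed[OF module_hom_kernel[OF M N f']] by (intro module_homI) auto
  have zero: "(\<lambda>x\<in>?K. \<zero>\<^bsub>M\<^esub>) \<in> module_hom R ?KM M"
    using module_hom_zero_map[OF K M] by simp
  have eq: "(\<lambda>x\<in>?K. x) = (\<lambda>x\<in>?K. \<zero>\<^bsub>M\<^esub>)"
    by (rule mono_inD[OF f, of ?KM])
      (use K incl zero f0 in \<open>auto simp: Rep_simps compose_def fun_eq_iff\<close>)
  have ker: "x = \<zero>\<^bsub>M\<^esub>" if "x \<in> ?K" for x
    using fun_cong[OF eq, of x] that by simp
  show ?thesis
  proof (rule inj_onI)
    fix x y assume xy: "x \<in> carrier M" "y \<in> carrier M" and eq: "f x = f y"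
    have fy: "f y \<oplus>\<^bsub>N\<^esub> f (\<ominus>\<^bsub>M\<^esub> y) = \<zero>\<^bsub>N\<^esub>"
      using module_hom_add[OF f', of y "\<ominus>\<^bsub>M\<^esub> y"] xy f0 by (simp add: M.r_neg)
    have "f (x \<oplus>\<^bsub>M\<^esub> \<ominus>\<^bsub>M\<^esub> y) = \<zero>\<^bsub>N\<^esub>"
      using module_hom_add[OF f', of x "\<ominus>\<^bsub>M\<^esub> y"] xy fy eq by simp
    then have "x \<oplus>\<^bsub>M\<^esub> \<ominus>\<^bsub>M\<^esub> y = \<zero>\<^bsub>M\<^esub>" using ker xy by simp
    then show "x = y" using xy M.minus_equality[of x "\<ominus>\<^bsub>M\<^esub> y"] by simp
  qed
qed

lemma mono_in_RepI:
  assumes f: "f \<in> module_hom R M N" and inj: "inj_on f (carrier M)"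
  shows "mono_in (Rep R) M N f"
  unfolding mono_in_def Rep_simps
proof (intro conjI ballI impI f)
  fix L g h
  assume g: "g \<in> module_hom R L M" and h: "h \<in> module_hom R L M"
    and eq: "compose (carrier L) f g = compose (carrier L) f h"
  show "g = h"
  proof (rule extensionalityI[OF module_hom_extensional[OF g] module_hom_extensional[OF h]])
    fix x assume x: "x \<in> carrier L"
    then have "f (g x) = f (h x)" using eq by (metis compose_eq)
    then show "g x = h x"
      using inj module_hom_closed[OF g x] module_hom_closed[OF h x] by (simp add: inj_on_eq_iff)
  qed
qed

lemma iso_in_RepI:
  assumes M: "left_module R M" and f: "f \<in> module_hom R M N" and bij: "bij_betw f (carrier M) (carrier N)"
  shows "iso_in (Rep R) M N f"
proof -
  interpret M: left_module R M by fact
  let ?g = "\<lambda>y\<in>carrier N. inv_into (carrier M) f y"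
  have inj: "inj_on f (carrier M)" and surj: "f ` carrier M = carrier N"
    using bij by (simp_all add: bij_betw_def)
  have gf: "?g (f x) = x" if "x \<in> carrier M" for x
    using that module_hom_closed[OF f that] inj by simp
  have g: "?g \<in> module_hom R N M"
  proof (rule module_homI)
    fix y y' assume "y \<in> carrier N" "y' \<in> carrier N"
    then obtain x x' where "x \<in> carrier M" "x' \<in> carrier M" "y = f x" "y' = f x'"
      using surj by (metis imageE)
    then show "?g (y \<oplus>\<^bsub>N\<^esub> y') = ?g y \<oplus>\<^bsub>M\<^esub> ?g y'"
      by (simp only: gf M.add.m_closed module_hom_add[OF f, symmetric])
  next
    fix a y assume a: "a \<in> carrier R" and "y \<in> carrier N"
    then obtain x where "x \<in> carrier M" "y = f x"
      using surj by (metis imageE)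
    then show "?g (a \<odot>\<^bsub>N\<^esub> y) = a \<odot>\<^bsub>M\<^esub> ?g y"
      by (simp only: gf a M.smult_closed module_hom_smult[OF f, symmetric])
  next
    fix y assume "y \<in> carrier N"
    then show "?g y \<in> carrier M" using surj by (auto simp: inv_into_into)
  qed simp
  have "compose (carrier M) ?g f = (\<lambda>x\<in>carrier M. x)"
    by (rule extensionalityI[OF compose_extensional restrict_extensional])
      (simp only: compose_eq gf restrict_apply')
  moreover have "compose (carrier N) f ?g = (\<lambda>y\<in>carrier N. y)"
    using surj by (auto simp: compose_def fun_eq_iff f_inv_into_f)
  ultimately show ?thesis
    unfolding iso_in_def Rep_simps using f g by blast
qed

lemma iso_in_Rep_surj:
  assumes "iso_in (Rep R) M N f"
  shows "f ` carrier M = carrier N"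
proof -
  obtain g where g: "g \<in> module_hom R N M" "compose (carrier N) f g = (\<lambda>y\<in>carrier N. y)"
    and f: "f \<in> module_hom R M N"
    using assms unfolding iso_in_def Rep_simps by blast
  have "y \<in> f ` carrier M" if y: "y \<in> carrier N" for y
  proof (rule image_eqI[OF _ module_hom_closed[OF g(1) y]])
    show "y = f (g y)" using g(2) y by (metis compose_eq restrict_apply')
  qed
  then show ?thesis using module_hom_closed[OF f] by blast
qed

text \<open>The inclusion of a submodule is a monomorphism; conversely a monomorphism is injective,
  so it identifies its domain with a submodule.\<close>

lemma simple_object_Rep: "simple_object (Rep R) M \<longleftrightarrow> simple_module R M"
proof
  assume s: "simple_object (Rep R) M"
  then have M: "left_module R M" by (simp add: simple_object_def Rep_simps)
  interpret M: left_module R M by fact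
  have "N = {\<zero>\<^bsub>M\<^esub>} \<or> N = carrier M" if N: "submodule N R M" for N
  proof -
    let ?N = "M\<lparr>carrier := N\<rparr>" and ?i = "\<lambda>x\<in>N. x"
    have mod: "left_module R ?N" by (rule M.left_module_submodule[OF N])
    have i: "?i \<in> module_hom R ?N M"
      using M.submodule_closed[OF N] by (intro module_homI) auto
    have "mono_in (Rep R) ?N M ?i"
      by (rule mono_in_RepI[OF i]) (auto intro: inj_onI)
    then have "zero_object (Rep R) ?N \<or> iso_in (Rep R) ?N M ?i"
      using s mod by (simp add: simple_object_def Rep_simps)
    then show ?thesis
      using zero_object_Rep[OF mod] iso_in_Rep_surj[of R ?N M ?i] by auto
  qed
  then show "simple_module R M"
    using s M zero_object_Rep[OF M] by (auto simp: simple_module_def simple_object_def)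
next
  assume s: "simple_module R M"
  then have M: "left_module R M" by (simp add: simple_module_def)
  have "zero_object (Rep R) N \<or> iso_in (Rep R) N M f"
    if N: "left_module R N" and f: "mono_in (Rep R) N M f" for N f
  proof -
    interpret N: left_module R N by fact
    have f': "f \<in> module_hom R N M" using mono_in_hom[OF f] by (simp add: Rep_simps)
    have inj: "inj_on f (carrier N)" by (rule mono_in_Rep_inj[OF N M f])
    consider "f ` carrier N = {\<zero>\<^bsub>M\<^esub>}" | "f ` carrier N = carrier M"
      using s module_hom_image[OF N M f'] by (auto simp: simple_module_def)
    then show ?thesis
    proof cases
      case 1
      then have "x = \<zero>\<^bsub>N\<^esub>" if "x \<in> carrier N" for x
        using inj that N.zero_closed by (metis imageI inj_onD singletonD)
      then show ?thesis using zero_object_Rep[OF N] N.zero_closed by blast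
    next
      case 2
      then show ?thesis using iso_in_RepI[OF N f'] inj by (simp add: bij_betw_def)
    qed
  qed
  then show "simple_object (Rep R) M"
    using s M zero_object_Rep[OF M] by (simp add: simple_object_def Rep_simps simple_module_def)
qed

section \<open>Vacuum vectors\<close>

locale SF_module = sf_connection A + left_module "SF A" M
  for A and M :: "(sf, 'v, 'b) module_scheme"
begin

abbreviation act :: "sign \<Rightarrow> int \<Rightarrow> 'v \<Rightarrow> 'v" where
  "act a n x \<equiv> \<psi> A a n \<odot>\<^bsub>M\<^esub> x"

abbreviation sc :: "complex \<Rightarrow> 'v \<Rightarrow> 'v" where
  "sc c x \<equiv> SF_scalar A c \<odot>\<^bsub>M\<^esub> x"

lemma act_closed [simp]: "x \<in> carrier M \<Longrightarrow> act a n x \<in> carrier M"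
  and sc_closed [simp]: "x \<in> carrier M \<Longrightarrow> sc c x \<in> carrier M"
  by (simp_all add: smult_closed)

lemma act_add: "x \<in> carrier M \<Longrightarrow> y \<in> carrier M \<Longrightarrow> act a n (x \<oplus>\<^bsub>M\<^esub> y) = act a n x \<oplus>\<^bsub>M\<^esub> act a n y"
  and sc_add: "x \<in> carrier M \<Longrightarrow> y \<in> carrier M \<Longrightarrow> sc c (x \<oplus>\<^bsub>M\<^esub> y) = sc c x \<oplus>\<^bsub>M\<^esub> sc c y"
  by (simp_all add: smult_r_distr)

lemma act_zero [simp]: "act a n \<zero>\<^bsub>M\<^esub> = \<zero>\<^bsub>M\<^esub>" and sc_zero [simp]: "sc c \<zero>\<^bsub>M\<^esub> = \<zero>\<^bsub>M\<^esub>"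
  and sc_0 [simp]: "x \<in> carrier M \<Longrightarrow> sc 0 x = \<zero>\<^bsub>M\<^esub>" and sc_1: "x \<in> carrier M \<Longrightarrow> sc 1 x = x"
  by (simp_all add: smult_r_null SF_scalar_0 smult_l_null SF_scalar_1 smult_one)

lemma sc_sc: "x \<in> carrier M \<Longrightarrow> sc c (sc d x) = sc (c * d) x"
  by (simp flip: smult_assoc SF_scalar_mult)

lemma sc_act: "x \<in> carrier M \<Longrightarrow> sc c (act a n x) = act a n (sc c x)"
  by (simp add: SF_scalar_commute flip: smult_assoc)

lemma sc_plus: "x \<in> carrier M \<Longrightarrow> sc (c + d) x = sc c x \<oplus>\<^bsub>M\<^esub> sc d x"
proof -
  have "SF_scalar A (c + d) = SF_scalar A c \<oplus>\<^bsub>SF A\<^esub> SF_scalar A d"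
    unfolding SF_scalar_def free_scalar_add cls_add ..
  then show "x \<in> carrier M \<Longrightarrow> sc (c + d) x = sc c x \<oplus>\<^bsub>M\<^esub> sc d x"
    by (simp add: smult_l_distr)
qed

lemma sc_minus: "x \<in> carrier M \<Longrightarrow> sc (- 1) x = \<ominus>\<^bsub>M\<^esub> x"
  using sc_plus[of x "- 1" 1] M.minus_equality[of "sc (- 1) x" x] by (simp add: sc_1)

lemma sc_eq_0:
  assumes "x \<in> carrier M" "sc c x = \<zero>\<^bsub>M\<^esub>" "c \<noteq> 0"
  shows "x = \<zero>\<^bsub>M\<^esub>"
  using sc_sc[OF assms(1), of "1 / c" c] assms by (simp add: sc_1)

lemma act_act:
  assumes x: "x \<in> carrier M"
  shows "act a m (act b n x) = sc (pairing A (a, m) (b, n)) x \<oplus>\<^bsub>M\<^esub> sc (- 1) (act b n (act a m x))"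
proof -
  have "act a m (act b n x) \<oplus>\<^bsub>M\<^esub> act b n (act a m x) = sc (pairing A (a, m) (b, n)) x"
    using x by (simp add: smult_l_distr flip: \<psi>_anticommutator smult_assoc)
  then show ?thesis
    using x by (simp add: sc_minus M.a_assoc M.r_neg flip: \<open>_ = sc _ x\<close>)
qed

text \<open>The anticommutator of a mode with itself is twice its square, so the square acts as a
  scalar.\<close>

lemma act_act_self:
  assumes x: "x \<in> carrier M"
  shows "act a n (act a n x) = sc (pairing A (a, n) (a, n) / 2) x"
proof -
  let ?u = "act a n (act a n x)"
  have u: "?u \<in> carrier M" using x by simp
  have "sc 2 ?u = ?u \<oplus>\<^bsub>M\<^esub> ?u"
    using sc_plus[OF u, of 1 1] u by (simp add: sc_1)
  also have "\<dots> = sc (pairing A (a, n) (a, n)) x \<oplus>\<^bsub>M\<^esub> sc (- 1) ?u \<oplus>\<^bsub>M\<^esub> ?u"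
    by (rule arg_cong[OF act_act[OF x], of "\<lambda>v. v \<oplus>\<^bsub>M\<^esub> ?u"])
  also have "\<dots> = sc (pairing A (a, n) (a, n)) x \<oplus>\<^bsub>M\<^esub> (\<ominus>\<^bsub>M\<^esub> ?u \<oplus>\<^bsub>M\<^esub> ?u)"
    using u x by (simp add: sc_minus M.a_assoc)
  also have "\<dots> = sc (pairing A (a, n) (a, n)) x"
    using u x by (simp add: M.l_neg)
  finally have "sc (1 / 2) (sc 2 ?u) = sc (1 / 2) (sc (pairing A (a, n) (a, n)) x)" by simp
  then show ?thesis using u x by (simp add: sc_sc sc_1)
qed

text \<open>The complex subspaces of \<open>M\<close>; negatives are covered by the scalar
  -1.\<close>

definition sub_closed :: "'v set \<Rightarrow> bool" where
  "sub_closed X \<longleftrightarrow> X \<subseteq> carrier M \<and> \<zero>\<^bsub>M\<^esub> \<in> X \<and> (\<forall>x\<in>X. \<forall>y\<in>X. x \<oplus>\<^bsub>M\<^esub> y \<in> X) \<and> (\<forall>c. \<forall>x\<in>X. sc c x \<in> X)"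

text \<open>By the Clifford relations this is stable under all modes of degree at least \<open>n\<close> if \<open>X\<close> is stable
  under those of degree above \<open>n\<close>.\<close>

definition adjoin :: "int \<Rightarrow> 'v set \<Rightarrow> 'v set" where
  "adjoin n X = {w \<oplus>\<^bsub>M\<^esub> act Plus n x \<oplus>\<^bsub>M\<^esub> act Minus n y \<oplus>\<^bsub>M\<^esub> act Plus n (act Minus n z) | w x y z.
    w \<in> X \<and> x \<in> X \<and> y \<in> X \<and> z \<in> X}"

context
  fixes X :: "'v set" and n :: int
  assumes X: "sub_closed X"
begin

lemma X_carrier: "x \<in> X \<Longrightarrow> x \<in> carrier M"
  and X_zero: "\<zero>\<^bsub>M\<^esub> \<in> X"
  and X_add: "x \<in> X \<Longrightarrow> y \<in> X \<Longrightarrow> x \<oplus>\<^bsub>M\<^esub> y \<in> X"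
  and X_sc: "x \<in> X \<Longrightarrow> sc c x \<in> X"
  using X by (auto simp: sub_closed_def)

lemma adjoinI:
  assumes "w \<in> X" "x \<in> X" "y \<in> X" "z \<in> X"
  shows "w \<oplus>\<^bsub>M\<^esub> act Plus n x \<oplus>\<^bsub>M\<^esub> act Minus n y \<oplus>\<^bsub>M\<^esub> act Plus n (act Minus n z) \<in> adjoin n X"
  using assms by (auto simp: adjoin_def)

lemma adjoinE:
  assumes "u \<in> adjoin n X"
  obtains w x y z where "w \<in> X" "x \<in> X" "y \<in> X" "z \<in> X"
    "u = w \<oplus>\<^bsub>M\<^esub> act Plus n x \<oplus>\<^bsub>M\<^esub> act Minus n y \<oplus>\<^bsub>M\<^esub> act Plus n (act Minus n z)"
  using assms by (auto simp: adjoin_def)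

lemma adjoin_incl:
  assumes "x \<in> X"
  shows "x \<in> adjoin n X" "act Plus n x \<in> adjoin n X" "act Minus n x \<in> adjoin n X"
    "act Plus n (act Minus n x) \<in> adjoin n X"
  using adjoinI[OF assms X_zero X_zero X_zero] adjoinI[OF X_zero assms X_zero X_zero]
    adjoinI[OF X_zero X_zero assms X_zero] adjoinI[OF X_zero X_zero X_zero assms] X_carrier[OF assms]
  by simp_all

lemma sub_closed_adjoin: "sub_closed (adjoin n X)"
  unfolding sub_closed_def
proof (intro conjI ballI allI)
  show "adjoin n X \<subseteq> carrier M" by (auto simp: adjoin_def X_carrier)
  show "\<zero>\<^bsub>M\<^esub> \<in> adjoin n X" by (rule adjoin_incl(1)[OF X_zero])
next
  fix u u' assume uu: "u \<in> adjoin n X" "u' \<in> adjoin n X"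
  obtain w x y z where X: "w \<in> X" "x \<in> X" "y \<in> X" "z \<in> X"
    and u: "u = w \<oplus>\<^bsub>M\<^esub> act Plus n x \<oplus>\<^bsub>M\<^esub> act Minus n y \<oplus>\<^bsub>M\<^esub> act Plus n (act Minus n z)"
    using uu(1) by (rule adjoinE)
  obtain w' x' y' z' where X': "w' \<in> X" "x' \<in> X" "y' \<in> X" "z' \<in> X"
    and u': "u' = w' \<oplus>\<^bsub>M\<^esub> act Plus n x' \<oplus>\<^bsub>M\<^esub> act Minus n y' \<oplus>\<^bsub>M\<^esub> act Plus n (act Minus n z')"
    using uu(2) by (rule adjoinE)
  have "u \<oplus>\<^bsub>M\<^esub> u' = (w \<oplus>\<^bsub>M\<^esub> w') \<oplus>\<^bsub>M\<^esub> act Plus n (x \<oplus>\<^bsub>M\<^esub> x') \<oplus>\<^bsub>M\<^esub> act Minus n (y \<oplus>\<^bsub>M\<^esub> y')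
      \<oplus>\<^bsub>M\<^esub> act Plus n (act Minus n (z \<oplus>\<^bsub>M\<^esub> z'))"
    unfolding u u' using X[THEN X_carrier] X'[THEN X_carrier] by (simp add: act_add M.a_ac)
  then show "u \<oplus>\<^bsub>M\<^esub> u' \<in> adjoin n X"
    using adjoinI[OF X_add[OF X(1) X'(1)] X_add[OF X(2) X'(2)] X_add[OF X(3) X'(3)] X_add[OF X(4) X'(4)]] by simp
next
  fix c u assume "u \<in> adjoin n X"
  then obtain w x y z where X: "w \<in> X" "x \<in> X" "y \<in> X" "z \<in> X"
    and u: "u = w \<oplus>\<^bsub>M\<^esub> act Plus n x \<oplus>\<^bsub>M\<^esub> act Minus n y \<oplus>\<^bsub>M\<^esub> act Plus n (act Minus n z)"
    by (rule adjoinE)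
  have "sc c u = sc c w \<oplus>\<^bsub>M\<^esub> act Plus n (sc c x) \<oplus>\<^bsub>M\<^esub> act Minus n (sc c y)
      \<oplus>\<^bsub>M\<^esub> act Plus n (act Minus n (sc c z))"
    unfolding u using X[THEN X_carrier] by (simp add: sc_add sc_act)
  then show "sc c u \<in> adjoin n X"
    using adjoinI[OF X[THEN X_sc]] by simp
qed

lemma adjoin_carrier: "u \<in> adjoin n X \<Longrightarrow> u \<in> carrier M"
  and adjoin_add: "u \<in> adjoin n X \<Longrightarrow> v \<in> adjoin n X \<Longrightarrow> u \<oplus>\<^bsub>M\<^esub> v \<in> adjoin n X"
  and adjoin_sc: "u \<in> adjoin n X \<Longrightarrow> sc c u \<in> adjoin n X"
  using sub_closed_adjoin by (auto simp: sub_closed_def)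

text \<open>By additivity it suffices to treat the four ordered monomials in the two modes of degree
  \<open>n\<close>; no others are required because squares are scalars.\<close>

lemma adjoin_mapsto:
  assumes Y: "sub_closed Y"
    and "\<And>x. x \<in> X \<Longrightarrow> act a m x \<in> Y" "\<And>x. x \<in> X \<Longrightarrow> act a m (act Plus n x) \<in> Y"
      "\<And>x. x \<in> X \<Longrightarrow> act a m (act Minus n x) \<in> Y"
      "\<And>x. x \<in> X \<Longrightarrow> act a m (act Plus n (act Minus n x)) \<in> Y"
    and u: "u \<in> adjoin n X"
  shows "act a m u \<in> Y"
proof -
  obtain w x y z where X: "w \<in> X" "x \<in> X" "y \<in> X" "z \<in> X"
    and u: "u = w \<oplus>\<^bsub>M\<^esub> act Plus n x \<oplus>\<^bsub>M\<^esub> act Minus n y \<oplus>\<^bsub>M\<^esub> act Plus n (act Minus n z)"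
    using u by (rule adjoinE)
  have "act a m u = act a m w \<oplus>\<^bsub>M\<^esub> act a m (act Plus n x) \<oplus>\<^bsub>M\<^esub> act a m (act Minus n y)
      \<oplus>\<^bsub>M\<^esub> act a m (act Plus n (act Minus n z))"
    unfolding u using X[THEN X_carrier] by (simp add: act_add)
  then show ?thesis
    using assms(2-5) X Y by (simp add: sub_closed_def)
qed

text \<open>Squares are scalars, so only Minus before Plus has to be reordered. Products are stored
  with Plus in front, hence stability under Plus comes first and serves in the case of
  Minus.\<close>

lemma adjoin_act_self:
  assumes "u \<in> adjoin n X"
  shows "act a n u \<in> adjoin n X"
proof -
  have "act Plus n (act Plus n x) \<in> adjoin n X" if "x \<in> X" for x
    using that by (simp add: act_act_self X_carrier X_sc adjoin_incl)
  moreover have "act Plus n (act Plus n (act Minus n x)) \<in> adjoin n X" if "x \<in> X" for x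
    using that by (simp add: act_act_self X_carrier X_sc adjoin_incl sc_act)
  ultimately have Plus: "act Plus n u \<in> adjoin n X" if "u \<in> adjoin n X" for u
    using adjoin_mapsto[OF sub_closed_adjoin _ _ _ _ that] adjoin_incl by blast
  have minus: "act Minus n (act Minus n x) \<in> adjoin n X" if "x \<in> X" for x
    using that by (simp add: act_act_self X_carrier X_sc adjoin_incl)
  have swap: "act Minus n (act Plus n v) \<in> adjoin n X" if "v \<in> adjoin n X" "act Minus n v \<in> adjoin n X" for v
    using that act_act[OF adjoin_carrier[OF that(1)], of Minus n Plus n]
    by (simp add: adjoin_add adjoin_sc Plus)
  have Minus: "act Minus n u \<in> adjoin n X" if "u \<in> adjoin n X" for u
    by (rule adjoin_mapsto[OF sub_closed_adjoin _ _ _ _ that]) (simp_all add: adjoin_incl minus swap)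
  show ?thesis using assms Plus Minus by (cases a) simp_all
qed

text \<open>The mode is moved by anticommutation past those of degree \<open>n\<close> until it
  reaches \<open>X\<close>; each exchange leaves a scalar multiple behind.\<close>

lemma adjoin_act:
  assumes act: "\<And>x. x \<in> X \<Longrightarrow> act a m x \<in> X" and u: "u \<in> adjoin n X"
  shows "act a m u \<in> adjoin n X"
proof -
  have swap: "act a m (act b n v) \<in> adjoin n X" if "v \<in> adjoin n X" "act a m v \<in> adjoin n X" for b v
    using that act_act[OF adjoin_carrier[OF that(1)], of a m b n]
    by (simp add: adjoin_add adjoin_sc adjoin_act_self)
  show ?thesis
    by (rule adjoin_mapsto[OF sub_closed_adjoin _ _ _ _ u]) (simp_all add: adjoin_incl act swap)
qed

text \<open>With degree sum above 1 the exchanges leave nothing behind, so the argument runs with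
  the zero subspace as target.\<close>

lemma adjoin_act_zero:
  assumes act: "\<And>x. x \<in> X \<Longrightarrow> act a m x = \<zero>\<^bsub>M\<^esub>" and m: "m + n > 1" and u: "u \<in> adjoin n X"
  shows "act a m u = \<zero>\<^bsub>M\<^esub>"
proof -
  have swap: "act a m (act b n v) = \<zero>\<^bsub>M\<^esub>" if "v \<in> carrier M" "act a m v = \<zero>\<^bsub>M\<^esub>" for b v
    using that act_act[OF that(1), of a m b n] pairing_eq_0[of "(a, m)" "(b, n)"] m by simp
  have "sub_closed {\<zero>\<^bsub>M\<^esub>}" by (simp add: sub_closed_def)
  then have "act a m u \<in> {\<zero>\<^bsub>M\<^esub>}"
    by (rule adjoin_mapsto[OF _ _ _ _ _ u]) (simp_all add: act swap X_carrier)
  then show ?thesis by simp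
qed

text \<open>The modes of degree \<open>1 - n\<close> separate the components, being dual to those of degree \<open>n\<close>.\<close>

lemma adjoin_vacuum:
  assumes act: "\<And>a x. x \<in> X \<Longrightarrow> act a (1 - n) x = \<zero>\<^bsub>M\<^esub>"
    and pair: "pairing A (Minus, 1 - n) (Plus, n) = \<xi>" "pairing A (Plus, 1 - n) (Minus, n) = \<xi>"
      "pairing A (Minus, 1 - n) (Minus, n) = 0" "pairing A (Plus, 1 - n) (Plus, n) = 0"
    and \<xi>: "\<xi> \<noteq> 0" and u: "u \<in> adjoin n X" and vac: "\<And>a. act a (1 - n) u = \<zero>\<^bsub>M\<^esub>"
  shows "u \<in> X"
proof -
  obtain w x y z where X: "w \<in> X" "x \<in> X" "y \<in> X" "z \<in> X"
    and u: "u = w \<oplus>\<^bsub>M\<^esub> act Plus n x \<oplus>\<^bsub>M\<^esub> act Minus n y \<oplus>\<^bsub>M\<^esub> act Plus n (act Minus n z)"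
    using u by (rule adjoinE)
  note C = X[THEN X_carrier]
  \<comment> \<open>Off-diagonality makes Minus in degree \<open>1 - n\<close> dual to Plus in
    degree \<open>n\<close>: up to the factor \<xi> it acts like the derivative with respect to that
    variable.\<close>
  have Minus: "act Minus (1 - n) (act Minus n v) = \<zero>\<^bsub>M\<^esub>" "act Minus (1 - n) (act Plus n v) = sc \<xi> v"
    if "v \<in> carrier M" "act Minus (1 - n) v = \<zero>\<^bsub>M\<^esub>" for v
    using that act_act[OF that(1), of Minus "1 - n"] pair by simp_all
  have Plus: "act Plus (1 - n) (act Plus n v) = \<zero>\<^bsub>M\<^esub>" "act Plus (1 - n) (act Minus n v) = sc \<xi> v"
    if "v \<in> carrier M" "act Plus (1 - n) v = \<zero>\<^bsub>M\<^esub>" for v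
    using that act_act[OF that(1), of Plus "1 - n"] pair by simp_all
  \<comment> \<open>Deriving by one variable leaves \<open>x\<close> and the term of
    \<open>z\<close>; deriving by the other one too isolates \<open>z\<close>. After that
    \<open>x\<close> and \<open>y\<close> follow in turn.\<close>
  have 1: "sc \<xi> x \<oplus>\<^bsub>M\<^esub> act Minus n (sc \<xi> z) = \<zero>\<^bsub>M\<^esub>"
    using vac[of Minus] C X unfolding u by (simp add: act_add act Minus sc_act)
  then have "act Plus (1 - n) (sc \<xi> x \<oplus>\<^bsub>M\<^esub> act Minus n (sc \<xi> z)) = \<zero>\<^bsub>M\<^esub>" by simp
  then have "sc (\<xi> * \<xi>) z = \<zero>\<^bsub>M\<^esub>"
    using C X by (simp add: act_add act Plus sc_sc X_sc)
  then have z: "z = \<zero>\<^bsub>M\<^esub>" using sc_eq_0[OF C(4)] \<xi> by simp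
  then have x: "x = \<zero>\<^bsub>M\<^esub>" using 1 C sc_eq_0[OF C(2) _ \<xi>] by simp
  have "sc \<xi> y = \<zero>\<^bsub>M\<^esub>"
    using vac[of Plus] C X unfolding u x z by (simp add: act_add act Plus)
  then have "y = \<zero>\<^bsub>M\<^esub>" using sc_eq_0[OF C(3) _ \<xi>] by simp
  then show ?thesis using X C unfolding u x z by simp
qed

end

text \<open>The span of ordered monomials in the modes of degrees -k to -1 applied to
  \<open>V\<close>. In its use \<open>V\<close> is stable under the modes \<open>n >= 0\<close>, so
  the first degree adjoined is -1.\<close>

primrec filtration :: "'v set \<Rightarrow> nat \<Rightarrow> 'v set" where
  "filtration V 0 = V"
| "filtration V (Suc k) = adjoin (- int (Suc k)) (filtration V k)"

context
  fixes V :: "'v set"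
  assumes V: "sub_closed V" and V_act: "\<And>a n x. n \<ge> 0 \<Longrightarrow> x \<in> V \<Longrightarrow> act a n x \<in> V"
    and V_vac: "\<And>a n x. n \<ge> 2 \<Longrightarrow> x \<in> V \<Longrightarrow> act a n x = \<zero>\<^bsub>M\<^esub>"
begin

lemma sub_closed_filtration: "sub_closed (filtration V k)"
  by (induction k) (simp_all only: filtration.simps V sub_closed_adjoin)

lemma filtration_mono: "j \<le> k \<Longrightarrow> filtration V j \<subseteq> filtration V k"
  by (rule lift_Suc_mono_le[of "filtration V"])
    (auto simp del: of_nat_Suc intro: adjoin_incl(1)[OF sub_closed_filtration])

lemma filtration_act: "n \<ge> - int k \<Longrightarrow> x \<in> filtration V k \<Longrightarrow> act a n x \<in> filtration V k"
proof (induction k arbitrary: x a n)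
  case 0
  then show ?case using V_act by simp
next
  case (Suc k)
  show ?case
  proof (cases "n = - int (Suc k)")
    case True
    show ?thesis
      using Suc.prems(2) unfolding True filtration.simps by (rule adjoin_act_self[OF sub_closed_filtration])
  next
    case False
    then have "n \<ge> - int k" using Suc.prems(1) by simp
    then show ?thesis
      using Suc.prems(2) unfolding filtration.simps
      by (intro adjoin_act[OF sub_closed_filtration] Suc.IH)
  qed
qed

text \<open>The bound \<open>k + 2\<close> is the least degree whose sum with \<open>- k\<close>
  exceeds 1.\<close>

lemma filtration_act_zero: "n \<ge> int k + 2 \<Longrightarrow> x \<in> filtration V k \<Longrightarrow> act a n x = \<zero>\<^bsub>M\<^esub>"
proof (induction k arbitrary: x a n)
  case 0
  then show ?case using V_vac by simp
next
  case (Suc k)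
  show ?case
  proof (rule adjoin_act_zero[OF sub_closed_filtration])
    show "act a n x = \<zero>\<^bsub>M\<^esub>" if "x \<in> filtration V k" for x
      using that Suc.prems(1) by (intro Suc.IH) simp_all
    show "x \<in> adjoin (- int (Suc k)) (filtration V k)" using Suc.prems(2) by (simp only: filtration.simps)
    show "n + - int (Suc k) > 1" using Suc.prems(1) by simp
  qed
qed

text \<open>A mode of degree \<open>n\<close> preserves every step with \<open>k >= - n\<close>, so
  the union is stable under all generators and hence under the algebra.\<close>

lemma filtration_exhausts: "submodule (\<Union>k. filtration V k) (SF A) M"
proof -
  let ?U = "\<Union>k. filtration V k"
  have closed: "x \<in> carrier M" if "x \<in> filtration V k" for x k
    using sub_closed_filtration[of k] that by (auto simp: sub_closed_def)
  have add: "x \<oplus>\<^bsub>M\<^esub> y \<in> ?U" if xy: "x \<in> ?U" "y \<in> ?U" for x y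
  proof -
    obtain j k where "x \<in> filtration V j" "y \<in> filtration V k" using xy by blast
    then have "x \<in> filtration V (max j k)" "y \<in> filtration V (max j k)"
      using filtration_mono[of j "max j k"] filtration_mono[of k "max j k"] by auto
    then have "x \<oplus>\<^bsub>M\<^esub> y \<in> filtration V (max j k)"
      using sub_closed_filtration by (auto simp: sub_closed_def)
    then show ?thesis by blast
  qed
  have sc: "sc c x \<in> ?U" if x: "x \<in> ?U" for c x
  proof -
    obtain k where "x \<in> filtration V k" using x by blast
    then have "sc c x \<in> filtration V k"
      using sub_closed_filtration[of k] by (auto simp: sub_closed_def)
    then show ?thesis by blast
  qed
  have act: "act a n x \<in> ?U" if x: "x \<in> ?U" for a n x
  proof -
    obtain k where "x \<in> filtration V k" using x by blast
    then have "x \<in> filtration V (max k (nat (- n)))"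
      using filtration_mono[of k "max k (nat (- n))"] by auto
    then have "act a n x \<in> filtration V (max k (nat (- n)))"
      by (rule filtration_act[rotated]) simp
    then show ?thesis by blast
  qed
  have U_carrier: "x \<in> carrier M" if "x \<in> ?U" for x using that closed by blast
  have smult: "s \<odot>\<^bsub>M\<^esub> x \<in> ?U" if "s \<in> SF_modes A UNIV" "x \<in> ?U" for s x
    using that unfolding SF_modes_def
  proof (induction s arbitrary: x rule: generate_ring.induct)
    case one
    then show ?case using U_carrier smult_one by simp
  next
    case (incl h)
    then consider c where "h = SF_scalar A c" | a n where "h = \<psi> A a n" by blast
    then show ?case
      by cases (simp_all only: sc[OF incl.prems] act[OF incl.prems])
  next
    case (a_inv h)
    then have h: "h \<in> carrier (SF A)"
      using SF_modes_subset[of A UNIV] unfolding SF_modes_def by blast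
    have "(\<ominus>\<^bsub>SF A\<^esub> h) \<odot>\<^bsub>M\<^esub> x = sc (- 1) (h \<odot>\<^bsub>M\<^esub> x)"
      using smult_l_minus[OF h] sc_minus smult_closed[OF h] U_carrier[OF a_inv.prems] by simp
    then show ?case using a_inv sc by simp
  next
    case (eng_add h1 h2)
    then have "h1 \<in> carrier (SF A)" "h2 \<in> carrier (SF A)"
      using SF_modes_subset[of A UNIV] unfolding SF_modes_def by blast+
    then have "(h1 \<oplus>\<^bsub>SF A\<^esub> h2) \<odot>\<^bsub>M\<^esub> x = h1 \<odot>\<^bsub>M\<^esub> x \<oplus>\<^bsub>M\<^esub> h2 \<odot>\<^bsub>M\<^esub> x"
      using smult_l_distr U_carrier[OF eng_add.prems] by blast
    then show ?case using add[OF eng_add.IH(1)[OF eng_add.prems] eng_add.IH(2)[OF eng_add.prems]] by simp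
  next
    case (eng_mult h1 h2)
    then have "h1 \<in> carrier (SF A)" "h2 \<in> carrier (SF A)"
      using SF_modes_subset[of A UNIV] unfolding SF_modes_def by blast+
    then have "(h1 \<otimes>\<^bsub>SF A\<^esub> h2) \<odot>\<^bsub>M\<^esub> x = h1 \<odot>\<^bsub>M\<^esub> (h2 \<odot>\<^bsub>M\<^esub> x)"
      using smult_assoc U_carrier[OF eng_mult.prems] by blast
    then show ?case using eng_mult.IH(1)[OF eng_mult.IH(2)[OF eng_mult.prems]] by simp
  qed
  have "\<zero>\<^bsub>M\<^esub> \<in> filtration V 0" using V by (simp add: sub_closed_def)
  then show ?thesis
    by (intro submoduleI add smult) (use closed SF_modes_UNIV[of A] in blast)+
qed

lemma vacuum:
  assumes A1: "A 1 = matrix2 \<xi> 0 0 (- \<xi>)" and \<xi>: "\<xi> \<noteq> 0"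
    and x: "x \<in> (\<Union>k. filtration V k)" and vac: "\<And>a n. n \<ge> 2 \<Longrightarrow> act a n x = \<zero>\<^bsub>M\<^esub>"
  shows "x \<in> V"
proof -
  have pair: "pairing A (Minus, 1 - n) (Plus, n) = \<xi>" "pairing A (Plus, 1 - n) (Minus, n) = \<xi>"
      "pairing A (Minus, 1 - n) (Minus, n) = 0" "pairing A (Plus, 1 - n) (Plus, n) = 0" for n
    by (simp_all add: pairing_def conn_form_entries A1 matrix2_def)
  have "x \<in> filtration V k \<Longrightarrow> x \<in> V" for k
  proof (induction k)
    case (Suc k)
    \<comment> \<open>The degree dual to \<open>- (k + 1)\<close> is \<open>k + 2\<close>: just high
      enough to kill step \<open>k\<close>, and at least 2, so that it also kills \<open>x\<close>
      by hypothesis.\<close>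
    have "x \<in> filtration V k"
    proof (rule adjoin_vacuum[OF sub_closed_filtration _ pair \<xi>])
      show "x \<in> adjoin (- int (Suc k)) (filtration V k)" using Suc.prems by simp
      show "act a (1 - - int (Suc k)) y = \<zero>\<^bsub>M\<^esub>" if "y \<in> filtration V k" for a y
        using that by (rule filtration_act_zero[rotated]) simp
      show "act a (1 - - int (Suc k)) x = \<zero>\<^bsub>M\<^esub>" for a
        by (rule vac) simp
    qed
    then show ?case by (rule Suc.IH)
  qed simp
  then show ?thesis using x by blast
qed

end

end

section \<open>The induction functor\<close>

lemma SF_sub_a_inv:
  assumes "x \<in> SF_modes A I"
  shows "\<ominus>\<^bsub>SF_sub A I\<^esub> x = \<ominus>\<^bsub>SF A\<^esub> x"
proof -
  interpret S: ring "SF A" by (rule SF_ring)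
  interpret I: ring "SF_sub A I" by (rule SF_sub_ring)
  have "x \<in> carrier (SF A)" using assms SF_modes_subset by blast
  then show ?thesis
    using assms subringE(5)[OF subring_SF_modes assms] by (intro I.minus_equality) (simp_all add: S.l_neg)
qed

text \<open>The uniqueness needed for the definite description in \<open>extended_action\<close>:
  actions of a generated subring are determined on generators, which include the scalars.\<close>

lemma left_module_SF_sub_eq:
  assumes M: "left_module (SF_sub A I) M" and N: "left_module (SF_sub A I) (M\<lparr>smult := \<rho>\<rparr>)"
    and scalar: "\<And>c v. v \<in> carrier M \<Longrightarrow> \<rho> (SF_scalar A c) v = SF_scalar A c \<odot>\<^bsub>M\<^esub> v"
    and gen: "\<And>a n v. n \<in> I \<Longrightarrow> v \<in> carrier M \<Longrightarrow> \<rho> (\<psi> A a n) v = \<psi> A a n \<odot>\<^bsub>M\<^esub> v"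
    and x: "x \<in> SF_modes A I" and v: "v \<in> carrier M"
  shows "\<rho> x v = x \<odot>\<^bsub>M\<^esub> v"
proof -
  interpret M: left_module "SF_sub A I" M by fact
  interpret N: left_module "SF_sub A I" "M\<lparr>smult := \<rho>\<rparr>" by fact
  have a_inv_N: "\<ominus>\<^bsub>M\<lparr>smult := \<rho>\<rparr>\<^esub> w = \<ominus>\<^bsub>M\<^esub> w" if "w \<in> carrier M" for w
    using that by (intro N.M.minus_equality) (simp_all add: M.M.l_neg)
  have in_modes: "h \<in> SF_modes A I" if "h \<in> generate_ring (SF A) (range (SF_scalar A) \<union> {\<psi> A a n |a n. n \<in> I})" for h
    using that by (simp add: SF_modes_def)
  show ?thesis
    using x v unfolding SF_modes_def
  proof (induction x arbitrary: v rule: generate_ring.induct)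
    case one
    then show ?case using M.smult_one N.smult_one by simp
  next
    case (incl h)
    then consider c where "h = SF_scalar A c" | a n where "h = \<psi> A a n" "n \<in> I" by blast
    then show ?case
      by cases (simp_all only: scalar[OF incl.prems] gen[OF _ incl.prems])
  next
    case (a_inv h)
    note h = in_modes[OF a_inv.hyps]
    have "(\<ominus>\<^bsub>SF A\<^esub> h) \<odot>\<^bsub>M\<^esub> v = \<ominus>\<^bsub>M\<^esub> (h \<odot>\<^bsub>M\<^esub> v)"
      using M.smult_l_minus[of h v] h a_inv.prems by (simp add: SF_sub_a_inv)
    moreover have "\<rho> (\<ominus>\<^bsub>SF A\<^esub> h) v = \<ominus>\<^bsub>M\<^esub> (\<rho> h v)"
      using N.smult_l_minus[of h v] N.smult_closed[of h v] h a_inv.prems by (simp add: SF_sub_a_inv a_inv_N)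
    ultimately show ?case using a_inv.IH[OF a_inv.prems] by simp
  next
    case (eng_add h1 h2)
    note h = in_modes[OF eng_add.hyps(1)] in_modes[OF eng_add.hyps(2)]
    show ?case
      using M.smult_l_distr[of h1 h2 v] N.smult_l_distr[of h1 h2 v] h eng_add by simp
  next
    case (eng_mult h1 h2)
    note h = in_modes[OF eng_mult.hyps(1)] in_modes[OF eng_mult.hyps(2)]
    show ?case
      using M.smult_assoc[of h1 h2 v] N.smult_assoc[of h1 h2 v] M.smult_closed[of h2 v] h eng_mult by simp
  qed
qed

text \<open>On the modes \<open>n >= 0\<close> the map \<open>proj\<close> is a ring homomorphism
  onto the modes 0 and 1, and \<open>V\<close> is pulled back along it. The value
  \<open>undefined\<close> elsewhere matches the normalization in
  \<open>extended_action\<close>.\<close>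

lemma (in sf_connection) left_module_proj_action:
  assumes V: "left_module (SF01 A) V"
  shows "left_module (SF_ge0 A) (V\<lparr>smult :=
    (\<lambda>x v. if x \<in> SF_modes A {0..} \<and> v \<in> carrier V then proj x \<odot>\<^bsub>V\<^esub> v else undefined)\<rparr>)"
    (is "left_module _ (V\<lparr>smult := ?\<rho>\<rparr>)")
proof -
  interpret V: left_module "SF01 A" V by fact
  have carr: "x \<in> carrier (SF A)" if "x \<in> SF_modes A I" for x I
    using SF_modes_subset that by blast
  have smult: "proj x \<odot>\<^bsub>V\<^esub> v \<in> carrier V" if "v \<in> carrier V" for x v
    using V.smult_closed[of "proj x" v] that proj_in by simp
  have one: "\<one>\<^bsub>SF A\<^esub> \<in> SF_modes A I" for I
    by (rule subringE(3)[OF subring_SF_modes])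
  show ?thesis
  proof (rule left_moduleI)
    show "abelian_group (V\<lparr>smult := ?\<rho>\<rparr>)"
      by (intro abelian_groupI) (auto simp: V.M.a_ac intro!: bexI[of _ "\<ominus>\<^bsub>V\<^esub> x" for x] V.M.l_neg)
  next
    fix x y v assume x: "x \<in> carrier (SF_ge0 A)" "y \<in> carrier (SF_ge0 A)" and v: "v \<in> carrier (V\<lparr>smult := ?\<rho>\<rparr>)"
    then have "x \<oplus>\<^bsub>SF A\<^esub> y \<in> SF_modes A {0..}" "x \<otimes>\<^bsub>SF A\<^esub> y \<in> SF_modes A {0..}"
      using subringE(6,7)[OF subring_SF_modes] by auto
    then show "(x \<oplus>\<^bsub>SF_ge0 A\<^esub> y) \<odot>\<^bsub>V\<lparr>smult := ?\<rho>\<rparr>\<^esub> v =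
        x \<odot>\<^bsub>V\<lparr>smult := ?\<rho>\<rparr>\<^esub> v \<oplus>\<^bsub>V\<lparr>smult := ?\<rho>\<rparr>\<^esub> y \<odot>\<^bsub>V\<lparr>smult := ?\<rho>\<rparr>\<^esub> v"
      "(x \<otimes>\<^bsub>SF_ge0 A\<^esub> y) \<odot>\<^bsub>V\<lparr>smult := ?\<rho>\<rparr>\<^esub> v = x \<odot>\<^bsub>V\<lparr>smult := ?\<rho>\<rparr>\<^esub> (y \<odot>\<^bsub>V\<lparr>smult := ?\<rho>\<rparr>\<^esub> v)"
      using x v V.smult_l_distr[of "proj x" "proj y" v] V.smult_assoc[of "proj x" "proj y" v]
        proj_add[of x y] proj_mult[of x y] proj_in carr smult by simp_all
  next
    fix v assume "v \<in> carrier (V\<lparr>smult := ?\<rho>\<rparr>)"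
    then show "\<one>\<^bsub>SF_ge0 A\<^esub> \<odot>\<^bsub>V\<lparr>smult := ?\<rho>\<rparr>\<^esub> v = v"
      using one proj_id[OF one] V.smult_one[of v] by simp
  qed (use proj_in smult V.smult_r_distr SF_sub_ring in auto)
qed

lemma (in sf_connection) extended_action_eq:
  assumes V: "left_module (SF01 A) V"
  shows "extended_action A V =
    (\<lambda>x v. if x \<in> SF_modes A {0..} \<and> v \<in> carrier V then proj x \<odot>\<^bsub>V\<^esub> v else undefined)"
    (is "_ = ?\<rho>")
proof -
  interpret V: left_module "SF01 A" V by fact
  have modes01: "x \<in> SF_modes A {0..}" if "x \<in> SF_modes A {0, 1}" for x
    using SF_modes_mono[of "{0, 1}" "{0..}" A] that by auto
  note mod = left_module_proj_action[OF V]
  show ?thesis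
    unfolding extended_action_def
  proof (rule the_equality)
    show "left_module (SF_ge0 A) (V\<lparr>smult := ?\<rho>\<rparr>) \<and>
      (\<forall>x\<in>carrier (SF01 A). \<forall>v\<in>carrier V. ?\<rho> x v = x \<odot>\<^bsub>V\<^esub> v) \<and>
      (\<forall>a. \<forall>n\<ge>2. \<forall>v\<in>carrier V. ?\<rho> (\<psi> A a n) v = \<zero>\<^bsub>V\<^esub>) \<and>
      (\<forall>x v. x \<notin> carrier (SF_ge0 A) \<or> v \<notin> carrier V \<longrightarrow> ?\<rho> x v = undefined)"
      using mod modes01 proj_id proj_\<psi> V.smult_l_null \<psi>_in_modes[of _ "{0..}" A] by auto
  next
    fix \<sigma>
    assume "left_module (SF_ge0 A) (V\<lparr>smult := \<sigma>\<rparr>) \<and>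
      (\<forall>x\<in>carrier (SF01 A). \<forall>v\<in>carrier V. \<sigma> x v = x \<odot>\<^bsub>V\<^esub> v) \<and>
      (\<forall>a. \<forall>n\<ge>2. \<forall>v\<in>carrier V. \<sigma> (\<psi> A a n) v = \<zero>\<^bsub>V\<^esub>) \<and>
      (\<forall>x v. x \<notin> carrier (SF_ge0 A) \<or> v \<notin> carrier V \<longrightarrow> \<sigma> x v = undefined)"
    then have \<sigma>: "left_module (SF_ge0 A) (V\<lparr>smult := \<sigma>\<rparr>)"
        "\<And>x v. x \<in> SF_modes A {0, 1} \<Longrightarrow> v \<in> carrier V \<Longrightarrow> \<sigma> x v = x \<odot>\<^bsub>V\<^esub> v"
        "\<And>a n v. n \<ge> 2 \<Longrightarrow> v \<in> carrier V \<Longrightarrow> \<sigma> (\<psi> A a n) v = \<zero>\<^bsub>V\<^esub>"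
        "\<And>x v. x \<notin> SF_modes A {0..} \<or> v \<notin> carrier V \<Longrightarrow> \<sigma> x v = undefined"
      by simp_all
    have "\<sigma> x v = ?\<rho> x v" if x: "x \<in> SF_modes A {0..}" and v: "v \<in> carrier V" for x v
    proof -
      have "\<sigma> x v = x \<odot>\<^bsub>V\<lparr>smult := ?\<rho>\<rparr>\<^esub> v"
      proof (rule left_module_SF_sub_eq[OF mod _ _ _ x])
        show "left_module (SF_ge0 A) (V\<lparr>smult := ?\<rho>, smult := \<sigma>\<rparr>)" using \<sigma>(1) by simp
        show "\<sigma> (SF_scalar A c) w = SF_scalar A c \<odot>\<^bsub>V\<lparr>smult := ?\<rho>\<rparr>\<^esub> w"
          if "w \<in> carrier (V\<lparr>smult := ?\<rho>\<rparr>)" for c w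
          using that \<sigma>(2) proj_id by simp
        show "\<sigma> (\<psi> A a n) w = \<psi> A a n \<odot>\<^bsub>V\<lparr>smult := ?\<rho>\<rparr>\<^esub> w"
          if n: "n \<in> {0..}" and w: "w \<in> carrier (V\<lparr>smult := ?\<rho>\<rparr>)" for a n w
        proof (cases "n \<ge> 2")
          case True
          then show ?thesis
            using n w \<sigma>(3)[OF True, of w a] \<psi>_in_modes[of n "{0..}" A a] proj_\<psi>[OF True, of a] V.smult_l_null[of w] by simp
        next
          case False
          then have "n \<in> {0, 1}" using n by auto
          then have "\<psi> A a n \<in> SF_modes A {0, 1}" by (rule \<psi>_in_modes)
          then show ?thesis
            using w \<sigma>(2)[of "\<psi> A a n" w] modes01[of "\<psi> A a n"] proj_id[of "\<psi> A a n"] by simp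
        qed
      qed (use v in simp)
      then show ?thesis by simp
    qed
    then show "\<sigma> = ?\<rho>" using \<sigma>(4) by (intro ext) auto
  qed
qed

section \<open>The unit of an induced module\<close>

locale ind_module = sf_connection A for A +
  fixes U :: "(sf, 'v) module"
  assumes U: "left_module (SF01 A) U"
begin

sublocale U: left_module "SF01 A" U by (rule U)

abbreviation "E \<equiv> extend_by_zero A U"

lemma E_simps [simp]: "carrier E = carrier U" "x \<oplus>\<^bsub>E\<^esub> y = x \<oplus>\<^bsub>U\<^esub> y" "\<zero>\<^bsub>E\<^esub> = \<zero>\<^bsub>U\<^esub>"
  by (simp_all add: extend_by_zero_def)

lemma E_smult: "b \<in> SF_modes A {0..} \<Longrightarrow> v \<in> carrier U \<Longrightarrow> b \<odot>\<^bsub>E\<^esub> v = proj b \<odot>\<^bsub>U\<^esub> v"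
  by (simp add: extend_by_zero_def extended_action_eq[OF U])

lemma proj_smult_closed [simp]: "v \<in> carrier U \<Longrightarrow> proj b \<odot>\<^bsub>U\<^esub> v \<in> carrier U"
  using U.smult_closed[of "proj b" v] proj_in by simp

lemma modes_closed: "b \<in> SF_modes A I \<Longrightarrow> b \<in> carrier (SF A)"
  using SF_modes_subset by blast

lemma left_module_E: "left_module (SF_ge0 A) E"
  using left_module_proj_action[OF U] by (simp add: extend_by_zero_def extended_action_eq[OF U])

sublocale E: extension_of_scalars "SF A" "SF_modes A {0..}" E
  using left_module_E subring_SF_modes SF_ring
  by (intro extension_of_scalars.intro extension_of_scalars_axioms.intro) (simp_all add: SF_sub_def)

lemma fobj_Ind: "fobj (Ind A) U = E.Q"
  by (simp add: Ind_def)

lemma left_module_Ind: "left_module (SF A) E.Q"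
  by (rule E.left_module_Q)

sublocale S: SF_module A E.Q
  using left_module_Ind by (intro SF_module.intro sf_connection_axioms)

abbreviation "unit v \<equiv> E.tens \<one>\<^bsub>SF A\<^esub> v"

lemma unit_closed: "v \<in> carrier U \<Longrightarrow> unit v \<in> carrier E.Q"
  by (simp add: E.tens_closed)

text \<open>Balancedness moves \<open>b\<close> across the tensor sign, where it acts through
  \<open>proj\<close>.\<close>

lemma smult_unit:
  assumes "b \<in> SF_modes A {0..}" "v \<in> carrier U"
  shows "b \<odot>\<^bsub>E.Q\<^esub> unit v = unit (proj b \<odot>\<^bsub>U\<^esub> v)"
  using assms E.smult_tens[of b "\<one>\<^bsub>SF A\<^esub>" v] E.tens_balanced[of "\<one>\<^bsub>SF A\<^esub>" b v] modes_closed[OF assms(1)]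
  by (simp add: E_smult)

lemma unit_inj:
  assumes "v \<in> carrier U" "w \<in> carrier U" "unit v = unit w"
  shows "v = w"
proof -
  have "\<one>\<^bsub>SF A\<^esub> \<in> SF_modes A {0, 1}" by (rule subringE(3)[OF subring_SF_modes])
  then have one: "proj \<one>\<^bsub>SF A\<^esub> \<odot>\<^bsub>U\<^esub> u = u" if "u \<in> carrier U" for u
    using that proj_id U.smult_one[of u] by simp
  obtain \<Phi> where "\<And>x u. x \<in> carrier (SF A) \<Longrightarrow> u \<in> carrier E \<Longrightarrow> \<Phi> (E.tens x u) = proj x \<odot>\<^bsub>U\<^esub> u"
  proof (rule E.universal[OF U.M.abelian_group_axioms, where \<phi> = "\<lambda>x u. proj x \<odot>\<^bsub>U\<^esub> u"])
    fix x y u assume "x \<in> carrier (SF A)" "y \<in> carrier (SF A)" "u \<in> carrier E"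
    then show "proj (x \<oplus>\<^bsub>SF A\<^esub> y) \<odot>\<^bsub>U\<^esub> u = proj x \<odot>\<^bsub>U\<^esub> u \<oplus>\<^bsub>U\<^esub> proj y \<odot>\<^bsub>U\<^esub> u"
      using U.smult_l_distr[of "proj x" "proj y" u] proj_in by (simp add: proj_add)
  next
    fix x u u' assume "x \<in> carrier (SF A)" "u \<in> carrier E" "u' \<in> carrier E"
    then show "proj x \<odot>\<^bsub>U\<^esub> (u \<oplus>\<^bsub>E\<^esub> u') = proj x \<odot>\<^bsub>U\<^esub> u \<oplus>\<^bsub>U\<^esub> proj x \<odot>\<^bsub>U\<^esub> u'"
      using U.smult_r_distr[of "proj x" u u'] proj_in by simp
  next
    fix x b u assume "x \<in> carrier (SF A)" "b \<in> SF_modes A {0..}" "u \<in> carrier E"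
    then show "proj (x \<otimes>\<^bsub>SF A\<^esub> b) \<odot>\<^bsub>U\<^esub> u = proj x \<odot>\<^bsub>U\<^esub> (b \<odot>\<^bsub>E\<^esub> u)"
      using U.smult_assoc[of "proj x" "proj b" u] proj_in by (simp add: proj_mult E_smult)
  next
    fix \<Phi> assume "\<And>x u. x \<in> carrier (SF A) \<Longrightarrow> u \<in> carrier E \<Longrightarrow> \<Phi> (E.tens x u) = proj x \<odot>\<^bsub>U\<^esub> u"
    then show thesis by (rule that)
  qed simp
  then show ?thesis using assms one by (metis E_simps(1) E.one_closed)
qed

lemma unit_add: "v \<in> carrier U \<Longrightarrow> w \<in> carrier U \<Longrightarrow> unit (v \<oplus>\<^bsub>U\<^esub> w) = unit v \<oplus>\<^bsub>E.Q\<^esub> unit w"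
  using E.tens_add_right[of "\<one>\<^bsub>SF A\<^esub>" v w] by simp

lemma unit_zero: "unit \<zero>\<^bsub>U\<^esub> = \<zero>\<^bsub>E.Q\<^esub>"
  using E.tens_zero_right[of "\<one>\<^bsub>SF A\<^esub>"] by simp

lemma act_unit_eq_0: "n \<ge> 2 \<Longrightarrow> v \<in> carrier U \<Longrightarrow> S.act a n (unit v) = \<zero>\<^bsub>E.Q\<^esub>"
  using smult_unit[of "\<psi> A a n" v] \<psi>_in_modes[of n "{0..}" A a] U.smult_l_null[of v]
  by (simp add: proj_\<psi> unit_zero)

lemma vacuum_Ind:
  assumes "A 1 = matrix2 \<xi> 0 0 (- \<xi>)" "\<xi> \<noteq> 0"
    and S: "S \<in> carrier E.Q" and vac: "\<And>a n. n \<ge> 2 \<Longrightarrow> S.act a n S = \<zero>\<^bsub>E.Q\<^esub>"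
  shows "\<exists>v\<in>carrier U. S = unit v"
proof -
  let ?V = "unit ` carrier U"
  have V: "S.sub_closed ?V"
    unfolding S.sub_closed_def
  proof (intro conjI ballI allI)
    show "\<zero>\<^bsub>E.Q\<^esub> \<in> ?V" using unit_zero U.M.zero_closed by (metis imageI)
    show "x \<oplus>\<^bsub>E.Q\<^esub> y \<in> ?V" if "x \<in> ?V" "y \<in> ?V" for x y
      using that by (auto simp flip: unit_add)
    show "S.sc c x \<in> ?V" if "x \<in> ?V" for c x
      using that by (auto simp: smult_unit)
  qed (auto simp: unit_closed)
  have V_act: "S.act a n x \<in> ?V" if "n \<ge> 0" "x \<in> ?V" for a n x
    using that \<psi>_in_modes[of n "{0..}" A a] by (auto simp: smult_unit)
  have V_vac: "S.act a n x = \<zero>\<^bsub>E.Q\<^esub>" if "n \<ge> 2" "x \<in> ?V" for a n x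
    using that act_unit_eq_0 by blast
  have sub: "submodule (\<Union>k. S.filtration ?V k) (SF A) E.Q"
    by (rule S.filtration_exhausts[OF V V_act V_vac])
  note cl = S.submodule_closed[OF sub]
  \<comment> \<open>A pure tensor is \<open>x\<close> applied to \<open>unit v\<close>, so a
    submodule containing all units is everything.\<close>
  have mem: "S \<in> (\<Union>k. S.filtration ?V k)"
    using S
  proof (induction S rule: E.Q_induct)
    case (tens x v)
    then have "unit v \<in> S.filtration ?V 0" by simp
    then have "unit v \<in> (\<Union>k. S.filtration ?V k)" by blast
    then show ?case
      using tens cl(4)[of x "unit v"] E.tens_eq_smult[of x v] by simp
  next
    case (add S S')
    show ?case by (rule cl(3)[OF add(3,4)])
  qed
  have "S \<in> ?V"
    by (rule S.vacuum[OF V V_act V_vac assms(1,2) mem vac])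
  then show ?thesis by blast
qed

end

section \<open>Induction on morphisms\<close>

locale ind_module_pair = V: ind_module A V + W: ind_module A W
  for A and V W :: "(sf, 'v) module"
begin

text \<open>On both sides the modes \<open>n >= 0\<close> act through \<open>proj\<close>, that is
  through elements with which \<open>f\<close> commutes.\<close>

lemma module_hom_extend:
  assumes f: "f \<in> module_hom (SF01 A) V W"
  shows "f \<in> module_hom ((SF A)\<lparr>carrier := SF_modes A {0..}\<rparr>) V.E W.E"
proof (rule module_homI)
  show "f \<in> extensional (carrier V.E)" using module_hom_extensional[OF f] by simp
qed (use module_hom_closed[OF f] module_hom_add[OF f] module_hom_smult[OF f] V.proj_in
    in \<open>simp_all add: V.E_smult W.E_smult\<close>)

lemma extension_pair:
  "f \<in> module_hom (SF01 A) V W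
    \<Longrightarrow> extension_pair (SF A) (SF_modes A {0..}) V.E W.E f"
  using module_hom_extend V.E.extension_of_scalars_axioms W.E.extension_of_scalars_axioms
  by (intro extension_pair.intro extension_pair_axioms.intro)

lemma fmor_Ind: "fmor (Ind A) V W f = induced_map (SF A) (SF_modes A {0..}) V.E W.E f"
  by (simp add: Ind_def)

lemma fmor_Ind_hom: "f \<in> module_hom (SF01 A) V W \<Longrightarrow> fmor (Ind A) V W f \<in> module_hom (SF A) V.E.Q W.E.Q"
  unfolding fmor_Ind by (rule extension_pair.induced_map_hom[OF extension_pair])

lemma fmor_Ind_unit:
  "f \<in> module_hom (SF01 A) V W \<Longrightarrow> v \<in> carrier V \<Longrightarrow> fmor (Ind A) V W f (V.unit v) = W.unit (f v)"
  unfolding fmor_Ind using extension_pair.induced_map_tens[OF extension_pair, of f "\<one>\<^bsub>SF A\<^esub>" v] by simp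

text \<open>Faithfulness is injectivity of the unit. For fullness, \<open>F\<close> sends
  \<open>unit v\<close> to a vacuum vector, hence to a unit of some vector, which becomes
  \<open>f v\<close>; linearity of \<open>f\<close> is read off from \<open>F\<close> by injectivity
  of the unit.\<close>

lemma bij_betw_fmor_Ind:
  assumes A1: "A 1 = matrix2 \<xi> 0 0 (- \<xi>)" "\<xi> \<noteq> 0"
  shows "bij_betw (fmor (Ind A) V W) (module_hom (SF01 A) V W) (module_hom (SF A) V.E.Q W.E.Q)"
proof (rule bij_betwI')
  fix f g assume f: "f \<in> module_hom (SF01 A) V W" and g: "g \<in> module_hom (SF01 A) V W"
  show "fmor (Ind A) V W f = fmor (Ind A) V W g \<longleftrightarrow> f = g"
  proof
    assume eq: "fmor (Ind A) V W f = fmor (Ind A) V W g"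
    show "f = g"
    proof (rule extensionalityI[OF module_hom_extensional[OF f] module_hom_extensional[OF g]])
      fix v assume v: "v \<in> carrier V"
      have "W.unit (f v) = W.unit (g v)"
        using fmor_Ind_unit[OF f v] fmor_Ind_unit[OF g v] eq by simp
      then show "f v = g v"
        by (rule W.unit_inj[OF module_hom_closed[OF f v] module_hom_closed[OF g v]])
    qed
  qed simp
next
  fix F assume F: "F \<in> module_hom (SF A) V.E.Q W.E.Q"
  have "\<exists>w. w \<in> carrier W \<and> F (V.unit v) = W.unit w" if v: "v \<in> carrier V" for v
  proof -
    have u: "V.unit v \<in> carrier V.E.Q" using v by (rule V.unit_closed)
    have "\<exists>w\<in>carrier W. F (V.unit v) = W.unit w"
    proof (rule W.vacuum_Ind[OF A1 module_hom_closed[OF F u]])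
      fix a and n :: int assume n: "n \<ge> 2"
      have "W.S.act a n (F (V.unit v)) = F (V.S.act a n (V.unit v))"
        by (rule module_hom_smult[OF F _ u, symmetric]) simp
      also have "\<dots> = \<zero>\<^bsub>W.E.Q\<^esub>"
        unfolding V.act_unit_eq_0[OF n v]
        by (rule module_hom_zero[OF V.E.abelian_group_Q W.E.abelian_group_Q F])
      finally show "W.S.act a n (F (V.unit v)) = \<zero>\<^bsub>W.E.Q\<^esub>" .
    qed
    then show ?thesis by blast
  qed
  then obtain f' where f': "\<And>v. v \<in> carrier V \<Longrightarrow> f' v \<in> carrier W \<and> F (V.unit v) = W.unit (f' v)"
    by metis
  define f where "f = restrict f' (carrier V)"
  have f_closed: "f v \<in> carrier W" and F_unit: "F (V.unit v) = W.unit (f v)" if "v \<in> carrier V" for v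
    using f'[OF that] that by (simp_all add: f_def)
  have f: "f \<in> module_hom (SF01 A) V W"
  proof (rule module_homI)
    fix v w assume v: "v \<in> carrier V" and w: "w \<in> carrier V"
    have "W.unit (f (v \<oplus>\<^bsub>V\<^esub> w)) = W.unit (f v \<oplus>\<^bsub>W\<^esub> f w)"
      using v w module_hom_add[OF F, of "V.unit v" "V.unit w"]
      by (simp add: V.unit_closed f_closed W.unit_add V.unit_add flip: F_unit)
    then show "f (v \<oplus>\<^bsub>V\<^esub> w) = f v \<oplus>\<^bsub>W\<^esub> f w"
      using v w by (intro W.unit_inj) (simp_all add: f_closed)
  next
    fix b v assume b: "b \<in> carrier (SF01 A)" and v: "v \<in> carrier V"
    then have b': "b \<in> SF_modes A {0..}" "V.proj b = b" "b \<in> carrier (SF A)"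
      using SF_modes_mono[of "{0, 1}" "{0..}" A] V.proj_id V.modes_closed by auto
    have bv: "b \<odot>\<^bsub>V\<^esub> v \<in> carrier V" by (rule V.U.smult_closed[OF b v])
    have bw: "b \<odot>\<^bsub>W\<^esub> f v \<in> carrier W" by (rule W.U.smult_closed[OF b f_closed[OF v]])
    have "W.unit (f (b \<odot>\<^bsub>V\<^esub> v)) = F (b \<odot>\<^bsub>V.E.Q\<^esub> V.unit v)"
      using F_unit[OF bv] V.smult_unit[OF b'(1) v] b'(2) by simp
    also have "\<dots> = b \<odot>\<^bsub>W.E.Q\<^esub> W.unit (f v)"
      using module_hom_smult[OF F b'(3) V.unit_closed[OF v]] F_unit[OF v] by simp
    also have "\<dots> = W.unit (b \<odot>\<^bsub>W\<^esub> f v)"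
      using W.smult_unit[OF b'(1) f_closed[OF v]] b'(2) by simp
    finally show "f (b \<odot>\<^bsub>V\<^esub> v) = b \<odot>\<^bsub>W\<^esub> f v"
      by (rule W.unit_inj[OF f_closed[OF bv] bw])
  qed (simp_all add: f_closed, simp add: f_def)
  have "fmor (Ind A) V W f = F"
  proof (rule V.E.module_hom_Q_eqI[OF fmor_Ind_hom[OF f] F])
    fix v assume "v \<in> carrier V.E"
    then have v: "v \<in> carrier V" by simp
    show "fmor (Ind A) V W f (V.unit v) = F (V.unit v)"
      unfolding fmor_Ind_unit[OF f v] F_unit[OF v] ..
  qed
  then show "\<exists>f\<in>module_hom (SF01 A) V W. F = fmor (Ind A) V W f" using f by blast
qed (rule fmor_Ind_hom)

end

context sf_connection
begin

lemma ind_module: "left_module (SF01 A) V \<Longrightarrow> ind_module A V"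
  by (simp add: ind_module.intro ind_module_axioms.intro sf_connection_axioms)

lemma ind_module_pair: "left_module (SF01 A) V \<Longrightarrow> left_module (SF01 A) W \<Longrightarrow> ind_module_pair A V W"
  by (simp add: ind_module_pair.intro ind_module)

text \<open>Both functor laws are compared on units, which generate the induced module.\<close>

lemma is_functor_Ind: "is_functor (Rep (SF01 A)) (Rep (SF A)) (Ind A :: 'v ind_functor)"
proof (intro is_functor.intro is_functor_axioms.intro category_Rep)
  fix V :: "(sf, 'v) module" assume "V \<in> Obj (Rep (SF01 A))"
  then have V: "left_module (SF01 A) V" by (simp add: Rep_simps)
  interpret V: ind_module A V by (rule ind_module[OF V])
  interpret VV: ind_module_pair A V V by (rule ind_module_pair[OF V V])
  show "fobj (Ind A) V \<in> Obj (Rep (SF A))"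
    unfolding V.fobj_Ind Rep_simps by (rule V.left_module_Ind)
  note i = module_hom_id[OF V]
  show "fmor (Ind A) V V (Id (Rep (SF01 A)) V) = Id (Rep (SF A)) (fobj (Ind A) V)"
    unfolding V.fobj_Ind Rep_simps
    by (rule V.E.module_hom_Q_eqI[OF VV.fmor_Ind_hom[OF i] module_hom_id[OF V.left_module_Ind]])
      (use VV.fmor_Ind_unit[OF i] V.unit_closed in simp)
next
  fix V W :: "(sf, 'v) module" and f
  assume "V \<in> Obj (Rep (SF01 A))" "W \<in> Obj (Rep (SF01 A))" "f \<in> Hom (Rep (SF01 A)) V W"
  then have V: "left_module (SF01 A) V" "left_module (SF01 A) W" and f: "f \<in> module_hom (SF01 A) V W"
    by (simp_all add: Rep_simps)
  interpret VW: ind_module_pair A V W by (rule ind_module_pair[OF V])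
  show "fmor (Ind A) V W f \<in> Hom (Rep (SF A)) (fobj (Ind A) V) (fobj (Ind A) W)"
    unfolding VW.V.fobj_Ind VW.W.fobj_Ind Rep_simps by (rule VW.fmor_Ind_hom[OF f])
next
  fix V W X :: "(sf, 'v) module" and f g
  assume "V \<in> Obj (Rep (SF01 A))" "W \<in> Obj (Rep (SF01 A))" "X \<in> Obj (Rep (SF01 A))"
    and "f \<in> Hom (Rep (SF01 A)) V W" "g \<in> Hom (Rep (SF01 A)) W X"
  then have V: "left_module (SF01 A) V" "left_module (SF01 A) W" "left_module (SF01 A) X"
    and f: "f \<in> module_hom (SF01 A) V W" and g: "g \<in> module_hom (SF01 A) W X"
    by (simp_all add: Rep_simps)
  interpret VW: ind_module_pair A V W by (rule ind_module_pair[OF V(1,2)])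
  interpret WX: ind_module_pair A W X by (rule ind_module_pair[OF V(2,3)])
  interpret VX: ind_module_pair A V X by (rule ind_module_pair[OF V(1,3)])
  note gf = module_hom_compose[OF f g V(1)]
  note Ff = VW.fmor_Ind_hom[OF f] and Fg = WX.fmor_Ind_hom[OF g]
  show "fmor (Ind A) V X (Comp (Rep (SF01 A)) V W X g f) =
      Comp (Rep (SF A)) (fobj (Ind A) V) (fobj (Ind A) W) (fobj (Ind A) X) (fmor (Ind A) W X g) (fmor (Ind A) V W f)"
    unfolding VW.V.fobj_Ind VW.W.fobj_Ind WX.W.fobj_Ind Rep_simps
  proof (rule VW.V.E.module_hom_Q_eqI[OF VX.fmor_Ind_hom[OF gf] module_hom_compose[OF Ff Fg VW.V.left_module_Ind]])
    fix v assume "v \<in> carrier VW.V.E"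
    then have v: "v \<in> carrier V" by simp
    show "fmor (Ind A) V X (compose (carrier V) g f) (VW.V.unit v) =
        compose (carrier VW.V.E.Q) (fmor (Ind A) W X g) (fmor (Ind A) V W f) (VW.V.unit v)"
      unfolding compose_eq[OF VW.V.unit_closed[OF v]] VW.fmor_Ind_unit[OF f v]
        WX.fmor_Ind_unit[OF g module_hom_closed[OF f v]] VX.fmor_Ind_unit[OF gf v] compose_eq[OF v] ..
  qed
qed

lemma fully_faithful_Ind:
  assumes A1: "A 1 = matrix2 \<xi> 0 0 (- \<xi>)" "\<xi> \<noteq> 0"
  shows "fully_faithful (Rep (SF01 A)) (Rep (SF A)) (Ind A :: 'v ind_functor)"
  unfolding fully_faithful_def
proof (intro conjI ballI is_functor_Ind)
  fix V W :: "(sf, 'v) module" assume "V \<in> Obj (Rep (SF01 A))" "W \<in> Obj (Rep (SF01 A))"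
  then have V: "left_module (SF01 A) V" "left_module (SF01 A) W" by (simp_all add: Rep_simps)
  interpret VW: ind_module_pair A V W by (rule ind_module_pair[OF V])
  show "bij_betw (fmor (Ind A) V W) (Hom (Rep (SF01 A)) V W) (Hom (Rep (SF A)) (fobj (Ind A) V) (fobj (Ind A) W))"
    unfolding VW.V.fobj_Ind VW.W.fobj_Ind Rep_simps by (rule VW.bij_betw_fmor_Ind[OF A1])
qed

end

section \<open>Restriction to the essential image\<close>

lemma full_subcategory_simps [simp]:
  "Obj (full_subcategory C S) = Obj C \<inter> S" "Hom (full_subcategory C S) = Hom C"
  "Id (full_subcategory C S) = Id C" "Comp (full_subcategory C S) = Comp C"
  by (simp_all add: full_subcategory_def)

lemma isomorphic_in_full_subcategory [simp]:
  "isomorphic_in (full_subcategory C S) X Y \<longleftrightarrow> isomorphic_in C X Y"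
  by (simp add: isomorphic_in_def iso_in_def)

lemma (in category) category_full_subcategory: "category (full_subcategory C S)"
  by standard (auto simp: Id_in Comp_in Comp_Id_left Comp_Id_right Comp_assoc)

text \<open>A full subcategory keeps the Hom-sets, so full faithfulness persists, and essential
  surjectivity holds by the choice of objects.\<close>

lemma categorical_equivalence_essential_image:
  assumes ff: "fully_faithful C D F"
  shows "categorical_equivalence C (full_subcategory D (essential_image C D F)) F"
proof -
  let ?D = "full_subcategory D (essential_image C D F)"
  interpret F: is_functor C D F using ff by (simp add: fully_faithful_def)
  have im: "fobj F X \<in> essential_image C D F" if "X \<in> Obj C" for X
    using that F.fobj_in[OF that] F.D.iso_in_Id[of "fobj F X"]
    by (auto simp: essential_image_def isomorphic_in_def)
  interpret D: category ?D by (rule F.D.category_full_subcategory)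
  show ?thesis
  proof
    show "bij_betw (fmor F X Y) (Hom C X Y) (Hom ?D (fobj F X) (fobj F Y))" if "X \<in> Obj C" "Y \<in> Obj C" for X Y
      using ff that by (simp add: fully_faithful_def)
    show "\<exists>X\<in>Obj C. isomorphic_in ?D Y (fobj F X)" if "Y \<in> Obj ?D" for Y
      using that by (simp add: essential_image_def)
  qed (simp_all add: F.fobj_in im F.fmor_in F.fmor_Id F.fmor_Comp)
qed

theorem corollary3p3:
  fixes A :: "int \<Rightarrow> sign_matrix" and \<xi> :: complex
  assumes "\<And>k. A k \<in> sl2"
    and "\<And>k. k > 1 \<Longrightarrow> A k = 0"
    and "A 1 = matrix2 \<xi> 0 0 (- \<xi>)"
    and "\<xi> \<noteq> 0"
  shows "fully_faithful (Rep (SF01 A)) (Rep (SF A)) (Ind A :: 'v ind_functor)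
    \<and> equivalence_of_categories (Rep (SF01 A)) (Ind_category A) (Ind A :: 'v ind_functor)
    \<and> {M. simple_object (Ind_category A) M} =
        {M \<in> Obj (Rep (SF A)). \<exists>V. simple_module (SF01 A) V \<and>
          isomorphic_in (Rep (SF A)) M (fobj (Ind A :: 'v ind_functor) V)}"
proof -
  interpret sf_connection A using assms(1,2) by unfold_locales
  have ff: "fully_faithful (Rep (SF01 A)) (Rep (SF A)) (Ind A :: 'v ind_functor)"
    by (rule fully_faithful_Ind[OF assms(3,4)])
  interpret Ind: categorical_equivalence "Rep (SF01 A)" "Ind_category A" "Ind A :: 'v ind_functor"
    unfolding Ind_category_def by (rule categorical_equivalence_essential_image[OF ff])
  have "{M. simple_object (Ind_category A) M} =
      {M \<in> Obj (Ind_category A). \<exists>V. simple_module (SF01 A) V \<and>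
        isomorphic_in (Rep (SF A)) M (fobj (Ind A :: 'v ind_functor) V)}"
    unfolding Ind.simple_objects simple_object_Rep by (simp add: Ind_category_def)
  \<comment> \<open>An isomorphism to an induced module already places \<open>M\<close> in the image
    category.\<close>
  also have "\<dots> = {M \<in> Obj (Rep (SF A)). \<exists>V. simple_module (SF01 A) V \<and>
        isomorphic_in (Rep (SF A)) M (fobj (Ind A :: 'v ind_functor) V)}"
    by (auto simp: Ind_category_def essential_image_def Rep_simps simple_module_def)
  finally show ?thesis
    using ff Ind.equivalence by blast
qed

end
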